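(* Let $g:\mathbb S^n\to\mathbb R$ be convex and differentiable, and let $g$ be $L_g$-smooth on $\Delta^n$, i.e., $L_g\ge 0$ is such that $\|\nabla g(Z')-\nabla g(Z)\|_F\le L_g\|Z'-Z\|_F$ for all $Z,Z'\in\Delta^n$. Let $g_*:=\min\{g(Z):Z\in\Delta^n\}$. Run the HLR method (described in the context) with input $(\bar Y_0,g,\bar\epsilon,\bar\rho,\lambda_0)$, where $\bar Y_0\in\bar B_1^{s_0}$ for some $s_0\ge1$ and $\bar\epsilon,\bar\rho,\lambda_0>0$. Put $\bar Z_0=\bar Y_0\bar Y_0^T$. Then: (a) the HLR method outputs a point $\bar Y$ such that $\bar Z=\bar Y\bar Y^T$ is an $\bar\epsilon$-optimal solution of $\min\{g(Z):Z\in\Delta^n\}$ in at most $$\mathcal S(\bar\epsilon):=\left\lceil 1+\frac{4\max\left\{g(\bar Z_0)-g_*,\ \sqrt{4L_g(g(\bar Z_0)-g_* )},\ 4L_g\right\}}{\bar\epsilon}\right\rceil$$ iterations (and hence minimum eigenvector computations); (b) the total number of ADAP-FISTA calls performed by the HLR method is no more than $$(1+\mathcal Q)\,\mathcal S(\bar\epsilon)+\frac{C_\sigma\max\{8\bar G+144L_g,\,1/\lambda_0\}}{\bar\rho^2}\left[g(\bar Z_0)-g(\bar Z)\right],$$ where $$\bar G:=\sup\{\|\nabla g(UU^T)\|_F:\ U\in\bar B_3\},\qquad C_\sigma:=\frac{2(1-\sigma)^2}{1-2\sigma},$$ $$\mathcal Q:=\left\lceil \log_0^+\!\left(\lambda_0\max\{8\bar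 G+144L_g,\,1/\lambda_0\}\right)/\log 2\right\rceil ,$$ and $\bar B_3=\bar B_3^s$ with $s$ the column dimension of the factorized problem $\min\{g(UU^T):U\in\bar B_1^s\}$ treated by ADAP-AIPP.
   Context: Notation. $\mathbb S^n$ is the space of real symmetric $n\times n$ matrices, $\bullet$ and $\|\cdot\|_F$ the Frobenius inner product and norm (also used on $\mathbb R^{n\times s}$). $\Delta^n:=\{X\in\mathbb S^n:\mathrm{tr}X\le1,\ X\succeq0\}$. $\bar B_r^s:=\{U\in\mathbb R^{n\times s}:\|U\|_F\le r\}$. $\delta_C$ is the indicator function of $C$. $\log_0^+(t)=\max\{\log t,0\}$. For $Q\in\mathbb S^n$, $\lambda_{\min}(Q)$ is its minimum eigenvalue and $v_{\min}(Q)$ a corresponding unit-norm eigenvector. For differentiable $\psi$, $\ell_\psi(u;x):=\psi(x)+\langle\nabla\psi(x),u-x\rangle$. Universal parameters $\sigma\in(0,1/2)$ and $\chi\in(0,1)$ are fixed throughout. $\epsilon$-optimal solution: $Z\in\Delta^n$ such that $0\in\nabla g(Z)+\partial_\epsilon\delta_{\Delta^n}(Z)$, equivalently $\nabla g(Z)\bullet Z+\max\{-\lambda_{\min}(\nabla g(Z)),0\}\le\epsilon$. Here $\partial_\epsilon h(z)=\{u: h(z')\ge h(z)+\langle u,z'-z\rangle-\epsilon\ \forall z'\}$. ADAP-FISTA method. Input: initial point $x_0\in\mathcal N$, scalars $\mu>0$, $L_0>\mu$, and a pair $(\psi_s,\psi_n)$ with $\psi_s$ differentiable and $\psi_n$ proper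 closed convex with bounded domain $\mathcal N$. (0) Set $y_0=x_0$, $A_0=0$, $\tau_0=1$, $i=0$. (1) Set $L_{i+1}=L_i$. (2) Compute $a_i=\frac{\tau_i+\sqrt{\tau_i^2+4\tau_iA_i(L_{i+1}-\mu)}}{2(L_{i+1}-\mu)}$, $\tilde x_i=\frac{A_iy_i+a_ix_i}{A_i+a_i}$, $y_{i+1}=\arg\min_{u\in\mathcal N}\{\ell_{\psi_s}(u;\tilde x_i)+\psi_n(u)+\frac{L_{i+1}}2\|u-\tilde x_i\|^2\}$. If $\ell_{\psi_s}(y_{i+1};\tilde x_i)+\frac{(1-\chi)L_{i+1}}4\|y_{i+1}-\tilde x_i\|^2\ge\psi_s(y_{i+1})$, go to (3); else set $L_{i+1}\leftarrow2L_{i+1}$ and repeat (2). (3) Compute $A_{i+1}=A_i+a_i$, $\tau_{i+1}=\tau_i+a_i\mu$, $s_{i+1}=(L_{i+1}-\mu)(\tilde x_i-y_{i+1})$, $x_{i+1}=\frac1{\tau_{i+1}}[\mu a_iy_{i+1}+\tau_ix_i-a_is_{i+1}]$. (4) If $\|y_{i+1}-x_0\|^2\ge\chi A_{i+1}L_{i+1}\|y_{i+1}-\tilde x_i\|^2$, go to (5); otherwise stop with failure. (5) Compute $v_{i+1}=\nabla\psi_s(y_{i+1})-\nabla\psi_s(\tilde x_i)+L_{i+1}(\tilde x_i-y_{i+1})$. If $\|v_{i+1}\|\le\sigma\|y_{i+1}-x_0\|$, stop with success and output $(y,v,L)=(y_{i+1},v_{i+1},L_{i+1})$; otherwise set $i\leftarrow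 i+1$ and go to (1). ADAP-AIPP method. Input: $(\tilde g,\lambda_0,\underline W,\bar\rho)$, where for a fixed $s$, $\tilde g(U):=g(UU^T)$ on $\mathbb R^{n\times s}$, $\lambda_0>0$, $\underline W\in\bar B_1^s$, $\bar\rho>0$. (0) Set $W_0=\underline W$, $j=1$, $\lambda=\lambda_0$, $\bar M_0=1$. (1) Choose $\underline M_j\in[1,\bar M_{j-1}]$ and call ADAP-FISTA with $x_0=W_{j-1}$, $(\mu,L_0)=(1/2,\underline M_j)$, $\psi_s=\lambda\tilde g+\frac12\|\cdot-W_{j-1}\|_F^2$, $\psi_n=\lambda\delta_{\bar B_1^s}$. (2) If ADAP-FISTA fails, or it succeeds but its output $(W,V,L)$ does not satisfy $\lambda\tilde g(W_{j-1})-[\lambda\tilde g(W)+\frac12\|W-W_{j-1}\|_F^2]\ge V\bullet(W_{j-1}-W)$, set $\lambda\leftarrow\lambda/2$ and go to (1). Otherwise set $(\lambda_j,\bar M_j)=(\lambda,L)$, $(W_j,V_j)=(W,V)$, $R_j=(V_j+W_{j-1}-W_j)/\lambda_j$ and go to (3). (3) If $\|R_j\|_F\le\bar\rho$, stop and output $(\overline W,\overline R)=(W_j,R_j)$; else go to (4). (4) Set $j\leftarrow j+1$ and go to (1). HLR method. Input $(\bar Y_0,g,\bar\epsilon,\bar\rho,\lambda_0)$ with $\bar Y_0\in\bar B_1^{s_0}$. (0) Set $\tilde Y_0=\bar Y_0$, $s=s_0$, $k=1$. (1) Call ADAP-AIPP (with the current column dimension $s$, $\tilde g(U)=g(UU^T)$)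 with $\lambda_0$, $\bar\rho$ and $\underline W=\tilde Y_{k-1}$, and let $(Y_k,\mathcal R_k)$ be its output. (2) Let $G_k=\nabla g(Y_kY_k^T)$; by computing a minimum eigenpair of $G_k$ (a minimum eigenvector computation) set $\theta_k=\max\{-\lambda_{\min}(G_k),0\}$, and $y_k=v_{\min}(G_k)$ if $\theta_k>0$, $y_k=0$ otherwise. (3) Set $\epsilon_k=(G_kY_k)\bullet Y_k+\theta_k$. If $\epsilon_k\le\bar\epsilon$, stop and output $(\bar Y,\bar\theta)=(Y_k,\theta_k)$; else go to (4). (4) Compute $\alpha_k=\arg\min_\alpha\{g(\alpha y_ky_k^T+(1-\alpha)Y_kY_k^T):\alpha\in[0,1]\}$ and set $(\tilde Y_k,s)=(y_k,1)$ if $\alpha_k=1$, and $(\tilde Y_k,s)=([\sqrt{1-\alpha_k}\,Y_k,\ \sqrt{\alpha_k}\,y_k],\,s+1)$ otherwise. (5) Set $k\leftarrow k+1$ and go to (1). *)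

theory Defs
  imports "HOL-Analysis.Analysis"
begin

section \<open>Symmetric matrices\<close>

text \<open>
  On \<open>real^'n^'n\<close> the library's inner product and norm are the Frobenius inner product and norm.
  A function on symmetric matrices is a function on \<open>real^'n^'n\<close> of which only the values on
  \<open>sym_mats\<close> are ever used.
\<close>

definition sym_mats :: "(real^'n^'n) set" where
  "sym_mats = {X. transpose X = X}"

definition psd :: "real^'n^'n \<Rightarrow> bool" where
  "psd X \<longleftrightarrow> X \<in> sym_mats \<and> (\<forall>v. 0 \<le> v \<bullet> (X *v v))"

definition spectraplex :: "(real^'n^'n) set" where
  "spectraplex = {X \<in> sym_mats. trace X \<le> 1 \<and> psd X}"

definition is_eigenpair :: "real^'n^'n \<Rightarrow> real \<Rightarrow> real^'n \<Rightarrow> bool" where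
  "is_eigenpair Q c v \<longleftrightarrow> v \<noteq> 0 \<and> Q *v v = c *\<^sub>R v"

definition lambda_min :: "real^'n^'n \<Rightarrow> real" where
  "lambda_min Q = Min {c. \<exists>v. is_eigenpair Q c v}"

definition outer :: "real^'n \<Rightarrow> real^'n^'n" where
  "outer y = (\<chi> a b. y $ a * y $ b)"


section \<open>Matrices with \<open>n\<close> rows and a varying number of columns\<close>

text \<open>
  The column dimension \<open>s\<close> changes while the method runs, so it cannot be a type index.  All
  matrices with rows indexed by \<open>'n\<close> live in one inner product space \<open>'n cmat\<close>, the finitely
  supported sequences of columns; the space of matrices with \<open>s\<close> columns is its linear subspace
  \<open>mats s\<close>, whose columns are numbered \<open>0,\<dots>,s-1\<close>.
\<close>

typedef (overloaded) ('n::finite) cmat = "{f :: nat \<Rightarrow> real^'n. finite {j. f j \<noteq> 0}}"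
  morphisms col Abs_cmat
  by (rule exI[of _ "\<lambda>_. 0"]) simp

lemma finite_col [simp]: "finite {j. col U j \<noteq> 0}"
  using col[of U] by simp

lemma cmat_eqI: "(\<And>j. col U j = col V j) \<Longrightarrow> U = V"
  by (metis col_inject ext)

lemma col_Abs_cmat: "finite {j. f j \<noteq> 0} \<Longrightarrow> col (Abs_cmat f) = f"
  by (simp add: Abs_cmat_inverse)

instantiation cmat :: (finite) real_inner
begin

definition "0 = Abs_cmat (\<lambda>_. 0)"
definition "U + V = Abs_cmat (\<lambda>j. col U j + col V j)"
definition "U - V = Abs_cmat (\<lambda>j. col U j - col V j)"
definition "- U = Abs_cmat (\<lambda>j. - col U j)"
definition "r *\<^sub>R U = Abs_cmat (\<lambda>j. r *\<^sub>R col U j)"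
text \<open>The Frobenius inner product: the sum over all columns (the others contribute nothing).\<close>
definition "U \<bullet> V = (\<Sum>j | col U j \<noteq> 0. col U j \<bullet> col V j)"
definition "norm (U::'a cmat) = sqrt (U \<bullet> U)"
definition "sgn (U::'a cmat) = inverse (norm U) *\<^sub>R U"
definition "dist (U::'a cmat) V = norm (U - V)"
definition "(uniformity :: ('a cmat \<times> 'a cmat) filter) =
  (INF e\<in>{0 <..}. principal {(x, y). dist x y < e})"
definition "open (S :: 'a cmat set) \<longleftrightarrow>
  (\<forall>x\<in>S. \<forall>\<^sub>F (x', y) in uniformity. x' = x \<longrightarrow> y \<in> S)"

lemma col_zero_aux: "col (0::'a cmat) = (\<lambda>_. 0)"
  unfolding zero_cmat_def by (rule col_Abs_cmat) simp

lemma col_plus_aux: "col (U + V :: 'a cmat) = (\<lambda>j. col U j + col V j)"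
  unfolding plus_cmat_def
  by (rule col_Abs_cmat, rule finite_subset[of _ "{j. col U j \<noteq> 0} \<union> {j. col V j \<noteq> 0}"]) auto

lemma col_minus_aux: "col (U - V :: 'a cmat) = (\<lambda>j. col U j - col V j)"
  unfolding minus_cmat_def
  by (rule col_Abs_cmat, rule finite_subset[of _ "{j. col U j \<noteq> 0} \<union> {j. col V j \<noteq> 0}"]) auto

lemma col_uminus_aux: "col (- U :: 'a cmat) = (\<lambda>j. - col U j)"
  unfolding uminus_cmat_def by (rule col_Abs_cmat) simp

lemma col_scaleR_aux: "col (r *\<^sub>R U :: 'a cmat) = (\<lambda>j. r *\<^sub>R col U j)"
  unfolding scaleR_cmat_def
  by (rule col_Abs_cmat, rule finite_subset[of _ "{j. col U j \<noteq> 0}"]) auto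

lemma inner_cmat_superset_aux:
  "finite S \<Longrightarrow> {j. col U j \<noteq> 0} \<subseteq> S \<Longrightarrow> U \<bullet> (V::'a cmat) = (\<Sum>j\<in>S. col U j \<bullet> col V j)"
  unfolding inner_cmat_def by (rule sum.mono_neutral_left) auto

instance
proof
  fix U V W :: "'a cmat" and r q :: real
  note cols = col_zero_aux col_plus_aux col_minus_aux col_uminus_aux col_scaleR_aux
  show "U + V + W = U + (V + W)" "U + V = V + U" "0 + U = U" "- U + U = 0" "U - V = U + - V"
    by (rule cmat_eqI; simp add: cols)+
  show "r *\<^sub>R (U + V) = r *\<^sub>R U + r *\<^sub>R V" "(r + q) *\<^sub>R U = r *\<^sub>R U + q *\<^sub>R U"
    "r *\<^sub>R q *\<^sub>R U = (r * q) *\<^sub>R U" "1 *\<^sub>R U = U"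
    by (rule cmat_eqI; simp add: cols scaleR_add_right scaleR_add_left)+
  show "dist U V = norm (U - V)" "sgn U = inverse (norm U) *\<^sub>R U" "norm U = sqrt (U \<bullet> U)"
    by (simp_all add: dist_cmat_def sgn_cmat_def norm_cmat_def)
  show "uniformity = (INF e\<in>{0 <..}. principal {(x, y::'a cmat). dist x y < e})"
    by (rule uniformity_cmat_def)
  show "open S \<longleftrightarrow> (\<forall>x\<in>S. \<forall>\<^sub>F (x', y) in uniformity. x' = x \<longrightarrow> y \<in> S)" for S :: "'a cmat set"
    by (rule open_cmat_def)
  let ?S = "{j. col U j \<noteq> 0} \<union> {j. col V j \<noteq> 0}"
  have fin: "finite ?S" by simp
  show "U \<bullet> V = V \<bullet> U"
    using inner_cmat_superset_aux[OF fin, of U V] inner_cmat_superset_aux[OF fin, of V U]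
    by (simp add: inner_commute)
  have "(U + V) \<bullet> W = (\<Sum>j\<in>?S. col (U + V) j \<bullet> col W j)"
    by (rule inner_cmat_superset_aux[OF fin]) (auto simp: cols)
  then show "(U + V) \<bullet> W = U \<bullet> W + V \<bullet> W"
    using inner_cmat_superset_aux[OF fin, of U W] inner_cmat_superset_aux[OF fin, of V W]
    by (simp add: cols inner_add_left sum.distrib)
  have "(r *\<^sub>R U) \<bullet> V = (\<Sum>j\<in>?S. col (r *\<^sub>R U) j \<bullet> col V j)"
    by (rule inner_cmat_superset_aux[OF fin]) (auto simp: cols)
  then show "(r *\<^sub>R U) \<bullet> V = r * (U \<bullet> V)"
    using inner_cmat_superset_aux[OF fin, of U V] by (simp add: cols sum_distrib_left)
  show "0 \<le> U \<bullet> U"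
    unfolding inner_cmat_def by (rule sum_nonneg) simp
  show "(U \<bullet> U = 0) = (U = 0)"
  proof
    assume "U \<bullet> U = 0"
    then have "\<forall>j\<in>{j. col U j \<noteq> 0}. col U j \<bullet> col U j = 0"
      unfolding inner_cmat_def by (subst (asm) sum_nonneg_eq_0_iff) auto
    then have "col U j = 0" for j
      using inner_eq_zero_iff by blast
    then show "U = 0"
      by (intro cmat_eqI) (simp add: col_zero_aux)
  next
    assume "U = 0"
    then show "U \<bullet> U = 0"
      by (simp add: inner_cmat_def col_zero_aux)
  qed
qed

end

lemmas col_zero [simp] = col_zero_aux
  and col_plus [simp] = col_plus_aux
  and col_minus [simp] = col_minus_aux
  and col_uminus [simp] = col_uminus_aux
  and col_scaleR [simp] = col_scaleR_aux
  and inner_cmat_superset = inner_cmat_superset_aux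

definition mats :: "nat \<Rightarrow> ('n::finite) cmat set" where
  "mats s = {U. \<forall>j\<ge>s. col U j = 0}"

definition mat_ball :: "nat \<Rightarrow> real \<Rightarrow> ('n::finite) cmat set" where
  "mat_ball s r = {U \<in> mats s. norm U \<le> r}"

text \<open>The symmetric matrix \<open>U U\<^sup>T\<close>, i.e. the sum over the columns \<open>u\<close> of \<open>u u\<^sup>T\<close>.\<close>

definition gram :: "('n::finite) cmat \<Rightarrow> real^'n^'n" where
  "gram U = (\<Sum>j | col U j \<noteq> 0. outer (col U j))"

definition left_mult :: "real^'n^'n \<Rightarrow> ('n::finite) cmat \<Rightarrow> 'n cmat" where
  "left_mult Q U = Abs_cmat (\<lambda>j. Q *v col U j)"

text \<open>For \<open>U \<in> mats s\<close> this is the matrix \<open>[U, y] \<in> mats (s + 1)\<close>.\<close>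

definition append_col :: "nat \<Rightarrow> ('n::finite) cmat \<Rightarrow> real^'n \<Rightarrow> 'n cmat" where
  "append_col s U y = Abs_cmat (\<lambda>j. if j = s then y else col U j)"

lemma col_left_mult [simp]: "col (left_mult Q U) j = Q *v col U j"
  unfolding left_mult_def
  by (subst col_Abs_cmat, rule finite_subset[of _ "{j. col U j \<noteq> 0}"]) auto

lemma col_append_col [simp]: "col (append_col s U y) j = (if j = s then y else col U j)"
  unfolding append_col_def
  by (subst col_Abs_cmat, rule finite_subset[of _ "insert s {j. col U j \<noteq> 0}"]) auto


section \<open>Gradients, indicator functions and approximate subdifferentials\<close>

text \<open>
  The gradient at \<open>x \<in> E\<close> of a function on the finite-dimensional linear subspace \<open>E\<close>, which is
  itself an element of \<open>E\<close>.
\<close>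

definition gradient_on :: "'a::real_inner set \<Rightarrow> ('a \<Rightarrow> real) \<Rightarrow> 'a \<Rightarrow> 'a" where
  "gradient_on E f x = (THE d. d \<in> E \<and> (f has_derivative (\<lambda>h. d \<bullet> h)) (at x within E))"

definition linearization :: "'a::real_inner set \<Rightarrow> ('a \<Rightarrow> real) \<Rightarrow> 'a \<Rightarrow> 'a \<Rightarrow> real" where
  "linearization E \<psi> u x = \<psi> x + gradient_on E \<psi> x \<bullet> (u - x)"

abbreviation grad :: "(real^'n^'n \<Rightarrow> real) \<Rightarrow> real^'n^'n \<Rightarrow> real^'n^'n" where
  "grad g \<equiv> gradient_on sym_mats g"

definition indicator_fn :: "'a set \<Rightarrow> 'a \<Rightarrow> ereal" where
  "indicator_fn C x = (if x \<in> C then 0 else \<infinity>)"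

definition eps_subdifferential ::
  "'a::real_inner set \<Rightarrow> real \<Rightarrow> ('a \<Rightarrow> ereal) \<Rightarrow> 'a \<Rightarrow> 'a set" where
  "eps_subdifferential E \<epsilon> h z =
     {u \<in> E. \<forall>z'\<in>E. h z' \<ge> h z + ereal (u \<bullet> (z' - z)) - ereal \<epsilon>}"

definition eps_optimal :: "(real^'n^'n \<Rightarrow> real) \<Rightarrow> real \<Rightarrow> real^'n^'n \<Rightarrow> bool" where
  "eps_optimal g \<epsilon> Z \<longleftrightarrow> Z \<in> spectraplex \<and>
     0 \<in> {grad g Z + u | u. u \<in> eps_subdifferential sym_mats \<epsilon> (indicator_fn spectraplex) Z}"


section \<open>The ADAP-FISTA method\<close>

text \<open>
  The three methods are transition systems.  A step may have several successors: the methods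
  leave the choice of \<open>\<underline>M\<^sub>j\<close>, of a minimum eigenvector and of minimizers open.

  \<open>Fista_Search y x A \<tau> L\<close> is the start of step (2) of an iteration with iterates \<open>y\<close>, \<open>x\<close>, scalars
  \<open>A\<close>, \<open>\<tau>\<close> and the current trial value \<open>L\<close> of \<open>L\<^sub>i\<^sub>+\<^sub>1\<close>.
\<close>

datatype 'a fista_state =
    Fista_Search 'a 'a real real real
  | Fista_Success 'a 'a real
  | Fista_Failure

definition fista_init :: "'a \<Rightarrow> real \<Rightarrow> 'a fista_state" where
  "fista_init x0 L0 = Fista_Search x0 x0 0 1 L0"

text \<open>
  \<open>E\<close> is the ambient space and \<open>\<N> = {u \<in> E. \<psi>\<^sub>n u < \<infinity>}\<close>; \<open>a\<close>, \<open>xt\<close>, \<open>y'\<close> are \<open>a\<^sub>i\<close>,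
  the convex combination of \<open>y\<^sub>i\<close> and \<open>x\<^sub>i\<close>, and \<open>y\<^sub>i\<^sub>+\<^sub>1\<close>, as computed in step (2).
\<close>

definition fista_trial ::
  "'a::real_inner set \<Rightarrow> real \<Rightarrow> ('a \<Rightarrow> real) \<Rightarrow> ('a \<Rightarrow> ereal) \<Rightarrow>
   'a \<Rightarrow> 'a \<Rightarrow> real \<Rightarrow> real \<Rightarrow> real \<Rightarrow> real \<Rightarrow> 'a \<Rightarrow> 'a \<Rightarrow> bool" where
  "fista_trial E \<mu> \<psi>s \<psi>n y x A \<tau> L a xt y' \<longleftrightarrow>
     a = (\<tau> + sqrt (\<tau>\<^sup>2 + 4 * \<tau> * A * (L - \<mu>))) / (2 * (L - \<mu>)) \<and>
     xt = (1 / (A + a)) *\<^sub>R (A *\<^sub>R y + a *\<^sub>R x) \<and>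
     is_arg_min
       (\<lambda>u. ereal (linearization E \<psi>s u xt) + \<psi>n u + ereal (L / 2 * (norm (u - xt))\<^sup>2))
       (\<lambda>u. u \<in> E \<and> \<psi>n u < \<infinity>) y'"

definition fista_descent ::
  "'a::real_inner set \<Rightarrow> real \<Rightarrow> ('a \<Rightarrow> real) \<Rightarrow> real \<Rightarrow> 'a \<Rightarrow> 'a \<Rightarrow> bool" where
  "fista_descent E chi \<psi>s L xt y' \<longleftrightarrow>
     linearization E \<psi>s y' xt + (1 - chi) * L / 4 * (norm (y' - xt))\<^sup>2 \<ge> \<psi>s y'"

definition fista_residual ::
  "'a::real_inner set \<Rightarrow> ('a \<Rightarrow> real) \<Rightarrow> real \<Rightarrow> 'a \<Rightarrow> 'a \<Rightarrow> 'a" where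
  "fista_residual E \<psi>s L xt y' =
     gradient_on E \<psi>s y' - gradient_on E \<psi>s xt + L *\<^sub>R (xt - y')"

inductive fista_step ::
  "real \<Rightarrow> real \<Rightarrow> 'a::real_inner set \<Rightarrow> real \<Rightarrow> 'a \<Rightarrow> ('a \<Rightarrow> real) \<Rightarrow> ('a \<Rightarrow> ereal) \<Rightarrow>
   'a fista_state \<Rightarrow> 'a fista_state \<Rightarrow> bool"
  for \<sigma> chi E \<mu> x0 \<psi>s \<psi>n where
  backtrack:
    "\<lbrakk> fista_trial E \<mu> \<psi>s \<psi>n y x A \<tau> L a xt y';
       \<not> fista_descent E chi \<psi>s L xt y' \<rbrakk>
     \<Longrightarrow> fista_step \<sigma> chi E \<mu> x0 \<psi>s \<psi>n (Fista_Search y x A \<tau> L) (Fista_Search y x A \<tau> (2 * L))"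
| failure:
    "\<lbrakk> fista_trial E \<mu> \<psi>s \<psi>n y x A \<tau> L a xt y';
       fista_descent E chi \<psi>s L xt y';
       \<not> (norm (y' - x0))\<^sup>2 \<ge> chi * (A + a) * L * (norm (y' - xt))\<^sup>2 \<rbrakk>
     \<Longrightarrow> fista_step \<sigma> chi E \<mu> x0 \<psi>s \<psi>n (Fista_Search y x A \<tau> L) Fista_Failure"
| success:
    "\<lbrakk> fista_trial E \<mu> \<psi>s \<psi>n y x A \<tau> L a xt y';
       fista_descent E chi \<psi>s L xt y';
       (norm (y' - x0))\<^sup>2 \<ge> chi * (A + a) * L * (norm (y' - xt))\<^sup>2;
       v = fista_residual E \<psi>s L xt y';
       norm v \<le> \<sigma> * norm (y' - x0) \<rbrakk>
     \<Longrightarrow> fista_step \<sigma> chi E \<mu> x0 \<psi>s \<psi>n (Fista_Search y x A \<tau> L) (Fista_Success y' v L)"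
| continue:
    "\<lbrakk> fista_trial E \<mu> \<psi>s \<psi>n y x A \<tau> L a xt y';
       fista_descent E chi \<psi>s L xt y';
       (norm (y' - x0))\<^sup>2 \<ge> chi * (A + a) * L * (norm (y' - xt))\<^sup>2;
       \<not> norm (fista_residual E \<psi>s L xt y') \<le> \<sigma> * norm (y' - x0);
       \<tau>' = \<tau> + a * \<mu>;
       s' = (L - \<mu>) *\<^sub>R (xt - y');
       x' = (1 / \<tau>') *\<^sub>R ((\<mu> * a) *\<^sub>R y' + \<tau> *\<^sub>R x - a *\<^sub>R s') \<rbrakk>
     \<Longrightarrow> fista_step \<sigma> chi E \<mu> x0 \<psi>s \<psi>n (Fista_Search y x A \<tau> L) (Fista_Search y' x' (A + a) \<tau>' L)"


section \<open>The ADAP-AIPP method\<close>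

text \<open>
  \<open>Aipp_Call W lam Mb\<close> is the start of step (1) with \<open>W = W\<^sub>j\<^sub>-\<^sub>1\<close> and \<open>Mb\<close> the upper bound for the
  choice of \<open>\<underline>M\<^sub>j\<close>; \<open>Aipp_Fista W lam Mb f\<close> is the running ADAP-FISTA call, in state \<open>f\<close>.
\<close>

datatype 'n aipp_state =
    Aipp_Call "'n cmat" real real
  | Aipp_Fista "'n cmat" real real "'n cmat fista_state"
  | Aipp_Output "'n cmat" "'n cmat"

definition aipp_init :: "real \<Rightarrow> ('n::finite) cmat \<Rightarrow> 'n aipp_state" where
  "aipp_init lam0 W0 = Aipp_Call W0 lam0 1"

definition aipp_smooth ::
  "(real^'n^'n \<Rightarrow> real) \<Rightarrow> real \<Rightarrow> ('n::finite) cmat \<Rightarrow> 'n cmat \<Rightarrow> real" where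
  "aipp_smooth g lam W U = lam * g (gram U) + 1 / 2 * (norm (U - W))\<^sup>2"

definition aipp_accepts ::
  "(real^'n^'n \<Rightarrow> real) \<Rightarrow> real \<Rightarrow> ('n::finite) cmat \<Rightarrow> 'n cmat \<Rightarrow> 'n cmat \<Rightarrow> bool" where
  "aipp_accepts g lam W W' V \<longleftrightarrow>
     lam * g (gram W) - (lam * g (gram W') + 1 / 2 * (norm (W' - W))\<^sup>2) \<ge> V \<bullet> (W - W')"

definition aipp_residual ::
  "real \<Rightarrow> ('n::finite) cmat \<Rightarrow> 'n cmat \<Rightarrow> 'n cmat \<Rightarrow> 'n cmat" where
  "aipp_residual lam W W' V = (1 / lam) *\<^sub>R (V + W - W')"

inductive aipp_step ::
  "real \<Rightarrow> real \<Rightarrow> (real^'n^'n \<Rightarrow> real) \<Rightarrow> nat \<Rightarrow> real \<Rightarrow>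
   ('n::finite) aipp_state \<Rightarrow> 'n aipp_state \<Rightarrow> bool"
  for \<sigma> chi g s \<rho> where
  call_fista:
    "\<lbrakk> 1 \<le> M; M \<le> Mb \<rbrakk>
     \<Longrightarrow> aipp_step \<sigma> chi g s \<rho> (Aipp_Call W lam Mb) (Aipp_Fista W lam Mb (fista_init W M))"
| run_fista:
    "fista_step \<sigma> chi (mats s) (1 / 2) W
       (aipp_smooth g lam W) (\<lambda>U. ereal lam * indicator_fn (mat_ball s 1) U) f f'
     \<Longrightarrow> aipp_step \<sigma> chi g s \<rho> (Aipp_Fista W lam Mb f) (Aipp_Fista W lam Mb f')"
| fista_failed:
    "aipp_step \<sigma> chi g s \<rho> (Aipp_Fista W lam Mb Fista_Failure) (Aipp_Call W (lam / 2) Mb)"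
| reject:
    "\<not> aipp_accepts g lam W W' V
     \<Longrightarrow> aipp_step \<sigma> chi g s \<rho> (Aipp_Fista W lam Mb (Fista_Success W' V L)) (Aipp_Call W (lam / 2) Mb)"
| stop:
    "\<lbrakk> aipp_accepts g lam W W' V; R = aipp_residual lam W W' V; norm R \<le> \<rho> \<rbrakk>
     \<Longrightarrow> aipp_step \<sigma> chi g s \<rho> (Aipp_Fista W lam Mb (Fista_Success W' V L)) (Aipp_Output W' R)"
| accept:
    "\<lbrakk> aipp_accepts g lam W W' V; \<not> norm (aipp_residual lam W W' V) \<le> \<rho> \<rbrakk>
     \<Longrightarrow> aipp_step \<sigma> chi g s \<rho> (Aipp_Fista W lam Mb (Fista_Success W' V L)) (Aipp_Call W' lam L)"


section \<open>The HLR method\<close>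

datatype 'n hlr_phase =
    Hlr_Aipp "'n aipp_state"
  | Hlr_Output "'n cmat" real

text \<open>
  \<open>iter\<close> and \<open>cols\<close> are the variables \<open>k\<close> and \<open>s\<close> of the method.  The next three fields record
  the history of the run: the number of ADAP-FISTA calls and of minimum eigenvector computations
  so far, and the largest column dimension with which ADAP-AIPP has been called.  The latter is
  the column dimension that the bound on the number of ADAP-FISTA calls refers to.
\<close>

record ('n::finite) hlr_state =
  iter :: nat
  cols :: nat
  fista_calls :: nat
  eig_comps :: nat
  max_cols :: nat
  phase :: "'n hlr_phase"

definition hlr_init :: "nat \<Rightarrow> ('n::finite) cmat \<Rightarrow> real \<Rightarrow> 'n hlr_state" where
  "hlr_init s0 Y0 lam0 =
     \<lparr> iter = 1, cols = s0, fista_calls = 0, eig_comps = 0, max_cols = s0,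
       phase = Hlr_Aipp (aipp_init lam0 Y0) \<rparr>"

text \<open>The computation in steps (2) and (3) of \<open>G\<^sub>k\<close>, \<open>\<theta>\<^sub>k\<close>, \<open>y\<^sub>k\<close> and \<open>\<epsilon>\<^sub>k\<close> from \<open>Y\<^sub>k\<close>.\<close>

definition hlr_eig ::
  "(real^'n^'n \<Rightarrow> real) \<Rightarrow> ('n::finite) cmat \<Rightarrow> real \<Rightarrow> real^'n \<Rightarrow> real \<Rightarrow> bool" where
  "hlr_eig g Y \<theta> y \<epsilon> \<longleftrightarrow>
     (let G = grad g (gram Y) in
       \<theta> = max (- lambda_min G) 0 \<and>
       (if \<theta> > 0 then is_eigenpair G (lambda_min G) y \<and> norm y = 1 else y = 0) \<and>
       \<epsilon> = left_mult G Y \<bullet> Y + \<theta>)"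

inductive hlr_step ::
  "real \<Rightarrow> real \<Rightarrow> (real^'n^'n \<Rightarrow> real) \<Rightarrow> real \<Rightarrow> real \<Rightarrow> real \<Rightarrow>
   ('n::finite) hlr_state \<Rightarrow> 'n hlr_state \<Rightarrow> bool"
  for \<sigma> chi g \<epsilon> \<rho> lam0 where
  run_aipp:
    "\<lbrakk> phase st = Hlr_Aipp p;
       aipp_step \<sigma> chi g (cols st) \<rho> p p';
       calls = (case p of Aipp_Call W lam Mb \<Rightarrow> 1 | _ \<Rightarrow> 0) \<rbrakk>
     \<Longrightarrow> hlr_step \<sigma> chi g \<epsilon> \<rho> lam0 st
           (st\<lparr> fista_calls := fista_calls st + calls, phase := Hlr_Aipp p' \<rparr>)"
| hlr_stop:
    "\<lbrakk> phase st = Hlr_Aipp (Aipp_Output Y R);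
       hlr_eig g Y \<theta> y \<epsilon>k;
       \<epsilon>k \<le> \<epsilon> \<rbrakk>
     \<Longrightarrow> hlr_step \<sigma> chi g \<epsilon> \<rho> lam0 st
           (st\<lparr> eig_comps := eig_comps st + 1, phase := Hlr_Output Y \<theta> \<rparr>)"
| hlr_next:
    "\<lbrakk> phase st = Hlr_Aipp (Aipp_Output Y R);
       hlr_eig g Y \<theta> y \<epsilon>k;
       \<not> \<epsilon>k \<le> \<epsilon>;
       is_arg_min (\<lambda>\<alpha>. g (\<alpha> *\<^sub>R outer y + (1 - \<alpha>) *\<^sub>R gram Y)) (\<lambda>\<alpha>. \<alpha> \<in> {0..1}) \<alpha>;
       (Y', s') = (if \<alpha> = 1 then (append_col 0 0 y, 1)
                   else (append_col (cols st) (sqrt (1 - \<alpha>) *\<^sub>R Y) (sqrt \<alpha> *\<^sub>R y), cols st + 1)) \<rbrakk>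
     \<Longrightarrow> hlr_step \<sigma> chi g \<epsilon> \<rho> lam0 st
           (st\<lparr> iter := iter st + 1, cols := s', eig_comps := eig_comps st + 1,
                max_cols := max (max_cols st) s', phase := Hlr_Aipp (aipp_init lam0 Y') \<rparr>)"


section \<open>The constants in the complexity bounds\<close>

text \<open>
  The infimum and the supremum below are those of a continuous function on a nonempty compact set
  (\<open>\<nabla>g\<close> is continuous because \<open>g\<close> is convex and differentiable), hence finite and attained.
\<close>

definition g_min :: "(real^'n^'n \<Rightarrow> real) \<Rightarrow> real" where
  "g_min g = (INF Z\<in>spectraplex. g Z)"

definition iter_bound :: "(real^'n^'n \<Rightarrow> real) \<Rightarrow> real \<Rightarrow> ('n::finite) cmat \<Rightarrow> real \<Rightarrow> int" where
  "iter_bound g Lg Y0 \<epsilon> =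
     \<lceil>1 + 4 * Max {g (gram Y0) - g_min g, sqrt (4 * Lg * (g (gram Y0) - g_min g)), 4 * Lg} / \<epsilon>\<rceil>"

definition grad_bound :: "(real^'n^'n \<Rightarrow> real) \<Rightarrow> nat \<Rightarrow> real" where
  "grad_bound g s = (SUP U\<in>mat_ball s 3. norm (grad g (gram U)))"

definition C_sigma :: "real \<Rightarrow> real" where
  "C_sigma \<sigma> = 2 * (1 - \<sigma>)\<^sup>2 / (1 - 2 * \<sigma>)"

definition curv_bound :: "(real^'n^'n \<Rightarrow> real) \<Rightarrow> real \<Rightarrow> nat \<Rightarrow> real \<Rightarrow> real" where
  "curv_bound g Lg s lam0 = max (8 * grad_bound g s + 144 * Lg) (1 / lam0)"

definition log0p :: "real \<Rightarrow> real" where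
  "log0p t = max (ln t) 0"

definition Q_bound :: "(real^'n^'n \<Rightarrow> real) \<Rightarrow> real \<Rightarrow> nat \<Rightarrow> real \<Rightarrow> int" where
  "Q_bound g Lg s lam0 = \<lceil>log0p (lam0 * curv_bound g Lg s lam0) / ln 2\<rceil>"

end

theory Submission
  imports Defs
begin

text \<open>
  HLR alternates a local search (ADAP-AIPP, which calls ADAP-FISTA) on the factorized problem with a
  Frank-Wolfe step on the spectraplex.

  \<^emph>\<open>Iterations.\<close>  The number \<open>\<epsilon>\<^sub>k\<close> is the Frank-Wolfe gap at \<open>Y\<^sub>k Y\<^sub>k\<^sup>T\<close>: it bounds
  \<open>\<nabla>g(Y\<^sub>k Y\<^sub>k\<^sup>T) \<bullet> (Y\<^sub>k Y\<^sub>k\<^sup>T - Z)\<close> for all \<open>Z\<close> in the spectraplex (\<open>eig_gap\<close>), because a positive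
  semidefinite matrix is a Gram matrix, so that its inner product with a symmetric matrix is at least the
  minimum eigenvalue times the trace.  The exact line search decreases \<open>g\<close> as in the classical analysis of the
  Frank-Wolfe algorithm (\<open>line_descent\<close>), the local search never increases it, and
  \<open>fw_count\<close> counts the steps before the gap is at most \<open>\<epsilon>\<close>.

  \<^emph>\<open>Number of calls.\<close>  By convexity of \<open>g\<close> the negative curvature of \<open>U \<mapsto> g (U U\<^sup>T)\<close> at \<open>V\<close> is
  at most twice the norm of \<open>\<nabla>g (V V\<^sup>T)\<close> (\<open>aipp_smooth_lower\<close>).  If \<open>\<lambda>\<close> is at most \<open>1 / (4 G)\<close> with \<open>G\<close> the bound of this
  gradient over the ball of radius \<open>3\<close>, the prox subproblem is therefore strongly convex, the usual potential
  function of accelerated gradient methods decreases, and the call succeeds with an output that ADAP-AIPP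
  accepts (\<open>fista_small_lam\<close>).  So \<open>\<lambda>\<close> is halved at most \<open>Q\<close> times in a call of ADAP-AIPP, and an
  iteration of ADAP-AIPP that does not stop decreases \<open>g\<close> by a fixed amount (\<open>residual_descent\<close>).

  \<^emph>\<open>Termination of ADAP-FISTA.\<close>  This needs a separate argument, since \<open>\<lambda>\<close> may be large, so that the
  subproblem is not convex, and since \<open>\<nabla>g\<close> is Lipschitz continuous on the spectraplex only, whereas the
  extrapolated points leave the unit ball; outside, the gradient is merely continuous, and \<open>L\<close> might be doubled
  again and again.  If \<open>L\<close> is doubled finitely often, \<open>A\<close> would grow at least linearly and the residual
  tend to zero (\<open>infinitely_many_rejected\<close>), although it is bounded away from zero until the call stops
  (\<open>residual_gap\<close>).  Otherwise \<open>L\<close> tends to infinity.  Rejected trials then have extrapolated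
  points \<open>z\<close> outside the ball, but only by \<open>o(1 / L)\<close>, and almost stationary (\<open>rejected\<close>), so they accumulate at a stationary
  point \<open>p\<close> of the unit sphere (\<open>limit_point\<close>); on the other hand, an accepted trial near \<open>p\<close> that does not stop the call has
  \<open>z\<close> at a distance from the sphere of the order of at least \<open>1 / L\<close> (\<open>accepted_off_sphere\<close>).  The
  discrete energy \<open>\<psi>(y) + (\<mu> + 1 / A) / 2 \<bar>x - y\<bar>\<^sup>2\<close> decreases (\<open>energy_decreases\<close>), with the consequence that either
  the iterates converge or the velocity \<open>\<bar>x - y\<bar>\<close> tends to zero (\<open>q_convergent\<close>, \<open>y_convergent\<close>).  After a rejected
  and an accepted trial near \<open>p\<close>, momentum pushes the iterates onto the sphere
  (\<open>rejected_then_on_sphere\<close>).  As long as they are near \<open>p\<close> they stay there, all trials are outside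
  the ball, and none is rejected (\<open>on_sphere_accepted\<close>).  This contradicts infinitely many rejections if the iterates
  converge; and if the velocity tends to zero, consecutive iterates on the sphere are so close to each other that
  the next extrapolated point is within \<open>o(1 / L)\<close> of the sphere (\<open>impossible\<close>).
\<close>

section \<open>Gradients relative to a linear subspace\<close>

lemma has_derivative_along_line:
  fixes f :: "'a::real_normed_vector \<Rightarrow> real"
  assumes "(f has_derivative f') (at x within E)" "subspace E" "x \<in> E" "h \<in> E"
  shows "((\<lambda>t. f (x + t *\<^sub>R h)) has_derivative (\<lambda>t. f' (t *\<^sub>R h))) (at 0)"
proof -
  have sub: "(\<lambda>t. x + t *\<^sub>R h) ` UNIV \<subseteq> E"
    using assms by (auto intro: subspace_add subspace_scale)
  have "(f has_derivative f') (at (x + 0 *\<^sub>R h) within (\<lambda>t. x + t *\<^sub>R h) ` UNIV)"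
    using has_derivative_subset[OF assms(1) sub] by simp
  moreover have "((\<lambda>t. x + t *\<^sub>R h) has_derivative (\<lambda>t. t *\<^sub>R h)) (at 0)"
    by (auto intro!: derivative_eq_intros)
  ultimately show ?thesis
    using has_derivative_in_compose by blast
qed

lemma gradient_on_eqI:
  assumes E: "subspace E" and x: "x \<in> E" and d: "d \<in> E"
    and D: "(f has_derivative (\<lambda>h. d \<bullet> h)) (at x within E)"
  shows "gradient_on E f x = d"
  unfolding gradient_on_def
proof (rule the_equality)
  show "d \<in> E \<and> (f has_derivative (\<lambda>h. d \<bullet> h)) (at x within E)"
    using d D by simp
next
  fix d' assume d': "d' \<in> E \<and> (f has_derivative (\<lambda>h. d' \<bullet> h)) (at x within E)"
  define h where "h = d' - d"
  have h: "h \<in> E" using d d' E by (simp add: h_def subspace_diff)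
  have "(\<lambda>t::real. d \<bullet> (t *\<^sub>R h)) = (\<lambda>t. d' \<bullet> (t *\<^sub>R h))"
    using has_derivative_along_line[OF D E x h] has_derivative_along_line[OF conjunct2[OF d'] E x h]
    by (rule has_derivative_unique)
  then have "d \<bullet> h = d' \<bullet> h" by (metis scaleR_one)
  then have "h \<bullet> h = 0" by (simp add: h_def algebra_simps)
  then show "d' = d" by (simp add: h_def)
qed

lemma gradient_on_exists:
  fixes f :: "'a::euclidean_space \<Rightarrow> real"
  assumes E: "subspace E" and x: "x \<in> E" and f: "f differentiable (at x within E)"
  shows gradient_on_in: "gradient_on E f x \<in> E"
    and gradient_on_derivative: "(f has_derivative (\<lambda>h. gradient_on E f x \<bullet> h)) (at x within E)"
proof -
  obtain f' where f': "(f has_derivative f') (at x within E)"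
    using f by (auto simp: differentiable_def)
  interpret bounded_linear f' using f' by (rule has_derivative_bounded_linear)
  define d0 where "d0 = (\<Sum>b\<in>Basis. f' b *\<^sub>R b)"
  have d0: "d0 \<bullet> h = f' h" for h
  proof -
    have "f' h = f' (\<Sum>b\<in>Basis. (h \<bullet> b) *\<^sub>R b)" by (simp add: euclidean_representation)
    also have "\<dots> = (\<Sum>b\<in>Basis. (h \<bullet> b) * f' b)" by (simp add: sum scaleR)
    also have "\<dots> = d0 \<bullet> h"
      by (simp add: d0_def inner_sum_left inner_sum_right inner_commute[of _ h] mult.commute)
    finally show ?thesis by simp
  qed
  obtain d r where d: "d \<in> span E" and r: "\<And>w. w \<in> span E \<Longrightarrow> orthogonal r w" and dr: "d0 = d + r"
    using orthogonal_subspace_decomp_exists by metis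
  have dE: "d \<in> E" using d E by (metis span_eq_iff)
  have eq: "d \<bullet> h = f' h" if "h \<in> E" for h
    using d0[of h] r[of h] that by (simp add: dr orthogonal_def inner_add_left span_base)
  have der: "(f has_derivative (\<lambda>h. d \<bullet> h)) (at x within E)"
    unfolding has_derivative_within
  proof
    show "bounded_linear ((\<bullet>) d)" by (rule bounded_linear_inner_right)
    have "((\<lambda>y. (1 / norm (y - x)) *\<^sub>R (f y - (f x + f' (y - x)))) \<longlongrightarrow> 0) (at x within E)"
      using f' by (simp add: has_derivative_within)
    moreover have "\<forall>\<^sub>F y in at x within E. (1 / norm (y - x)) *\<^sub>R (f y - (f x + f' (y - x)))
        = (1 / norm (y - x)) *\<^sub>R (f y - (f x + d \<bullet> (y - x)))"
      unfolding eventually_at_filter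
      by (rule always_eventually) (use eq E x in \<open>auto simp: subspace_diff\<close>)
    ultimately show "((\<lambda>y. (1 / norm (y - x)) *\<^sub>R (f y - (f x + d \<bullet> (y - x)))) \<longlongrightarrow> 0) (at x within E)"
      by (rule Lim_transform_eventually)
  qed
  have "gradient_on E f x = d" by (rule gradient_on_eqI[OF E x dE der])
  then show "gradient_on E f x \<in> E" "(f has_derivative (\<lambda>h. gradient_on E f x \<bullet> h)) (at x within E)"
    using dE der by auto
qed

lemma gradient_inequality:
  fixes f :: "'a::euclidean_space \<Rightarrow> real"
  assumes E: "subspace E" and f: "f differentiable_on E" and cv: "convex_on E f"
    and x: "x \<in> E" and y: "y \<in> E"
  shows "f x + gradient_on E f x \<bullet> (y - x) \<le> f y"
proof -
  define h where "h = y - x"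
  have h: "h \<in> E" using x y E by (simp add: h_def subspace_diff)
  let ?\<phi> = "\<lambda>t. f (x + t *\<^sub>R h)"
  have inE: "x + t *\<^sub>R h \<in> E" for t using x h E by (simp add: subspace_add subspace_scale)
  have "(f has_derivative (\<lambda>k. gradient_on E f x \<bullet> k)) (at x within E)"
    using f x E by (intro gradient_on_derivative) (auto simp: differentiable_on_def)
  from has_derivative_along_line[OF this E x h]
  have "(?\<phi> has_field_derivative (gradient_on E f x \<bullet> h)) (at 0)"
    by (rule has_derivative_imp_has_field_derivative) (simp add: mult.commute)
  moreover have "convex_on UNIV ?\<phi>"
  proof (rule convex_onI)
    fix t u v :: real assume t: "0 < t" "t < 1"
    have "x + ((1 - t) *\<^sub>R u + t *\<^sub>R v) *\<^sub>R h = (1 - t) *\<^sub>R (x + u *\<^sub>R h) + t *\<^sub>R (x + v *\<^sub>R h)"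
      by (simp add: algebra_simps)
    then show "?\<phi> ((1 - t) *\<^sub>R u + t *\<^sub>R v) \<le> (1 - t) * ?\<phi> u + t * ?\<phi> v"
      using convex_onD[OF cv, of t "x + u *\<^sub>R h" "x + v *\<^sub>R h"] t inE by simp
  qed simp
  ultimately have "?\<phi> 1 - ?\<phi> 0 \<ge> (gradient_on E f x \<bullet> h) * (1 - 0)"
    by (intro convex_on_imp_above_tangent[where A = UNIV]) auto
  then show ?thesis by (simp add: h_def)
qed

text \<open>
  A convex differentiable function is continuously differentiable.  At a point \<open>x\<close>, differentiability
  bounds the increments of \<open>f\<close> over a small sphere of radius \<open>r\<close> around \<open>x\<close>; by uniform continuity
  the same bound holds, up to \<open>\<epsilon> r\<close>, around nearby points \<open>y\<close>, where it bounds the gradient by convexity.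
\<close>

lemma continuous_on_gradient:
  fixes f :: "'a::euclidean_space \<Rightarrow> real"
  assumes E: "subspace E" and f: "f differentiable_on E" and cv: "convex_on E f"
  shows "continuous_on E (gradient_on E f)"
  unfolding continuous_on_iff
proof (intro ballI allI impI)
  fix x and e :: real assume x: "x \<in> E" and e: "0 < e"
  let ?G = "gradient_on E f"
  have Gin: "?G z \<in> E" if "z \<in> E" for z
    using gradient_on_in[OF E that] f that by (auto simp: differentiable_on_def)
  have "(f has_derivative (\<lambda>k. ?G x \<bullet> k)) (at x within E)"
    using f x E by (intro gradient_on_derivative) (auto simp: differentiable_on_def)
  then obtain d where d: "0 < d" and
    dd: "\<And>y. y \<in> E \<Longrightarrow> norm (y - x) < d \<Longrightarrow> norm (f y - f x - ?G x \<bullet> (y - x)) \<le> e / 4 * norm (y - x)"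
    unfolding has_derivative_within_alt using e by (metis divide_pos_pos zero_less_numeral)
  define r where "r = min (d / 2) 1"
  have r: "0 < r" "r < d" "r \<le> 1" using d by (auto simp: r_def)
  define C where "C = E \<inter> cball x 2"
  have "compact C" unfolding C_def
    using closed_subspace[OF E] by (metis compact_Int_closed compact_cball inf_commute)
  moreover have "continuous_on C f"
    using differentiable_imp_continuous_on[OF f] by (rule continuous_on_subset) (auto simp: C_def)
  ultimately have "uniformly_continuous_on C f" by (rule compact_uniformly_continuous[rotated])
  moreover have "0 < e * r / 8" using e r by simp
  ultimately obtain s where s: "0 < s" and
    ss: "\<And>u v. u \<in> C \<Longrightarrow> v \<in> C \<Longrightarrow> dist v u < s \<Longrightarrow> dist (f v) (f u) < e * r / 8"
    unfolding uniformly_continuous_on_def by metis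
  show "\<exists>d>0. \<forall>y\<in>E. dist y x < d \<longrightarrow> dist (?G y) (?G x) < e"
  proof (intro exI conjI ballI impI)
    show "0 < min s 1" using s by simp
    fix y assume y: "y \<in> E" and yx: "dist y x < min s 1"
    define w where "w = ?G y - ?G x"
    show "dist (?G y) (?G x) < e"
    proof (cases "w = 0")
      case True then show ?thesis using e by (simp add: w_def)
    next
      case False
      define h where "h = (r / norm w) *\<^sub>R w"
      have w: "w \<in> E" using Gin x y E by (simp add: w_def subspace_diff)
      have h: "h \<in> E" using w E by (simp add: h_def subspace_scale)
      have nh: "norm h = r" using False r by (simp add: h_def)
      have "f y + ?G y \<bullet> h \<le> f (y + h)"
        using gradient_inequality[OF E f cv y, of "y + h"] y h E by (simp add: subspace_add)
      moreover have "dist x (y + h) \<le> 2"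
        using norm_triangle_ineq4[of "x - y" h] nh r yx by (simp add: dist_norm norm_minus_commute algebra_simps)
      then have "dist (f (y + h)) (f (x + h)) < e * r / 8"
        using x y h E nh r yx
        by (intro ss) (auto simp: C_def subspace_add dist_norm norm_minus_commute)
      moreover have "dist (f y) (f x) < e * r / 8"
        using x y E yx by (intro ss) (auto simp: C_def dist_commute)
      moreover have "norm (f (x + h) - f x - ?G x \<bullet> h) \<le> e / 4 * r"
        using dd[of "x + h"] x h E nh r by (simp add: subspace_add)
      ultimately have "?G y \<bullet> h - ?G x \<bullet> h < e * r / 2 + e * r / 8"
        by (simp add: dist_real_def abs_if split: if_splits)
      then have "w \<bullet> h < e * r"
        using mult_pos_pos[OF e r(1)] by (simp add: w_def inner_diff_left)
      moreover have "w \<bullet> h = r * norm w"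
        using False by (simp add: h_def power2_norm_eq_inner[symmetric] power2_eq_square)
      ultimately show ?thesis using r by (simp add: w_def dist_norm mult.commute)
    qed
  qed
qed

section \<open>Gram matrices\<close>

lemma subspace_sym_mats: "subspace (sym_mats :: (real^'n^'n) set)"
  by (auto simp: subspace_def sym_mats_def transpose_def vec_eq_iff)

lemma subspace_mats: "subspace (mats s :: ('n::finite) cmat set)"
  by (auto simp: subspace_def mats_def)

lemma mats_mono: "s \<le> s' \<Longrightarrow> mats s \<subseteq> mats s'"
  by (auto simp: mats_def)

lemma inner_mats: "U \<in> mats s \<Longrightarrow> U \<bullet> V = (\<Sum>j<s. col U j \<bullet> col V j)"
  by (rule inner_cmat_superset) (auto simp: mats_def not_le[symmetric])

lemma ex_mats: "\<exists>s. (U::('n::finite) cmat) \<in> mats s"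
proof -
  obtain s where "\<And>j. j \<in> {j. col U j \<noteq> 0} \<Longrightarrow> j < s"
    using finite_nat_set_iff_bounded[of "{j. col U j \<noteq> 0}"] finite_col by auto
  then show ?thesis by (intro exI[of _ s]) (force simp: mats_def)
qed

lemma ex_mats2: "\<exists>s. (U::('n::finite) cmat) \<in> mats s \<and> V \<in> mats s"
proof -
  obtain a b where "U \<in> mats a" "V \<in> mats b" using ex_mats by metis
  then show ?thesis using mats_mono[of a "max a b"] mats_mono[of b "max a b"] by (metis max.cobounded1 max.cobounded2 subsetD)
qed

lemma norm_matrix_vector_le: "norm (Q *v v) \<le> norm Q * norm v"
  for Q :: "real^'n^'m"
proof -
  have "(norm (Q *v v))\<^sup>2 = (Q *v v) \<bullet> (Q *v v)" by (rule power2_norm_eq_inner)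
  also have "\<dots> = (\<Sum>i\<in>UNIV. (Q $ i \<bullet> v)\<^sup>2)"
    by (rule trans[OF inner_vec_def]) (simp only: inner_real_def matrix_vector_mul_component power2_eq_square)
  also have "\<dots> \<le> (\<Sum>i\<in>UNIV. (norm (Q $ i))\<^sup>2 * (norm v)\<^sup>2)"
    by (rule sum_mono) (metis Cauchy_Schwarz_ineq power2_norm_eq_inner)
  also have "\<dots> = (\<Sum>i\<in>UNIV. Q $ i \<bullet> Q $ i) * (norm v)\<^sup>2"
    by (simp only: sum_distrib_right[symmetric] power2_norm_eq_inner)
  also have "\<dots> = (norm Q * norm v)\<^sup>2"
    by (simp only: power_mult_distrib power2_norm_eq_inner[of Q] inner_vec_def[of Q])
  finally show ?thesis by (rule power2_le_imp_le) simp
qed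

lemma norm_left_mult_le: "norm (left_mult Q U) \<le> norm Q * norm (U :: ('n::finite) cmat)"
proof -
  obtain s where U: "U \<in> mats s" using ex_mats by blast
  then have QU: "left_mult Q U \<in> mats s" by (auto simp: mats_def)
  have "(norm (left_mult Q U))\<^sup>2 = (\<Sum>j<s. (norm (Q *v col U j))\<^sup>2)"
    by (simp add: power2_norm_eq_inner inner_mats[OF QU])
  also have "\<dots> \<le> (\<Sum>j<s. (norm Q)\<^sup>2 * (norm (col U j))\<^sup>2)"
    by (intro sum_mono) (metis norm_matrix_vector_le norm_ge_zero power_mono power_mult_distrib)
  also have "\<dots> = (norm Q * norm U)\<^sup>2"
    by (simp add: sum_distrib_left[symmetric] power_mult_distrib power2_norm_eq_inner inner_mats[OF U])
  finally show ?thesis by (rule power2_le_imp_le) simp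
qed

lemma bounded_bilinear_left_mult: "bounded_bilinear (left_mult :: real^'n^'n \<Rightarrow> 'n cmat \<Rightarrow> 'n cmat)"
proof
  show "\<exists>K. \<forall>a b. norm (left_mult a b :: 'n cmat) \<le> norm a * norm b * K"
    by (rule exI[of _ 1]) (simp add: norm_left_mult_le)
qed (rule cmat_eqI; simp add: matrix_vector_mult_add_rdistrib matrix_vector_right_distrib
      scaleR_matrix_vector_assoc matrix_vector_mult_scaleR)+

text \<open>The matrix \<open>U V\<^sup>T\<close>.\<close>

definition outer_prod :: "('n::finite) cmat \<Rightarrow> 'n cmat \<Rightarrow> real^'n^'n" where
  "outer_prod U V = (\<chi> a b. \<Sum>j | col U j \<noteq> 0. col U j $ a * col V j $ b)"

lemma outer_prod_mats:
  "U \<in> mats s \<Longrightarrow> outer_prod U V $ a $ b = (\<Sum>j<s. col U j $ a * col V j $ b)"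
  unfolding outer_prod_def
  by (simp, rule sum.mono_neutral_left) (auto simp: mats_def not_le[symmetric])

lemma gram_eq_outer_prod: "gram U = outer_prod U U"
  by (simp add: gram_def outer_prod_def outer_def vec_eq_iff)

lemma inner_outer_prod: "Q \<bullet> outer_prod U V = left_mult Q V \<bullet> U"
proof -
  obtain s where s: "U \<in> mats s" using ex_mats by blast
  have "Q \<bullet> outer_prod U V = (\<Sum>a\<in>UNIV. \<Sum>b\<in>UNIV. \<Sum>j<s. Q $ a $ b * (col U j $ a * col V j $ b))"
    by (simp add: inner_vec_def outer_prod_mats[OF s] sum_distrib_left)
  also have "\<dots> = (\<Sum>j<s. \<Sum>a\<in>UNIV. \<Sum>b\<in>UNIV. Q $ a $ b * (col U j $ a * col V j $ b))"
    by (subst sum.swap, subst sum.swap) (simp add: sum.swap[of _ _ "{..<s}"])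
  also have "\<dots> = U \<bullet> left_mult Q V"
    by (simp add: inner_mats[OF s] inner_vec_def matrix_vector_mult_def sum_distrib_left mult_ac)
  finally show ?thesis by (simp add: inner_commute)
qed

lemma norm_outer_prod_le: "norm (outer_prod U V) \<le> norm U * norm V"
proof (cases "outer_prod U V = 0")
  case False
  let ?M = "outer_prod U V"
  have "norm ?M * norm ?M = left_mult ?M V \<bullet> U"
    by (metis inner_outer_prod power2_eq_square power2_norm_eq_inner)
  also have "\<dots> \<le> norm (left_mult ?M V) * norm U" by (rule norm_cauchy_schwarz)
  also have "\<dots> \<le> norm ?M * (norm U * norm V)"
    using mult_right_mono[OF norm_left_mult_le[of ?M V], of "norm U"] by (simp add: mult_ac)
  finally show ?thesis using False by simp
qed simp

lemma bounded_bilinear_outer_prod: "bounded_bilinear (outer_prod :: 'n cmat \<Rightarrow> _ \<Rightarrow> real^'n^'n)"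
proof
  fix U U' V V' :: "'n cmat" and r :: real
  obtain s where s: "U \<in> mats s" "U' \<in> mats s" using ex_mats2 by blast
  then have s': "U + U' \<in> mats s" "r *\<^sub>R U \<in> mats s"
    by (auto intro: subspace_add[OF subspace_mats] subspace_scale[OF subspace_mats])
  show "outer_prod (U + U') V = outer_prod U V + outer_prod U' V"
    "outer_prod U (V + V') = outer_prod U V + outer_prod U V'"
    "outer_prod (r *\<^sub>R U) V = r *\<^sub>R outer_prod U V"
    "outer_prod U (r *\<^sub>R V) = r *\<^sub>R outer_prod U V"
    unfolding vec_eq_iff vector_add_component vector_scaleR_component outer_prod_mats[OF s(1)]
      outer_prod_mats[OF s(2)] outer_prod_mats[OF s'(1)] outer_prod_mats[OF s'(2)]
    by (simp_all add: algebra_simps sum.distrib sum_distrib_left)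
  show "\<exists>K. \<forall>a b. norm (outer_prod a b :: real^'n^'n) \<le> norm a * norm b * K"
    by (rule exI[of _ 1]) (simp add: norm_outer_prod_le)
qed

interpretation left_mult: bounded_bilinear left_mult by (rule bounded_bilinear_left_mult)
interpretation outer_prod: bounded_bilinear outer_prod by (rule bounded_bilinear_outer_prod)

lemma inner_gram: "Q \<bullet> gram U = left_mult Q U \<bullet> U"
  by (simp add: gram_eq_outer_prod inner_outer_prod)

lemma norm_gram_le: "norm (gram U) \<le> (norm U)\<^sup>2"
  by (simp add: gram_eq_outer_prod norm_outer_prod_le power2_eq_square)

lemma gram_in_sym: "gram U \<in> sym_mats"
  by (simp add: sym_mats_def gram_eq_outer_prod outer_prod_def transpose_def vec_eq_iff mult.commute)

lemma trace_gram: "trace (gram U) = (norm U)\<^sup>2"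
proof -
  obtain s where s: "U \<in> mats s" using ex_mats by blast
  have "trace (gram U) = (\<Sum>a\<in>UNIV. \<Sum>j<s. col U j $ a * col U j $ a)"
    by (simp add: trace_def gram_eq_outer_prod outer_prod_mats[OF s])
  also have "\<dots> = U \<bullet> U" by (subst sum.swap) (simp add: inner_mats[OF s] inner_vec_def)
  finally show ?thesis by (simp add: power2_norm_eq_inner)
qed

lemma inner_outer: "Q \<bullet> outer y = y \<bullet> (Q *v y)"
  by (simp add: inner_vec_def outer_def matrix_vector_mult_def sum_distrib_left mult_ac)

lemma outer_mult_vec: "outer v *v w = (v \<bullet> w) *\<^sub>R v"
proof -
  have "(\<Sum>i\<in>UNIV. v $ a * v $ i * w $ i) = (\<Sum>i\<in>UNIV. v $ i * w $ i) * v $ a" for a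
    by (subst sum_distrib_right, rule sum.cong) simp_all
  then show ?thesis by (simp add: vec_eq_iff outer_def matrix_vector_mult_def inner_vec_def)
qed

lemma psd_gram: "psd (gram U)"
proof -
  have "0 \<le> v \<bullet> (gram U *v v)" for v
  proof -
    obtain s where s: "U \<in> mats s" using ex_mats by blast
    have "v \<bullet> (gram U *v v) = gram U \<bullet> outer v" by (simp add: inner_outer)
    also have "\<dots> = left_mult (outer v) U \<bullet> U" by (metis inner_commute inner_gram)
    also have "\<dots> = (\<Sum>j<s. col U j \<bullet> (outer v *v col U j))"
      using inner_mats[OF s, of "left_mult (outer v) U"] by (simp add: inner_commute)
    also have "\<dots> = (\<Sum>j<s. (col U j \<bullet> v)\<^sup>2)"
      by (simp add: outer_mult_vec power2_eq_square inner_commute)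
    also have "\<dots> \<ge> 0" by (rule sum_nonneg) simp
    finally show ?thesis .
  qed
  then show ?thesis by (simp add: psd_def gram_in_sym)
qed

lemma gram_in_spectraplex: "norm U \<le> 1 \<Longrightarrow> gram U \<in> spectraplex"
  by (simp add: spectraplex_def gram_in_sym psd_gram trace_gram power_le_one)

lemma gram_scaleR: "gram (r *\<^sub>R U) = r\<^sup>2 *\<^sub>R gram U"
  by (simp add: gram_eq_outer_prod outer_prod.scaleR_left outer_prod.scaleR_right power2_eq_square)

lemma append_col_in_mats: "U \<in> mats s \<Longrightarrow> append_col s U y \<in> mats (Suc s)"
  by (auto simp: mats_def)

lemma gram_append_col: "U \<in> mats s \<Longrightarrow> gram (append_col s U y) = gram U + outer y"
  by (simp add: vec_eq_iff gram_eq_outer_prod outer_prod_mats[OF append_col_in_mats] outer_prod_mats outer_def)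

lemma norm_append_col: "U \<in> mats s \<Longrightarrow> (norm (append_col s U y))\<^sup>2 = (norm U)\<^sup>2 + (norm y)\<^sup>2"
  by (simp add: power2_norm_eq_inner inner_mats[OF append_col_in_mats] inner_mats)

lemma zero_in_mats: "0 \<in> mats s"
  by (simp add: mats_def)

lemma gram_zero [simp]: "gram 0 = 0"
  by (simp add: gram_def)

lemma mat_ball_eq: "mat_ball s r = mats s \<inter> cball 0 r"
  by (auto simp: mat_ball_def)

lemma compact_mat_ball: "compact (mat_ball s r :: ('n::finite) cmat set)"
proof (induction s)
  case 0
  have "mat_ball 0 r \<subseteq> {0 :: 'n cmat}"
    by (auto simp: mat_ball_def mats_def intro: cmat_eqI)
  then show ?case by (metis compact_empty compact_sing subset_singletonD)
next
  case (Suc s)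
  define E1 where "E1 = append_col s (0 :: 'n cmat)"
  have bl: "bounded_linear E1"
  proof (rule bounded_linear_intro[where K = 1])
    show "norm (E1 y) \<le> norm y * 1" for y
      using norm_append_col[OF zero_in_mats, of s y] power2_eq_imp_eq[of "norm (E1 y)" "norm y"]
      by (simp add: E1_def)
  qed (rule cmat_eqI; simp add: E1_def)+
  have eq: "append_col s U y = U + E1 y" if "U \<in> mats s" for U y
    using that by (intro cmat_eqI) (auto simp: E1_def mats_def)
  define T where "T = (\<lambda>(U, y). U + E1 y) ` (mat_ball s r \<times> cball 0 r)"
  have "compact T"
    unfolding T_def case_prod_unfold
    by (intro compact_continuous_image compact_Times Suc compact_cball continuous_intros
        bounded_linear.continuous_on[OF bl])
  then have "compact (T \<inter> cball 0 r)" by (rule compact_Int_closed) simp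
  moreover have "mat_ball (Suc s) r = T \<inter> cball 0 r"
  proof (intro equalityI subsetI)
    fix W :: "'n cmat" assume W: "W \<in> mat_ball (Suc s) r"
    define U where "U = append_col s W 0"
    have U: "U \<in> mats s" using W by (auto simp: U_def mats_def mat_ball_def)
    have W': "W = append_col s U (col W s)" by (rule cmat_eqI) (simp add: U_def)
    have n: "norm W \<le> r" using W by (simp add: mat_ball_def)
    have "(norm W)\<^sup>2 = (norm U)\<^sup>2 + (norm (col W s))\<^sup>2"
      using norm_append_col[OF U, of "col W s"] unfolding W'[symmetric] .
    then have "norm U \<le> norm W" "norm (col W s) \<le> norm W"
      by (auto intro: power2_le_imp_le[OF _ norm_ge_zero])
    then have "norm U \<le> r" "norm (col W s) \<le> r" using n by auto
    then have "(U, col W s) \<in> mat_ball s r \<times> cball 0 r" using U by (simp add: mat_ball_def)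
    moreover have "W = (\<lambda>(U, y). U + E1 y) (U, col W s)" using trans[OF W' eq[OF U]] by simp
    ultimately have "W \<in> T" unfolding T_def by (rule rev_image_eqI)
    then show "W \<in> T \<inter> cball 0 r" using n by simp
  next
    fix W assume W: "W \<in> T \<inter> cball 0 r"
    then obtain U y where U: "U \<in> mat_ball s r" "W = U + E1 y" by (auto simp: T_def)
    then have "W = append_col s U y" "U \<in> mats s" using eq by (auto simp: mat_ball_def)
    then show "W \<in> mat_ball (Suc s) r"
      using W append_col_in_mats by (simp add: mat_ball_def)
  qed
  ultimately show ?case by simp
qed

lemma continuous_on_gram: "continuous_on S gram"
  unfolding gram_eq_outer_prod[abs_def]
  by (intro outer_prod.continuous_on continuous_intros)

lemma outer_scaleR: "outer (r *\<^sub>R y) = r\<^sup>2 *\<^sub>R outer y"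
  by (simp add: outer_def vec_eq_iff power2_eq_square)

section \<open>Positive semidefinite matrices as Gram matrices\<close>

lemma psd_quad2:
  assumes "psd Z"
  shows "0 \<le> s\<^sup>2 * Z $ a $ a + 2 * s * t * Z $ a $ b + t\<^sup>2 * Z $ b $ b"
proof -
  let ?v = "s *\<^sub>R axis a 1 + t *\<^sub>R axis b (1::real)"
  have sym: "Z $ b $ a = Z $ a $ b"
    using assms by (auto simp: psd_def sym_mats_def transpose_def vec_eq_iff)
  have "0 \<le> ?v \<bullet> (Z *v ?v)" using assms by (simp add: psd_def)
  also have "\<dots> = s\<^sup>2 * Z $ a $ a + 2 * s * t * Z $ a $ b + t\<^sup>2 * Z $ b $ b"
    by (simp add: matrix_vector_right_distrib matrix_vector_mult_scaleR inner_axis_axis inner_add_left inner_add_right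
        matrix_vector_mul_component inner_axis inner_axis' sym power2_eq_square algebra_simps
        matrix_vector_mult_basis column_def)
  finally show ?thesis .
qed

lemma psd_diag_nonneg: "psd Z \<Longrightarrow> 0 \<le> Z $ a $ a"
  using psd_quad2[of Z 1 a 0 a] by simp

lemma psd_zero_diag:
  assumes "psd Z" "Z $ a $ a = 0"
  shows "Z $ a $ b = 0"
proof (rule ccontr)
  assume nz: "Z $ a $ b \<noteq> 0"
  let ?s = "- (1 + Z $ b $ b) / Z $ a $ b"
  have "0 \<le> ?s\<^sup>2 * Z $ a $ a + 2 * ?s * 1 * Z $ a $ b + 1\<^sup>2 * Z $ b $ b"
    by (rule psd_quad2[OF assms(1)])
  moreover have "2 * ?s * 1 * Z $ a $ b = - 2 * (1 + Z $ b $ b)" using nz by simp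
  ultimately have "0 \<le> - 2 * (1 + Z $ b $ b) + Z $ b $ b" unfolding assms(2) by simp
  then show False using psd_diag_nonneg[OF assms(1), of b] by simp
qed

text \<open>One step of the Cholesky factorization: a rank-one matrix is split off so that the remainder is
  still positive semidefinite and has one more vanishing diagonal entry.\<close>

lemma psd_is_gram:
  assumes "psd (Z :: real^'n^'n)"
  shows "\<exists>s U. U \<in> mats s \<and> gram U = Z"
  using assms
proof (induction "card {a. Z $ a $ a \<noteq> 0}" arbitrary: Z rule: less_induct)
  case less
  show ?case
  proof (cases "\<exists>k. Z $ k $ k \<noteq> 0")
    case False
    then have "Z = 0" using psd_zero_diag[OF less.prems] by (simp add: vec_eq_iff)
    then show ?thesis using zero_in_mats gram_zero by metis
  next
    case True
    then obtain k where k: "Z $ k $ k \<noteq> 0" by blast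
    then have p: "0 < Z $ k $ k" using psd_diag_nonneg[OF less.prems, of k] by simp
    have sym: "Z $ a $ b = Z $ b $ a" for a b
      using less.prems by (auto simp: psd_def sym_mats_def transpose_def vec_eq_iff)
    define y where "y = (1 / sqrt (Z $ k $ k)) *\<^sub>R (Z $ k)"
    define Z' where "Z' = Z - outer y"
    have Z'c: "Z' $ a $ b = Z $ a $ b - Z $ k $ a * Z $ k $ b / Z $ k $ k" for a b
      using p by (simp add: Z'_def y_def outer_def real_sqrt_mult_self)
    have ps: "psd Z'"
      unfolding psd_def
    proof (intro conjI allI)
      show "Z' \<in> sym_mats"
        unfolding sym_mats_def transpose_def mem_Collect_eq vec_eq_iff vec_lambda_beta Z'c
        by (intro allI arg_cong2[where f = "(-)"] sym arg_cong2[where f = "(/)"] mult.commute refl)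
      fix v :: "real^'n"
      let ?r = "(Z $ k \<bullet> v) / Z $ k $ k"
      let ?w = "v - ?r *\<^sub>R axis k 1"
      have ax: "Z *v axis k 1 = Z $ k"
        by (simp add: matrix_vector_mult_basis column_def vec_eq_iff) (metis sym)
      have "0 \<le> ?w \<bullet> (Z *v ?w)" using less.prems by (simp add: psd_def)
      also have "Z *v ?w = Z *v v - ?r *\<^sub>R Z $ k"
        by (simp only: matrix_vector_mult_diff_distrib matrix_vector_mult_scaleR ax)
      also have "?w \<bullet> (Z *v v - ?r *\<^sub>R Z $ k) = v \<bullet> (Z *v v) - ?r * (v \<bullet> Z $ k) - ?r * (Z *v v) $ k + ?r * ?r * Z $ k $ k"
        by (simp only: inner_diff_left inner_diff_right inner_scaleR_left inner_scaleR_right inner_axis' inner_real_def)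
          (simp add: algebra_simps)
      also have "\<dots> = v \<bullet> (Z *v v) - 2 * ?r * (Z $ k \<bullet> v) + ?r\<^sup>2 * Z $ k $ k"
        unfolding matrix_vector_mul_component inner_commute[of v "Z $ k"] power2_eq_square by simp
      also have "\<dots> = v \<bullet> (Z *v v) - (Z $ k \<bullet> v)\<^sup>2 / Z $ k $ k"
        using k by (simp add: field_simps power2_eq_square)
      also have "\<dots> = v \<bullet> (Z' *v v)"
      proof -
        have "v \<bullet> (outer y *v v) = (y \<bullet> v)\<^sup>2" by (simp add: outer_mult_vec power2_eq_square inner_commute)
        also have "\<dots> = (Z $ k \<bullet> v)\<^sup>2 / Z $ k $ k"
          using p by (simp add: y_def power_mult_distrib power_divide)
        finally show ?thesis by (simp add: Z'_def matrix_vector_mult_diff_rdistrib inner_diff_right)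
      qed
      finally show "0 \<le> v \<bullet> (Z' *v v)" .
    qed
    have "{a. Z' $ a $ a \<noteq> 0} \<subset> {a. Z $ a $ a \<noteq> 0}"
    proof (rule psubsetI)
      show "{a. Z' $ a $ a \<noteq> 0} \<subseteq> {a. Z $ a $ a \<noteq> 0}"
        using psd_zero_diag[OF less.prems] sym by (auto simp: Z'c)
      show "{a. Z' $ a $ a \<noteq> 0} \<noteq> {a. Z $ a $ a \<noteq> 0}"
        using k by (auto simp: Z'c set_eq_iff intro!: exI[of _ k])
    qed
    then have "card {a. Z' $ a $ a \<noteq> 0} < card {a. Z $ a $ a \<noteq> 0}"
      by (intro psubset_card_mono) auto
    from less.hyps[OF this ps] obtain s U where "U \<in> mats s" "gram U = Z'" by blast
    then have "gram (append_col s U y) = Z" "append_col s U y \<in> mats (Suc s)"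
      by (auto simp: gram_append_col append_col_in_mats Z'_def)
    then show ?thesis by blast
  qed
qed

section \<open>The minimum eigenvalue\<close>

lemma sym_mats_inner:
  assumes "Q \<in> sym_mats"
  shows "(Q *v u) \<bullet> v = u \<bullet> (Q *v v)"
proof -
  have "transpose Q = Q" using assms by (simp add: sym_mats_def)
  then show ?thesis using dot_lmul_matrix[of u Q v] by (simp flip: transpose_matrix_vector)
qed

text \<open>The minimum of the quadratic form over the unit sphere is attained at an eigenvector.\<close>

lemma rayleigh_minimum:
  fixes Q :: "real^'n^'n"
  assumes Q: "Q \<in> sym_mats"
  obtains c v where "norm v = 1" "is_eigenpair Q c v" "\<And>w. c * (norm w)\<^sup>2 \<le> w \<bullet> (Q *v w)"
proof -
  have "continuous_on (sphere 0 1) (\<lambda>v. v \<bullet> (Q *v v))"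
    by (intro continuous_intros linear_continuous_on matrix_vector_mul_bounded_linear)
  moreover have "compact (sphere 0 1 :: (real^'n) set)" "sphere (0::real^'n) 1 \<noteq> {}"
    by auto
  ultimately obtain v where v: "norm v = 1" and
    min: "\<And>w. norm w = 1 \<Longrightarrow> v \<bullet> (Q *v v) \<le> w \<bullet> (Q *v w)"
    using continuous_attains_inf[of "sphere 0 1" "\<lambda>v. v \<bullet> (Q *v v)"] by auto
  define c where "c = v \<bullet> (Q *v v)"
  have ge: "c * (norm w)\<^sup>2 \<le> w \<bullet> (Q *v w)" for w
  proof (cases "w = 0")
    case False
    have "c \<le> (w /\<^sub>R norm w) \<bullet> (Q *v (w /\<^sub>R norm w))"
      unfolding c_def by (rule min) (use False in simp)
    also have "\<dots> = (w \<bullet> (Q *v w)) / (norm w)\<^sup>2"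
      by (simp add: matrix_vector_mult_scaleR power2_eq_square divide_inverse)
    finally show ?thesis using False by (simp add: field_simps)
  qed simp
  define r where "r = Q *v v - c *\<^sub>R v"
  define n where "n = r \<bullet> (Q *v r) - c * (r \<bullet> r)"
  have n0: "0 \<le> n" using ge[of r] by (simp add: n_def power2_norm_eq_inner)
  have quad: "0 \<le> 2 * t * (norm r)\<^sup>2 + t\<^sup>2 * n" for t
  proof -
    have "0 \<le> (v + t *\<^sub>R r) \<bullet> (Q *v (v + t *\<^sub>R r)) - c * ((v + t *\<^sub>R r) \<bullet> (v + t *\<^sub>R r))"
      using ge[of "v + t *\<^sub>R r"] by (simp add: power2_norm_eq_inner)
    also have "\<dots> = (v \<bullet> (Q *v v) - c * (v \<bullet> v)) + t * (v \<bullet> (Q *v r)) + t * (r \<bullet> (Q *v v))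
        - 2 * t * c * (v \<bullet> r) + t\<^sup>2 * n"
      by (simp add: matrix_vector_right_distrib matrix_vector_mult_scaleR inner_add_left inner_add_right
          n_def algebra_simps power2_eq_square[of t] inner_commute[of r v])
    also have "v \<bullet> (Q *v r) = (Q *v v) \<bullet> r" using sym_mats_inner[OF Q, of v r] by simp
    also have "v \<bullet> (Q *v v) - c * (v \<bullet> v) = 0"
      using v by (simp add: c_def flip: power2_norm_eq_inner)
    also have "0 + t * ((Q *v v) \<bullet> r) + t * (r \<bullet> (Q *v v)) - 2 * t * c * (v \<bullet> r) + t\<^sup>2 * n
        = 2 * t * (r \<bullet> r) + t\<^sup>2 * n"
      by (simp add: r_def inner_diff_left inner_diff_right inner_commute algebra_simps)
    finally show ?thesis by (simp add: power2_norm_eq_inner)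
  qed
  have "r = 0"
  proof (cases "n = 0")
    case True then show ?thesis using quad[of "-1"] by simp
  next
    case False
    then have "0 \<le> - ((norm r)\<^sup>2)\<^sup>2 / n"
      using quad[of "- (norm r)\<^sup>2 / n"] by (simp add: field_simps power2_eq_square)
    then show ?thesis using n0 False by (simp add: divide_le_0_iff)
  qed
  then have "is_eigenpair Q c v" using v by (auto simp: is_eigenpair_def r_def)
  then show ?thesis using that v ge by blast
qed

lemma finite_eigenvalues:
  fixes Q :: "real^'n^'n"
  assumes Q: "Q \<in> sym_mats"
  shows "finite {c. \<exists>v. is_eigenpair Q c v}" (is "finite ?C")
proof -
  define f where "f c = (SOME v. is_eigenpair Q c v)" for c
  have f: "is_eigenpair Q c (f c)" if "c \<in> ?C" for c
    using that unfolding f_def by (auto intro: someI)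
  have orth: "f c \<bullet> f c' = 0" if "c \<in> ?C" "c' \<in> ?C" "c \<noteq> c'" for c c'
  proof -
    have "c * (f c \<bullet> f c') = c' * (f c \<bullet> f c')"
      using sym_mats_inner[OF Q, of "f c" "f c'"] f[OF that(1)] f[OF that(2)] by (simp add: is_eigenpair_def)
    then show ?thesis using that by simp
  qed
  have nz: "f c \<noteq> 0" if "c \<in> ?C" for c using f[OF that] by (simp add: is_eigenpair_def)
  have "inj_on f ?C"
  proof (rule inj_onI, rule ccontr)
    fix c c' assume "c \<in> ?C" "c' \<in> ?C" "f c = f c'" "c \<noteq> c'"
    then show False using orth[of c c'] nz[of c] by simp
  qed
  moreover have "pairwise orthogonal (f ` ?C)"
    unfolding pairwise_def orthogonal_def using orth by blast
  then have "independent (f ` ?C)"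
    using nz by (intro pairwise_orthogonal_independent) force+
  then have "finite (f ` ?C)" by (rule independent_imp_finite)
  ultimately show ?thesis using finite_imageD by blast
qed

text \<open>The number \<open>lambda_min Q\<close> is a minimum over finitely many eigenvalues, among them the minimum of the
  quadratic form, which is the smallest one.\<close>

lemma lambda_min:
  fixes Q :: "real^'n^'n"
  assumes Q: "Q \<in> sym_mats"
  shows lambda_min_le: "lambda_min Q * (norm w)\<^sup>2 \<le> w \<bullet> (Q *v w)"
    and lambda_min_eigenpair: "\<exists>v. is_eigenpair Q (lambda_min Q) v \<and> norm v = 1"
proof -
  obtain c v where cv: "norm v = 1" "is_eigenpair Q c v" and ge: "\<And>w. c * (norm w)\<^sup>2 \<le> w \<bullet> (Q *v w)"
    using rayleigh_minimum[OF Q] by metis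
  have "lambda_min Q = c"
    unfolding lambda_min_def
  proof (rule Min_eqI[OF finite_eigenvalues[OF Q]])
    show "c \<in> {c. \<exists>v. is_eigenpair Q c v}" using cv by blast
    fix b assume "b \<in> {c. \<exists>v. is_eigenpair Q c v}"
    then obtain w where "w \<noteq> 0" "Q *v w = b *\<^sub>R w" by (auto simp: is_eigenpair_def)
    then show "c \<le> b" using ge[of w] by (simp flip: power2_norm_eq_inner)
  qed
  then show "lambda_min Q * (norm w)\<^sup>2 \<le> w \<bullet> (Q *v w)" "\<exists>v. is_eigenpair Q (lambda_min Q) v \<and> norm v = 1"
    using ge cv by auto
qed

text \<open>The linear form \<open>Z \<mapsto> Q \<bullet> Z\<close> is minimized over the spectraplex by \<open>v v\<^sup>T\<close> for a minimum
  eigenvector \<open>v\<close>, or by \<open>0\<close>.\<close>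

lemma inner_spectraplex_ge:
  fixes Q :: "real^'n^'n"
  assumes Q: "Q \<in> sym_mats" and Z: "Z \<in> spectraplex"
  shows "- max (- lambda_min Q) 0 \<le> Q \<bullet> Z"
proof -
  obtain s U where U: "U \<in> mats s" "gram U = Z"
    using psd_is_gram[of Z] Z by (auto simp: spectraplex_def)
  have tr: "(norm U)\<^sup>2 \<le> 1" using Z by (simp add: U(2)[symmetric] trace_gram spectraplex_def)
  have LU: "left_mult Q U \<in> mats s" using U(1) by (auto simp: mats_def)
  have "lambda_min Q * (norm U)\<^sup>2 = (\<Sum>j<s. lambda_min Q * (norm (col U j))\<^sup>2)"
    by (simp add: power2_norm_eq_inner inner_mats[OF U(1)] sum_distrib_left)
  also have "\<dots> \<le> (\<Sum>j<s. col U j \<bullet> (Q *v col U j))"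
    by (intro sum_mono lambda_min_le[OF Q])
  also have "\<dots> = Q \<bullet> Z"
    by (simp add: U(2)[symmetric] inner_gram inner_mats[OF LU] inner_commute[of "col U _"])
  finally have *: "lambda_min Q * (norm U)\<^sup>2 \<le> Q \<bullet> Z" .
  have "- max (- lambda_min Q) 0 * 1 \<le> - max (- lambda_min Q) 0 * (norm U)\<^sup>2"
    by (rule mult_left_mono_neg) (use tr in auto)
  also have "\<dots> \<le> lambda_min Q * (norm U)\<^sup>2"
    by (rule mult_right_mono) auto
  finally show ?thesis using * by simp
qed

section \<open>The factorized function\<close>

lemma left_mult_symmetric:
  assumes "Q \<in> sym_mats"
  shows "left_mult Q U \<bullet> V = left_mult Q V \<bullet> U"
proof -
  obtain s where s: "U \<in> mats s" "V \<in> mats s" using ex_mats2 by blast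
  then have "left_mult Q U \<in> mats s" "left_mult Q V \<in> mats s" by (auto simp: mats_def)
  then have "left_mult Q U \<bullet> V = (\<Sum>j<s. (Q *v col U j) \<bullet> col V j)"
    and "left_mult Q V \<bullet> U = (\<Sum>j<s. (Q *v col V j) \<bullet> col U j)" by (simp_all add: inner_mats)
  moreover have "(Q *v u) \<bullet> v = (Q *v v) \<bullet> u" for u v
    using sym_mats_inner[OF assms, of u v] by (simp only: inner_commute[of u])
  ultimately show ?thesis by (simp only:)
qed

text \<open>The gradient of \<open>aipp_smooth g lam W\<close>, see \<open>gradient_aipp_smooth\<close>.\<close>

definition prox_gradient :: "(real^'n^'n \<Rightarrow> real) \<Rightarrow> real \<Rightarrow> 'n cmat \<Rightarrow> 'n cmat \<Rightarrow> 'n cmat" where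
  "prox_gradient g lam W U = (2 * lam) *\<^sub>R left_mult (grad g (gram U)) U + (U - W)"

locale convex_differentiable =
  fixes g :: "real^'n^'n \<Rightarrow> real"
  assumes convex: "convex_on sym_mats g"
    and differentiable: "g differentiable_on sym_mats"
begin

lemma grad_in_sym: "Z \<in> sym_mats \<Longrightarrow> grad g Z \<in> sym_mats"
  using gradient_on_in[OF subspace_sym_mats] differentiable by (auto simp: differentiable_on_def)

lemma grad_derivative:
  "Z \<in> sym_mats \<Longrightarrow> (g has_derivative (\<lambda>H. grad g Z \<bullet> H)) (at Z within sym_mats)"
  using gradient_on_derivative[OF subspace_sym_mats] differentiable by (auto simp: differentiable_on_def)

lemma grad_inequality:
  "Z \<in> sym_mats \<Longrightarrow> Z' \<in> sym_mats \<Longrightarrow> g Z + grad g Z \<bullet> (Z' - Z) \<le> g Z'"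
  by (rule gradient_inequality[OF subspace_sym_mats differentiable convex])

lemma continuous_on_grad_gram: "continuous_on S (\<lambda>U. grad g (gram U))"
  using continuous_on_gradient[OF subspace_sym_mats differentiable convex]
  by (rule continuous_on_compose2[OF _ continuous_on_gram]) (auto intro: gram_in_sym)

lemma gradient_aipp_smooth:
  assumes W: "W \<in> mats s" and U: "U \<in> mats s"
  shows "gradient_on (mats s) (aipp_smooth g lam W) U = prox_gradient g lam W U"
proof (rule gradient_on_eqI[OF subspace_mats U])
  show "prox_gradient g lam W U \<in> mats s"
    using W U by (auto simp: prox_gradient_def mats_def)
  let ?G = "grad g (gram U)"
  have dg: "(gram has_derivative (\<lambda>H. outer_prod U H + outer_prod H U)) (at U within mats s)"
    unfolding gram_eq_outer_prod[abs_def]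
    by (rule outer_prod.FDERIV[OF has_derivative_ident has_derivative_ident])
  have "(g has_derivative (\<lambda>H. ?G \<bullet> H)) (at (gram U) within gram ` mats s)"
    using grad_derivative[OF gram_in_sym] by (rule has_derivative_subset) (auto intro: gram_in_sym)
  from has_derivative_in_compose[OF dg this]
  have 1: "((\<lambda>U. g (gram U)) has_derivative (\<lambda>H. ?G \<bullet> (outer_prod U H + outer_prod H U))) (at U within mats s)" .
  have 2: "((\<lambda>V. (V - W) \<bullet> (V - W)) has_derivative (\<lambda>H. 2 * ((U - W) \<bullet> H))) (at U within mats s)"
    by (auto intro!: derivative_eq_intros simp: inner_commute)
  have 3: "((\<lambda>V. lam * g (gram V) + 1 / 2 * ((V - W) \<bullet> (V - W))) has_derivative
     (\<lambda>H. lam * (?G \<bullet> (outer_prod U H + outer_prod H U)) + 1 / 2 * (2 * ((U - W) \<bullet> H)))) (at U within mats s)"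
    by (intro has_derivative_add has_derivative_mult_right 1 2)
  have eq: "?G \<bullet> (outer_prod U H + outer_prod H U) = 2 * (left_mult ?G U \<bullet> H)" for H
    by (simp add: inner_add_right inner_outer_prod left_mult_symmetric[OF grad_in_sym[OF gram_in_sym], of _ H U])
  show "(aipp_smooth g lam W has_derivative (\<bullet>) (prox_gradient g lam W U)) (at U within mats s)"
    using 3 unfolding eq aipp_smooth_def[abs_def] prox_gradient_def power2_norm_eq_inner
    by (simp add: inner_add_left[abs_def] mult_ac)
qed

text \<open>
  Convexity of \<open>g\<close> alone bounds the negative curvature of \<open>U \<mapsto> g (U U\<^sup>T)\<close> at \<open>V\<close>
  by the norm of the gradient of \<open>g\<close> at \<open>V V\<^sup>T\<close>.
\<close>

lemma aipp_smooth_lower: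
  assumes lam: "0 \<le> lam"
  shows "aipp_smooth g lam W V + prox_gradient g lam W V \<bullet> (U - V)
      + (1 / 2 - lam * norm (grad g (gram V))) * (norm (U - V))\<^sup>2 \<le> aipp_smooth g lam W U"
proof -
  let ?G = "grad g (gram V)" and ?H = "U - V"
  have gram: "gram U - gram V = outer_prod V ?H + outer_prod ?H V + gram ?H"
    by (simp add: gram_eq_outer_prod outer_prod.diff_left outer_prod.diff_right)
  have "?G \<bullet> (gram U - gram V) = 2 * (left_mult ?G V \<bullet> ?H) + ?G \<bullet> gram ?H"
    unfolding gram inner_add_right inner_outer_prod
      left_mult_symmetric[OF grad_in_sym[OF gram_in_sym], of _ ?H V] by simp
  moreover have "g (gram V) + ?G \<bullet> (gram U - gram V) \<le> g (gram U)"
    by (rule grad_inequality[OF gram_in_sym gram_in_sym])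
  moreover have "\<bar>?G \<bullet> gram ?H\<bar> \<le> norm ?G * (norm ?H)\<^sup>2"
    using Cauchy_Schwarz_ineq2[of ?G "gram ?H"] mult_left_mono[OF norm_gram_le[of ?H] norm_ge_zero[of ?G]] by linarith
  ultimately have "g (gram V) + 2 * (left_mult ?G V \<bullet> ?H) - norm ?G * (norm ?H)\<^sup>2 \<le> g (gram U)" by linarith
  from mult_left_mono[OF this lam]
  have "lam * g (gram V) + 2 * lam * (left_mult ?G V \<bullet> ?H) - lam * norm ?G * (norm ?H)\<^sup>2 \<le> lam * g (gram U)"
    by (simp add: algebra_simps)
  moreover have "(norm (U - W))\<^sup>2 = (norm (V - W))\<^sup>2 + 2 * ((V - W) \<bullet> ?H) + (norm ?H)\<^sup>2"
    by (simp add: power2_norm_eq_inner inner_diff_left inner_diff_right inner_commute)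
  ultimately show ?thesis
    by (simp add: aipp_smooth_def prox_gradient_def inner_add_left algebra_simps)
qed

lemma continuous_on_prox_gradient: "continuous_on S (prox_gradient g lam W)"
  unfolding prox_gradient_def[abs_def]
  by (intro continuous_intros left_mult.continuous_on continuous_on_grad_gram)

lemma grad_gram_bounded: "bdd_above ((\<lambda>U. norm (grad g (gram U))) ` mat_ball s r)"
  by (intro bounded_imp_bdd_above compact_imp_bounded compact_continuous_image compact_mat_ball
      continuous_on_norm continuous_on_grad_gram)

lemma norm_grad_le_grad_bound: "U \<in> mat_ball s 3 \<Longrightarrow> norm (grad g (gram U)) \<le> grad_bound g s"
  unfolding grad_bound_def by (rule cSUP_upper[OF _ grad_gram_bounded])

lemma grad_bound_mono: "s \<le> s' \<Longrightarrow> grad_bound g s \<le> grad_bound g s'"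
  unfolding grad_bound_def
proof (rule cSUP_subset_mono[OF _ grad_gram_bounded])
  have "0 \<in> mat_ball s 3" using zero_in_mats[of s] by (simp add: mat_ball_def)
  then show "mat_ball s 3 \<noteq> {}" by blast
qed (use mats_mono in \<open>auto simp: mat_ball_def\<close>)

text \<open>The bound on \<open>\<nabla>g\<close> is available on the spectraplex only, hence this one only on the unit ball.\<close>

lemma prox_gradient_lipschitz:
  assumes L: "0 \<le> Lg" "\<forall>Z\<in>spectraplex. \<forall>Z'\<in>spectraplex. norm (grad g Z' - grad g Z) \<le> Lg * norm (Z' - Z)"
    and lam: "0 \<le> lam"
  obtains K where "\<And>U V. U \<in> mats s \<Longrightarrow> norm U \<le> 1 \<Longrightarrow> V \<in> mats s \<Longrightarrow> norm V \<le> 1 \<Longrightarrow>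
    norm (prox_gradient g lam W U - prox_gradient g lam W V) \<le> K * norm (U - V)"
proof
  fix U V :: "'n cmat" assume U: "U \<in> mats s" "norm U \<le> 1" and V: "V \<in> mats s" "norm V \<le> 1"
  let ?G = "\<lambda>U. grad g (gram U)"
  have "gram U - gram V = outer_prod U (U - V) + outer_prod (U - V) V"
    by (simp add: gram_eq_outer_prod outer_prod.diff_left outer_prod.diff_right)
  then have "norm (gram U - gram V) \<le> norm (outer_prod U (U - V)) + norm (outer_prod (U - V) V)"
    by (simp add: norm_triangle_ineq)
  also have "\<dots> \<le> 1 * norm (U - V) + norm (U - V) * 1"
    using norm_outer_prod_le[of U "U - V"] norm_outer_prod_le[of "U - V" V] U(2) V(2)
    by (intro add_mono; metis (no_types, opaque_lifting) mult_left_mono mult_right_mono norm_ge_zero order_trans)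
  finally have gr: "norm (gram U - gram V) \<le> 2 * norm (U - V)" by simp
  have "norm (?G U - ?G V) \<le> Lg * norm (gram U - gram V)"
    using L(2) gram_in_spectraplex[OF U(2)] gram_in_spectraplex[OF V(2)] by blast
  also have "\<dots> \<le> Lg * (2 * norm (U - V))" by (rule mult_left_mono[OF gr L(1)])
  finally have GL: "norm (?G U - ?G V) \<le> Lg * (2 * norm (U - V))" .
  have "left_mult (?G U) U - left_mult (?G V) V = left_mult (?G U - ?G V) U + left_mult (?G V) (U - V)"
    by (simp add: left_mult.diff_left left_mult.diff_right)
  then have "norm (left_mult (?G U) U - left_mult (?G V) V)
      \<le> norm (left_mult (?G U - ?G V) U) + norm (left_mult (?G V) (U - V))"
    by (simp add: norm_triangle_ineq)
  also have "\<dots> \<le> Lg * (2 * norm (U - V)) * 1 + grad_bound g s * norm (U - V)"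
  proof (rule add_mono)
    show "norm (left_mult (?G U - ?G V) U) \<le> Lg * (2 * norm (U - V)) * 1"
      using GL U(2) L(1) by (intro order_trans[OF norm_left_mult_le] mult_mono) auto
    have "V \<in> mat_ball s 3" using V by (simp add: mat_ball_def)
    then show "norm (left_mult (?G V) (U - V)) \<le> grad_bound g s * norm (U - V)"
      by (intro order_trans[OF norm_left_mult_le] mult_right_mono norm_grad_le_grad_bound) auto
  qed
  finally have lm: "norm (left_mult (?G U) U - left_mult (?G V) V) \<le> (2 * Lg + grad_bound g s) * norm (U - V)"
    by (simp add: algebra_simps)
  have "prox_gradient g lam W U - prox_gradient g lam W V
     = (2 * lam) *\<^sub>R (left_mult (?G U) U - left_mult (?G V) V) + (U - V)"
    by (simp add: prox_gradient_def algebra_simps)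
  then have "norm (prox_gradient g lam W U - prox_gradient g lam W V)
     \<le> 2 * lam * norm (left_mult (?G U) U - left_mult (?G V) V) + norm (U - V)"
    using norm_triangle_ineq[of "(2 * lam) *\<^sub>R (left_mult (?G U) U - left_mult (?G V) V)" "U - V"] lam by simp
  also have "\<dots> \<le> 2 * lam * ((2 * Lg + grad_bound g s) * norm (U - V)) + norm (U - V)"
    using lm lam by (intro add_mono mult_left_mono) auto
  finally show "norm (prox_gradient g lam W U - prox_gradient g lam W V)
     \<le> (2 * lam * (2 * Lg + grad_bound g s) + 1) * norm (U - V)"
    by (simp add: algebra_simps)
qed

end

section \<open>Projection onto the unit ball\<close>

text \<open>The point of the closed unit ball that is nearest to \<open>w\<close>.\<close>

definition ball_proj :: "'a::real_inner \<Rightarrow> 'a" where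
  "ball_proj w = (if norm w \<le> 1 then w else (1 / norm w) *\<^sub>R w)"

lemma norm_ball_proj_le: "norm (ball_proj w) \<le> 1"
  by (simp add: ball_proj_def)

lemma norm_ball_proj_eq: "1 \<le> norm w \<Longrightarrow> norm (ball_proj w) = 1"
  by (auto simp: ball_proj_def)

lemma ball_proj_in_subspace: "subspace E \<Longrightarrow> w \<in> E \<Longrightarrow> ball_proj w \<in> E"
  by (simp add: ball_proj_def subspace_scale)

lemma ball_proj_id: "norm w \<le> 1 \<Longrightarrow> ball_proj w = w"
  by (simp add: ball_proj_def)

lemma ball_proj_inner_le:
  assumes "norm u \<le> 1"
  shows "(w - ball_proj w) \<bullet> (u - ball_proj w) \<le> 0"
proof (cases "norm w \<le> 1")
  case False
  define p where "p = ball_proj w"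
  have np: "norm p = 1" using False by (simp add: p_def norm_ball_proj_eq)
  have w: "w - p = (norm w - 1) *\<^sub>R p"
  proof -
    have "norm w *\<^sub>R p = w" using False by (auto simp: p_def ball_proj_def)
    then show ?thesis by (simp add: scaleR_diff_left)
  qed
  have "p \<bullet> u \<le> 1"
    using norm_cauchy_schwarz[of p u] np assms by simp
  then have "(norm w - 1) * (p \<bullet> (u - p)) \<le> 0"
    using False np by (simp add: mult_le_0_iff inner_diff_right norm_eq_1)
  then show ?thesis unfolding p_def[symmetric] w by simp
qed (simp add: ball_proj_def)

lemma ball_proj_nonexpansive: "norm (ball_proj u - ball_proj v) \<le> norm (u - v)"
proof -
  let ?d = "ball_proj u - ball_proj v"
  have "(u - ball_proj u) \<bullet> (ball_proj v - ball_proj u) \<le> 0" "(v - ball_proj v) \<bullet> (ball_proj u - ball_proj v) \<le> 0"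
    by (intro ball_proj_inner_le norm_ball_proj_le)+
  then have "?d \<bullet> ?d \<le> (u - v) \<bullet> ?d"
    by (simp add: inner_diff_left inner_diff_right inner_commute)
  also have "\<dots> \<le> norm (u - v) * norm ?d" by (rule norm_cauchy_schwarz)
  finally have "norm ?d * norm ?d \<le> norm (u - v) * norm ?d"
    by (simp add: power2_eq_square flip: power2_norm_eq_inner)
  then show ?thesis by (cases "?d = 0") auto
qed

section \<open>A single ADAP-FISTA call\<close>

text \<open>
  The call minimizes \<open>\<psi>\<close> over the unit ball of the subspace \<open>E\<close>, starting at \<open>x0\<close>; \<open>D\<close> is the
  gradient of \<open>\<psi>\<close>.
\<close>

locale fista =
  fixes E :: "'a::real_inner set" and \<psi> :: "'a \<Rightarrow> real" and D :: "'a \<Rightarrow> 'a"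
    and \<mu> \<sigma> chi :: real and x0 :: 'a
  assumes subspace: "subspace E"
    and D_in: "\<And>z. z \<in> E \<Longrightarrow> D z \<in> E"
    and gradient: "\<And>z. z \<in> E \<Longrightarrow> gradient_on E \<psi> z = D z"
    and mu: "0 < \<mu>" "\<mu> < 1" and sigma: "0 < \<sigma>" and chi: "0 < chi" "chi < 1"
    and x0: "x0 \<in> E" "norm x0 \<le> 1"
begin

abbreviation step :: "'a fista_state \<Rightarrow> 'a fista_state \<Rightarrow> bool" where
  "step \<equiv> fista_step \<sigma> chi E \<mu> x0 \<psi> (indicator_fn (E \<inter> cball 0 1))"

text \<open>The point \<open>y\<^sub>i\<^sub>+\<^sub>1\<close> computed from the extrapolated point \<open>z\<close>.\<close>

definition prox :: "real \<Rightarrow> 'a \<Rightarrow> 'a" where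
  "prox L z = ball_proj (z - (1 / L) *\<^sub>R D z)"

text \<open>The scalar \<open>a\<^sub>i\<close>.  During a call \<open>\<tau>\<^sub>i = 1 + \<mu> A\<^sub>i\<close>, so \<open>\<tau>\<^sub>i\<close> is not a separate argument.\<close>

definition stepsize :: "real \<Rightarrow> real \<Rightarrow> real" where
  "stepsize A L = ((1 + \<mu> * A) + sqrt ((1 + \<mu> * A)\<^sup>2 + 4 * (1 + \<mu> * A) * A * (L - \<mu>))) / (2 * (L - \<mu>))"

text \<open>The extrapolated point, a convex combination of \<open>y\<close> and \<open>x\<close>.\<close>

definition mid :: "'a \<Rightarrow> 'a \<Rightarrow> real \<Rightarrow> real \<Rightarrow> 'a" where
  "mid y x A L = (1 / (A + stepsize A L)) *\<^sub>R (A *\<^sub>R y + stepsize A L *\<^sub>R x)"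

text \<open>The descent test of step (2) for the extrapolated point \<open>z\<close> and the new point \<open>w\<close>.\<close>

definition accepted :: "real \<Rightarrow> 'a \<Rightarrow> 'a \<Rightarrow> bool" where
  "accepted L z w \<longleftrightarrow> \<psi> w \<le> \<psi> z + D z \<bullet> (w - z) + (1 - chi) * L / 4 * (norm (w - z))\<^sup>2"

text \<open>The vector \<open>v\<^sub>i\<^sub>+\<^sub>1\<close>.\<close>

definition residual :: "real \<Rightarrow> 'a \<Rightarrow> 'a \<Rightarrow> 'a" where
  "residual L z w = D w - D z + L *\<^sub>R (z - w)"

lemma prox_in: "z \<in> E \<Longrightarrow> prox L z \<in> E"
  unfolding prox_def
  by (intro ball_proj_in_subspace subspace subspace_diff subspace_scale D_in)

lemma norm_prox: "norm (prox L z) \<le> 1"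
  by (simp add: prox_def norm_ball_proj_le)

lemma prox_inner_ge:
  assumes "0 < L" "norm u \<le> 1"
  shows "0 \<le> (D z + L *\<^sub>R (prox L z - z)) \<bullet> (u - prox L z)"
proof -
  have "L * ((z - (1 / L) *\<^sub>R D z - prox L z) \<bullet> (u - prox L z)) \<le> 0"
    using ball_proj_inner_le[OF assms(2), of "z - (1 / L) *\<^sub>R D z"] assms(1)
    by (simp add: mult_le_0_iff prox_def)
  also have "L * ((z - (1 / L) *\<^sub>R D z - prox L z) \<bullet> (u - prox L z))
      = (L *\<^sub>R (z - (1 / L) *\<^sub>R D z - prox L z)) \<bullet> (u - prox L z)" by simp
  also have "L *\<^sub>R (z - (1 / L) *\<^sub>R D z - prox L z) = - (D z + L *\<^sub>R (prox L z - z))"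
    using assms(1) by (simp add: algebra_simps)
  finally show ?thesis unfolding inner_minus_left by linarith
qed

text \<open>The prox objective grows quadratically away from its minimizer.\<close>

lemma prox_three_point:
  assumes "0 < L" "norm u \<le> 1"
  shows "D z \<bullet> (prox L z - z) + L / 2 * (norm (prox L z - z))\<^sup>2 + L / 2 * (norm (u - prox L z))\<^sup>2
    \<le> D z \<bullet> (u - z) + L / 2 * (norm (u - z))\<^sup>2"
proof -
  let ?w = "prox L z"
  have "(norm (u - z))\<^sup>2 = (norm (u - ?w))\<^sup>2 + 2 * ((?w - z) \<bullet> (u - ?w)) + (norm (?w - z))\<^sup>2"
    by (simp add: power2_norm_eq_inner inner_diff_left inner_diff_right inner_commute)
  then have "L / 2 * (norm (u - z))\<^sup>2
      = L / 2 * (norm (u - ?w))\<^sup>2 + L * ((?w - z) \<bullet> (u - ?w)) + L / 2 * (norm (?w - z))\<^sup>2"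
    by (simp add: distrib_left)
  moreover have "D z \<bullet> (u - z) = D z \<bullet> (u - ?w) + D z \<bullet> (?w - z)" by (simp add: inner_diff_right)
  ultimately show ?thesis
    using prox_inner_ge[OF assms, of z] unfolding inner_add_left inner_scaleR_left by linarith
qed

lemma prox_arg_min_iff:
  assumes L: "0 < L" and z: "z \<in> E"
  shows "is_arg_min (\<lambda>u. ereal (linearization E \<psi> u z) + indicator_fn (E \<inter> cball 0 1) u + ereal (L / 2 * (norm (u - z))\<^sup>2))
     (\<lambda>u. u \<in> E \<and> indicator_fn (E \<inter> cball 0 1) u < \<infinity>) w \<longleftrightarrow> w = prox L z"
    (is "is_arg_min ?f ?S w \<longleftrightarrow> _")
proof -
  let ?h = "\<lambda>u. \<psi> z + D z \<bullet> (u - z) + L / 2 * (norm (u - z))\<^sup>2"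
  have S: "?S u \<longleftrightarrow> u \<in> E \<and> norm u \<le> 1" for u by (auto simp: indicator_fn_def)
  have f: "?f u = ereal (?h u)" if "?S u" for u
    using that z unfolding S by (simp add: indicator_fn_def linearization_def gradient)
  have pS: "?S (prox L z)" unfolding S using prox_in[OF z] norm_prox by simp
  have ineq: "?h (prox L z) + L / 2 * (norm (u - prox L z))\<^sup>2 \<le> ?h u" if "?S u" for u
    using prox_three_point[OF L, of u z] that unfolding S by simp
  show ?thesis
  proof
    assume w: "is_arg_min ?f ?S w"
    then have "?h w \<le> ?h (prox L z)"
      using pS f[OF pS] f[of w] unfolding is_arg_min_def by (metis ereal_less_eq(3) linorder_not_less)
    then have "L / 2 * (norm (w - prox L z))\<^sup>2 \<le> 0"
      using ineq[of w] w unfolding is_arg_min_def by linarith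
    then show "w = prox L z" using L by (simp add: mult_le_0_iff)
  next
    assume w: "w = prox L z"
    have "\<not> ?f u < ?f w" if "?S u" for u
    proof -
      have "0 \<le> L / 2 * (norm (u - prox L z))\<^sup>2" using L by simp
      then have "?h w \<le> ?h u" using ineq[OF that] unfolding w by linarith
      then show ?thesis using f[OF that] f[OF pS] by (simp add: w)
    qed
    then show "is_arg_min ?f ?S w" using pS unfolding is_arg_min_def w by blast
  qed
qed

lemma stepsize:
  assumes "0 \<le> A" "1 \<le> L"
  shows stepsize_pos: "0 < stepsize A L"
    and stepsize_eq: "(L - \<mu>) * (stepsize A L)\<^sup>2 = (1 + \<mu> * A) * (A + stepsize A L)"
proof -
  let ?\<tau> = "1 + \<mu> * A" and ?k = "L - \<mu>"
  have t: "0 < ?\<tau>" using assms mu by (simp add: add_pos_nonneg)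
  have k: "0 < ?k" using assms mu by simp
  have d: "0 \<le> ?\<tau>\<^sup>2 + 4 * ?\<tau> * A * ?k" using t k assms by simp
  show "0 < stepsize A L"
    unfolding stepsize_def using t k d
    by (intro divide_pos_pos add_pos_nonneg[OF t real_sqrt_ge_zero[OF d]]) simp
  define r where "r = sqrt (?\<tau>\<^sup>2 + 4 * ?\<tau> * A * ?k)"
  have r: "r\<^sup>2 = ?\<tau>\<^sup>2 + 4 * ?\<tau> * A * ?k" using d by (simp add: r_def)
  have a: "2 * ?k * stepsize A L = ?\<tau> + r"
    unfolding stepsize_def r_def using k by simp
  have "(2 * ?k * stepsize A L)\<^sup>2 = ?\<tau>\<^sup>2 + 2 * ?\<tau> * r + r\<^sup>2" unfolding a by (simp add: power2_sum)
  also have "\<dots> = 4 * ?\<tau> * A * ?k + 2 * ?\<tau> * (?\<tau> + r)" unfolding r by (simp add: power2_eq_square algebra_simps)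
  also have "\<dots> = 4 * ?k * (?\<tau> * (A + stepsize A L))" unfolding a[symmetric] by (simp add: algebra_simps)
  also have "(2 * ?k * stepsize A L)\<^sup>2 = 4 * ?k * (?k * (stepsize A L)\<^sup>2)"
    by algebra
  finally have "4 * ?k * (?k * (stepsize A L)\<^sup>2) = 4 * ?k * (?\<tau> * (A + stepsize A L))" .
  then show "?k * (stepsize A L)\<^sup>2 = ?\<tau> * (A + stepsize A L)" using k by simp
qed

lemma mid_in: "y \<in> E \<Longrightarrow> x \<in> E \<Longrightarrow> mid y x A L \<in> E"
  unfolding mid_def by (intro subspace_scale subspace_add subspace)

lemma fista_trial_iff:
  assumes "y \<in> E" "x \<in> E" "1 \<le> L"
  shows "fista_trial E \<mu> \<psi> (indicator_fn (E \<inter> cball 0 1)) y x A (1 + \<mu> * A) L a z w \<longleftrightarrow>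
    a = stepsize A L \<and> z = mid y x A L \<and> w = prox L (mid y x A L)"
proof -
  have "mid y x A L \<in> E" "0 < L" using assms mid_in by auto
  note arg_min = prox_arg_min_iff[OF this(2,1)]
  show ?thesis
    unfolding fista_trial_def stepsize_def[symmetric] arg_min[symmetric]
    by (rule conj_cong[OF refl], simp only: mid_def[symmetric] cong: conj_cong)
qed

lemma fista_descent_iff: "z \<in> E \<Longrightarrow> fista_descent E chi \<psi> L z w \<longleftrightarrow> accepted L z w"
  by (simp add: fista_descent_def accepted_def linearization_def gradient)

lemma fista_residual_eq: "z \<in> E \<Longrightarrow> w \<in> E \<Longrightarrow> fista_residual E \<psi> L z w = residual L z w"
  by (simp add: fista_residual_def residual_def gradient)

text \<open>The new iterate \<open>x\<close> is an extrapolation along the last move of the iterate \<open>y\<close>.\<close>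

definition extrapolation :: "real \<Rightarrow> real \<Rightarrow> real" where
  "extrapolation A L = (1 + \<mu> * A) * A / (stepsize A L * (1 + \<mu> * (A + stepsize A L)))"

lemma next_x_scaled:
  assumes "0 \<le> A" "1 \<le> L" and z: "z = mid y x A L" and a: "a = stepsize A L"
    and x': "x' = (1 / (1 + \<mu> * A + a * \<mu>)) *\<^sub>R ((\<mu> * a) *\<^sub>R w + (1 + \<mu> * A) *\<^sub>R x - a *\<^sub>R ((L - \<mu>) *\<^sub>R (z - w)))"
  shows "(1 + \<mu> * (A + a)) *\<^sub>R (x' - w) = (1 + \<mu> * A) *\<^sub>R (x - w) - (a * (L - \<mu>)) *\<^sub>R (z - w)"
proof -
  have "0 < 1 + \<mu> * (A + a)"
    using assms(1,2) mu stepsize_pos[OF assms(1,2)] a by (simp add: add_pos_nonneg)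
  moreover have eq: "1 + \<mu> * A + a * \<mu> = 1 + \<mu> * (A + a)" by (simp add: algebra_simps)
  ultimately have "(1 + \<mu> * (A + a)) *\<^sub>R x' = (\<mu> * a) *\<^sub>R w + (1 + \<mu> * A) *\<^sub>R x - a *\<^sub>R ((L - \<mu>) *\<^sub>R (z - w))"
    unfolding x' eq by simp
  moreover have "(1 + \<mu> * (A + a)) *\<^sub>R w = (\<mu> * a) *\<^sub>R w + (1 + \<mu> * A) *\<^sub>R w"
    by (simp add: distrib_left flip: scaleR_add_left)
  ultimately show ?thesis by (simp add: scaleR_diff_right[of "1 + \<mu> * _"])
qed

lemma next_x_extrapolation:
  assumes "0 \<le> A" "1 \<le> L" and z: "z = mid y x A L" and a: "a = stepsize A L"
    and x': "x' = (1 / (1 + \<mu> * A + a * \<mu>)) *\<^sub>R ((\<mu> * a) *\<^sub>R w + (1 + \<mu> * A) *\<^sub>R x - a *\<^sub>R ((L - \<mu>) *\<^sub>R (z - w)))"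
  shows "x' - w = extrapolation A L *\<^sub>R (w - y)"
proof -
  let ?\<tau> = "1 + \<mu> * A" and ?\<tau>' = "1 + \<mu> * (A + a)"
  have ap: "0 < a" using stepsize_pos[OF assms(1,2)] a by simp
  have tp: "0 < ?\<tau>'" using assms(1) mu ap by (simp add: add_pos_nonneg)
  have "a * (a * (L - \<mu>)) = ?\<tau> * (A + a)"
    using stepsize_eq[OF assms(1,2)] by (simp add: a power2_eq_square mult_ac)
  then have k: "a * (L - \<mu>) = ?\<tau> * (A + a) / a" using ap by (simp add: field_simps)
  have "(A + a) *\<^sub>R z = A *\<^sub>R y + a *\<^sub>R x"
    unfolding z mid_def a[symmetric] using assms(1) ap by simp
  then have "(A + a) *\<^sub>R (z - w) = A *\<^sub>R (y - w) + a *\<^sub>R (x - w)" by (simp add: algebra_simps)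
  then have "(a * (L - \<mu>)) *\<^sub>R (z - w) = (?\<tau> / a) *\<^sub>R (A *\<^sub>R (y - w) + a *\<^sub>R (x - w))"
    unfolding k by (metis (no_types, lifting) scaleR_scaleR times_divide_eq_left)
  also have "\<dots> = (?\<tau> * A / a) *\<^sub>R (y - w) + ?\<tau> *\<^sub>R (x - w)"
    using ap by (simp add: scaleR_add_right)
  finally have "?\<tau>' *\<^sub>R (x' - w) = (?\<tau> * A / a) *\<^sub>R (w - y)"
    using next_x_scaled[OF assms] by (simp add: scaleR_diff_right)
  then have "(1 / ?\<tau>') *\<^sub>R ?\<tau>' *\<^sub>R (x' - w) = (1 / ?\<tau>') *\<^sub>R (?\<tau> * A / a) *\<^sub>R (w - y)" by simp
  then show ?thesis using tp unfolding extrapolation_def a[symmetric] by (simp add: mult_ac)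
qed

text \<open>The initial point is not a stationary point of \<open>\<psi>\<close> on the unit ball.\<close>

definition nonstationary :: bool where
  "nonstationary \<longleftrightarrow> (\<exists>u\<in>E. norm u \<le> 1 \<and> D x0 \<bullet> (u - x0) < 0)"

text \<open>Invariant of a call.  If \<open>x0\<close> is stationary, the first iteration succeeds; so \<open>A\<close> is only positive if it is not.\<close>

primrec inv :: "'a fista_state \<Rightarrow> bool" where
  "inv (Fista_Search y x A \<tau> L) \<longleftrightarrow> y \<in> E \<and> norm y \<le> 1 \<and> x \<in> E \<and> 0 \<le> A \<and> \<tau> = 1 + \<mu> * A \<and> 1 \<le> L \<and>
     (A = 0 \<longrightarrow> y = x0 \<and> x = x0) \<and> (A \<noteq> 0 \<longrightarrow> nonstationary)"
| "inv (Fista_Success y v L) \<longleftrightarrow> y \<in> E \<and> norm y \<le> 1 \<and> norm v \<le> \<sigma> * norm (y - x0) \<and> 1 \<le> L"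
| "inv Fista_Failure \<longleftrightarrow> True"

lemma inv_init: "1 \<le> L \<Longrightarrow> inv (fista_init x0 L)"
  using x0 by (simp add: fista_init_def)

lemma prox_stationary:
  assumes L: "0 < L" and ns: "\<not> nonstationary"
  shows "prox L x0 = x0"
proof -
  have "prox L x0 \<in> E" "norm (prox L x0) \<le> 1" using prox_in x0 norm_prox by auto
  then have "0 \<le> D x0 \<bullet> (prox L x0 - x0)" using ns by (force simp: nonstationary_def)
  then have "L / 2 * (norm (prox L x0 - x0))\<^sup>2 + L / 2 * (norm (x0 - prox L x0))\<^sup>2 \<le> 0"
    using prox_three_point[OF L x0(2), of x0] by simp
  then have "L * (norm (prox L x0 - x0))\<^sup>2 \<le> 0" by (simp add: norm_minus_commute)
  then show ?thesis using L by (simp add: mult_le_0_iff)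
qed

text \<open>What one transition does, in the terms introduced above.\<close>

lemma step_cases:
  assumes inv: "inv (Fista_Search y x A \<tau> L)" and st: "step (Fista_Search y x A \<tau> L) s'"
  defines "a \<equiv> stepsize A L" and "z \<equiv> mid y x A L"
  defines "w \<equiv> prox L z"
  obtains (backtrack) "\<not> accepted L z w" "s' = Fista_Search y x A \<tau> (2 * L)"
  | (failure) "accepted L z w" "\<not> chi * (A + a) * L * (norm (w - z))\<^sup>2 \<le> (norm (w - x0))\<^sup>2" "s' = Fista_Failure"
  | (success) "accepted L z w" "norm (residual L z w) \<le> \<sigma> * norm (w - x0)" "s' = Fista_Success w (residual L z w) L"
  | (continue) x' where "accepted L z w" "chi * (A + a) * L * (norm (w - z))\<^sup>2 \<le> (norm (w - x0))\<^sup>2"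
     "\<sigma> * norm (w - x0) < norm (residual L z w)"
     "x' - w = extrapolation A L *\<^sub>R (w - y)"
     "(1 + \<mu> * (A + a)) *\<^sub>R (x' - w) = (1 + \<mu> * A) *\<^sub>R (x - w) - (a * (L - \<mu>)) *\<^sub>R (z - w)"
     "s' = Fista_Search w x' (A + a) (1 + \<mu> * (A + a)) L"
proof -
  have yx: "y \<in> E" "x \<in> E" "1 \<le> L" "\<tau> = 1 + \<mu> * A" "0 \<le> A" using inv by auto
  have zE: "z \<in> E" unfolding z_def by (rule mid_in) (use yx in auto)
  have wE: "w \<in> E" unfolding w_def by (rule prox_in[OF zE])
  note trial = fista_trial_iff[OF yx(1,2,3), where A = A, folded yx(4), folded a_def z_def, folded w_def]
  show ?thesis
    using st
  proof (cases rule: fista_step.cases)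
    case (backtrack a' xt y')
    then have "xt = z" "y' = w" using trial by auto
    then show ?thesis using that(1) backtrack fista_descent_iff[OF zE] by auto
  next
    case (failure a' xt y')
    then have "a' = a" "xt = z" "y' = w" using trial by auto
    then show ?thesis using that(2) failure fista_descent_iff[OF zE] by auto
  next
    case (success a' xt y' v)
    then have "a' = a" "xt = z" "y' = w" using trial by auto
    then show ?thesis using that(3) success fista_descent_iff[OF zE] fista_residual_eq[OF zE wE] by auto
  next
    case (continue a' xt y' \<tau>' s'' x')
    then have eqs: "a' = a" "xt = z" "y' = w" using trial by auto
    have x': "x' = (1 / (1 + \<mu> * A + a * \<mu>)) *\<^sub>R ((\<mu> * a) *\<^sub>R w + (1 + \<mu> * A) *\<^sub>R x - a *\<^sub>R ((L - \<mu>) *\<^sub>R (z - w)))"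
      using continue eqs yx(4) by simp
    have a: "a = stepsize A L" and z: "z = mid y x A L" by (simp_all add: a_def z_def)
    note * = next_x_extrapolation[OF yx(5,3) z a x'] next_x_scaled[OF yx(5,3) z a x']
    have "accepted L z w" "chi * (A + a) * L * (norm (w - z))\<^sup>2 \<le> (norm (w - x0))\<^sup>2"
      "\<sigma> * norm (w - x0) < norm (residual L z w)"
      using continue(3-5) eqs fista_descent_iff[OF zE] fista_residual_eq[OF zE wE] by auto
    moreover have "s' = Fista_Search w x' (A + a) (1 + \<mu> * (A + a)) L"
      using continue(1,6) eqs yx(4) by (simp add: distrib_left mult.commute)
    ultimately show ?thesis using that(4) * by blast
  qed
qed

lemma inv_step:
  assumes inv: "inv s" and st: "step s s'"
  shows "inv s'"
proof (cases s)
  case (Fista_Search y x A \<tau> L)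
  note inv' = inv[unfolded Fista_Search] and st' = st[unfolded Fista_Search]
  have yx: "y \<in> E" "norm y \<le> 1" "x \<in> E" "1 \<le> L" "\<tau> = 1 + \<mu> * A" "0 \<le> A" using inv' by auto
  let ?z = "mid y x A L"
  let ?w = "prox L ?z"
  have zE: "?z \<in> E" by (rule mid_in) (use yx in auto)
  have w: "?w \<in> E" "norm ?w \<le> 1" using prox_in[OF zE] norm_prox by auto
  from inv' st' show ?thesis
  proof (cases rule: step_cases)
    case (continue x')
    have a: "0 < stepsize A L" by (rule stepsize_pos[OF yx(6,4)])
    have "x' = ?w + extrapolation A L *\<^sub>R (?w - y)" using continue(4) by (simp add: algebra_simps)
    then have "x' \<in> E" using w yx subspace by (simp add: subspace_add subspace_diff subspace_scale)
    moreover have nonstationary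
    proof (cases "A = 0")
      case True
      then have "?z = x0" using inv' a by (simp add: mid_def)
      show ?thesis
      proof (rule ccontr)
        assume "\<not> nonstationary"
        then have "?w = x0" using prox_stationary[of L] yx \<open>?z = x0\<close> by simp
        then show False using continue(3) \<open>?z = x0\<close> by (simp add: residual_def)
      qed
    qed (use inv' in auto)
    ultimately show ?thesis using continue w yx a by simp
  qed (use inv' w in auto)
qed (use st in \<open>auto elim: fista_step.cases\<close>)

lemma inv_reachable: "step\<^sup>*\<^sup>* s s' \<Longrightarrow> inv s \<Longrightarrow> inv s'"
  by (induction rule: rtranclp_induct) (auto intro: inv_step)

lemma step_exists:
  assumes "inv (Fista_Search y x A \<tau> L)"
  shows "\<exists>s'. step (Fista_Search y x A \<tau> L) s'"
proof -
  have yx: "y \<in> E" "x \<in> E" "1 \<le> L" "\<tau> = 1 + \<mu> * A" using assms by auto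
  have "fista_trial E \<mu> \<psi> (indicator_fn (E \<inter> cball 0 1)) y x A \<tau> L (stepsize A L) (mid y x A L) (prox L (mid y x A L))"
    unfolding yx(4) fista_trial_iff[OF yx(1,2,3)] by simp
  note t = fista_step.intros[OF this]
  show ?thesis
  proof (cases "fista_descent E chi \<psi> L (mid y x A L) (prox L (mid y x A L))")
    case False
    from t(1)[OF this] show ?thesis ..
  next
    case desc: True
    show ?thesis
    proof (cases "chi * (A + stepsize A L) * L * (norm (prox L (mid y x A L) - mid y x A L))\<^sup>2
        \<le> (norm (prox L (mid y x A L) - x0))\<^sup>2")
      case False
      from t(2)[OF desc this] show ?thesis ..
    next
      case cond: True
      show ?thesis
      proof (cases "norm (fista_residual E \<psi> L (mid y x A L) (prox L (mid y x A L)))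
          \<le> \<sigma> * norm (prox L (mid y x A L) - x0)")
        case True
        from t(3)[OF desc cond refl this] show ?thesis ..
      next
        case False
        from t(4)[OF desc cond this refl refl refl] show ?thesis ..
      qed
    qed
  qed
qed

end

section \<open>ADAP-FISTA in the strongly convex case\<close>

text \<open>
  If \<open>\<psi>\<close> is strongly convex in the following sense, the call never fails and its output satisfies the
  inequality tested by ADAP-AIPP.  The extrapolated points leave the unit ball, but stay in
  the ball of radius \<open>3\<close>.
\<close>

locale strongly_convex_fista = fista +
  fixes ystar
  assumes strongly_convex: "\<And>u z. u \<in> E \<Longrightarrow> norm u \<le> 1 \<Longrightarrow> z \<in> E \<Longrightarrow> norm z \<le> 3 \<Longrightarrow>
     \<psi> z + D z \<bullet> (u - z) + \<mu> / 2 * (norm (u - z))\<^sup>2 \<le> \<psi> u"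
    and ystar: "ystar \<in> E" "norm ystar \<le> 1" "\<And>u. u \<in> E \<Longrightarrow> norm u \<le> 1 \<Longrightarrow> \<psi> ystar \<le> \<psi> u"
begin

text \<open>The potential function \<open>A (\<psi> y - \<psi> u) + \<tau> / 2 (norm (u - x))\<^sup>2\<close> of accelerated gradient methods
  decreases, for every \<open>u\<close> in the unit ball; the decrease also bounds the length of the step.\<close>

lemma potential_step:
  assumes y: "y \<in> E" "norm y \<le> 1" and x: "x \<in> E" "norm x \<le> 3" and A: "0 \<le> A" and L: "1 \<le> L"
    and u: "u \<in> E" "norm u \<le> 1"
  defines "a \<equiv> stepsize A L" and "z \<equiv> mid y x A L"
  defines "w \<equiv> prox L z"
  assumes acc: "accepted L z w"
    and x': "(1 + \<mu> * (A + a)) *\<^sub>R (x' - w) = (1 + \<mu> * A) *\<^sub>R (x - w) - (a * (L - \<mu>)) *\<^sub>R (z - w)"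
  shows "(A + a) * \<psi> w + (1 + chi) / 4 * (A + a) * L * (norm (w - z))\<^sup>2 + (1 + \<mu> * (A + a)) / 2 * (norm (u - x'))\<^sup>2
     \<le> A * \<psi> y + a * \<psi> u + (1 + \<mu> * A) / 2 * (norm (u - x))\<^sup>2"
proof -
  have a: "0 < a" and aeq: "(L - \<mu>) * a\<^sup>2 = (1 + \<mu> * A) * (A + a)"
    unfolding a_def by (rule stepsize_pos[OF A L], rule stepsize_eq[OF A L])
  define \<tau> where "\<tau> = 1 + \<mu> * A"
  define \<tau>' where "\<tau>' = 1 + \<mu> * (A + a)"
  have tt: "0 < \<tau>" "\<tau> \<le> \<tau>'" "\<tau>' = \<tau> + \<mu> * a" using A a mu 
    by (simp_all add: \<tau>_def \<tau>'_def add_pos_nonneg distrib_left)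
  have zE: "z \<in> E" unfolding z_def by (rule mid_in) (use y x in auto)
  have w: "w \<in> E" "norm w \<le> 1" using prox_in[OF zE] norm_prox by (auto simp: w_def)
  have Az: "(A + a) *\<^sub>R z = A *\<^sub>R y + a *\<^sub>R x"
    unfolding z_def mid_def a_def[symmetric] using A a by simp
  have "(A + a) * norm z \<le> norm (A *\<^sub>R y) + norm (a *\<^sub>R x)"
    using norm_triangle_ineq[of "A *\<^sub>R y" "a *\<^sub>R x"] A a unfolding Az[symmetric] by simp
  also have "\<dots> \<le> (A + a) * 3"
  proof -
    have "A * norm y \<le> A * 3" "a * norm x \<le> a * 3" using A a y x by (auto intro!: mult_left_mono)
    moreover have "norm (A *\<^sub>R y) = A * norm y" "norm (a *\<^sub>R x) = a * norm x" using A a by auto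
    ultimately show ?thesis unfolding distrib_right by linarith
  qed
  finally have z3: "norm z \<le> 3" using A a mult_le_cancel_left_pos[of "A + a" "norm z" 3] by linarith
  define s where "s = (L - \<mu>) *\<^sub>R (z - w)"
  define Y where "Y = y - w"
  define X where "X = x - w"
  define Z where "Z = z - w"
  define U where "U = u - w"
  define X' where "X' = x' - w"
  define c where "c = \<psi> z + D z \<bullet> (w - z) + \<mu> / 2 * (norm (w - z))\<^sup>2"
  \<comment> \<open>a quadratic minorant of \<open>\<psi>\<close> on the unit ball with gradient \<open>s\<close> at \<open>w\<close>\<close>
  have minorant: "c + s \<bullet> (v - w) + \<mu> / 2 * (norm (v - w))\<^sup>2 \<le> \<psi> v" if v: "v \<in> E" "norm v \<le> 1" for v
  proof -
    have "(norm (v - z))\<^sup>2 = (norm (v - w))\<^sup>2 + 2 * ((w - z) \<bullet> (v - w)) + (norm (w - z))\<^sup>2"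
      by (simp add: power2_norm_eq_inner inner_diff_left inner_diff_right inner_commute)
    then have "\<mu> / 2 * (norm (v - z))\<^sup>2
        = \<mu> / 2 * (norm (v - w))\<^sup>2 + \<mu> * ((w - z) \<bullet> (v - w)) + \<mu> / 2 * (norm (w - z))\<^sup>2"
      by (simp add: distrib_left)
    moreover have "0 \<le> (D z + L *\<^sub>R (w - z)) \<bullet> (v - w)"
      unfolding w_def by (rule prox_inner_ge) (use L v in auto)
    moreover have "s \<bullet> (v - w) = \<mu> * ((w - z) \<bullet> (v - w)) - L * ((w - z) \<bullet> (v - w))"
      by (simp add: s_def inner_diff_left algebra_simps)
    moreover have "D z \<bullet> (v - z) = D z \<bullet> (v - w) + D z \<bullet> (w - z)" by (simp add: inner_diff_right)
    ultimately show ?thesis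
      using strongly_convex[OF v zE z3] unfolding c_def inner_add_left inner_scaleR_left by linarith
  qed
  have AZ: "(A + a) *\<^sub>R Z = A *\<^sub>R Y + a *\<^sub>R X"
    using Az by (simp add: Z_def Y_def X_def algebra_simps)
  have sZ: "s = (L - \<mu>) *\<^sub>R Z" by (simp add: s_def Z_def)
  have X': "\<tau>' *\<^sub>R X' = \<tau> *\<^sub>R X - a *\<^sub>R s"
    using x' by (simp add: X'_def \<tau>'_def \<tau>_def X_def s_def)
  have 1: "A * (s \<bullet> Y) + a * (s \<bullet> X) = (A + a) * (L - \<mu>) * (Z \<bullet> Z)"
  proof -
    have "A * (s \<bullet> Y) + a * (s \<bullet> X) = s \<bullet> (A *\<^sub>R Y + a *\<^sub>R X)" by (simp add: inner_add_right)
    also have "\<dots> = s \<bullet> ((A + a) *\<^sub>R Z)" by (simp only: AZ)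
    finally show ?thesis by (simp add: sZ)
  qed
  have 2: "a * (s \<bullet> U) + \<mu> * a / 2 * (U \<bullet> U) + \<tau> / 2 * ((U - X) \<bullet> (U - X)) - \<tau>' / 2 * ((U - X') \<bullet> (U - X'))
      = \<tau> / 2 * (X \<bullet> X) - \<tau>' / 2 * (X' \<bullet> X')"
  proof -
    have "U \<bullet> (\<tau>' *\<^sub>R X') = U \<bullet> (\<tau> *\<^sub>R X - a *\<^sub>R s)" by (simp only: X')
    then have "\<tau>' * (U \<bullet> X') = \<tau> * (U \<bullet> X) - a * (s \<bullet> U)" by (simp add: inner_diff_right inner_commute)
    then show ?thesis
      by (simp add: inner_diff_left inner_diff_right inner_commute[of X U] inner_commute[of X' U] tt(3) field_simps)
  qed
  have 3: "\<tau>' / 2 * (X' \<bullet> X') \<le> \<tau> / 2 * (X \<bullet> X) - a * (s \<bullet> X) + (A + a) * (L - \<mu>) / 2 * (Z \<bullet> Z)"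
  proof -
    have "\<tau>' * (\<tau>' * (X' \<bullet> X')) = (\<tau>' *\<^sub>R X') \<bullet> (\<tau>' *\<^sub>R X')" by simp
    also have "\<dots> = \<tau> * (\<tau> * (X \<bullet> X) - 2 * a * (s \<bullet> X)) + a\<^sup>2 * (s \<bullet> s)"
      unfolding X' by (simp add: inner_diff_left inner_diff_right inner_commute[of X s] power2_eq_square algebra_simps)
    also have "a\<^sup>2 * (s \<bullet> s) = ((L - \<mu>) * a\<^sup>2) * (L - \<mu>) * (Z \<bullet> Z)" by (simp add: sZ mult_ac)
    also have "\<dots> = \<tau> * ((A + a) * (L - \<mu>) * (Z \<bullet> Z))" unfolding aeq by (simp add: \<tau>_def mult_ac)
    finally have eq: "\<tau>' * (\<tau>' * (X' \<bullet> X')) = \<tau> * (\<tau> * (X \<bullet> X) - 2 * a * (s \<bullet> X) + (A + a) * (L - \<mu>) * (Z \<bullet> Z))"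
      by (simp add: algebra_simps)
    have "\<tau> * (\<tau>' * (X' \<bullet> X')) \<le> \<tau>' * (\<tau>' * (X' \<bullet> X'))"
      using tt by (intro mult_right_mono) auto
    then have "\<tau>' * (X' \<bullet> X') \<le> \<tau> * (X \<bullet> X) - 2 * a * (s \<bullet> X) + (A + a) * (L - \<mu>) * (Z \<bullet> Z)"
      unfolding eq using tt(1) by simp
    then show ?thesis by (simp add: field_simps)
  qed
  define zz where "zz = (norm (w - z))\<^sup>2"
  define p where "p = (norm (u - x))\<^sup>2"
  define p' where "p' = (norm (u - x'))\<^sup>2"
  have eqs: "Z \<bullet> Z = zz" "(U - X) \<bullet> (U - X) = p" "(U - X') \<bullet> (U - X') = p'"
    by (simp_all add: zz_def p_def p'_def Z_def U_def X_def X'_def norm_minus_commute flip: power2_norm_eq_inner)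
  have "A * (c + s \<bullet> Y + \<mu> / 2 * (norm Y)\<^sup>2) \<le> A * \<psi> y"
    using minorant[OF y] A by (intro mult_left_mono) (auto simp: Y_def)
  moreover have "0 \<le> A * (\<mu> / 2 * (norm Y)\<^sup>2)" using A mu by simp
  ultimately have 4: "A * c + A * (s \<bullet> Y) \<le> A * \<psi> y" by (simp add: distrib_left)
  have "a * (c + s \<bullet> U + \<mu> / 2 * (norm U)\<^sup>2) \<le> a * \<psi> u"
    using minorant[OF u] a by (intro mult_left_mono) (auto simp: U_def)
  then have 5: "a * c + a * (s \<bullet> U) + \<mu> * a / 2 * (U \<bullet> U) \<le> a * \<psi> u"
    by (simp add: distrib_left power2_norm_eq_inner mult.left_commute)
  have "\<psi> w + (1 + chi) / 4 * L * zz \<le> c + (L - \<mu>) / 2 * zz"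
    using acc unfolding accepted_def c_def zz_def by (simp add: field_simps)
  then have "(A + a) * (\<psi> w + (1 + chi) / 4 * L * zz) \<le> (A + a) * (c + (L - \<mu>) / 2 * zz)"
    using A a by (intro mult_left_mono) auto
  moreover have "(A + a) * (\<psi> w + (1 + chi) / 4 * L * zz) = (A + a) * \<psi> w + (1 + chi) / 4 * (A + a) * L * zz"
    "(A + a) * (c + (L - \<mu>) / 2 * zz) = A * c + a * c + (A + a) * (L - \<mu>) / 2 * zz"
    by (simp_all add: algebra_simps)
  moreover have "(A + a) * (L - \<mu>) * zz = 2 * ((A + a) * (L - \<mu>) / 2 * zz)" by simp
  ultimately show ?thesis
    using 1 2 3 4 5
    unfolding eqs zz_def[symmetric] p_def[symmetric] p'_def[symmetric] \<tau>_def[symmetric] \<tau>'_def[symmetric]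
    by linarith
qed

text \<open>For a search state, the potential at every \<open>u\<close> is at most its initial value; with the minimizer for
  \<open>u\<close> this confines \<open>x\<close> to the ball of radius \<open>3\<close>.  A successful end satisfies the inequality tested by ADAP-AIPP.\<close>

primrec pot_inv :: "'a fista_state \<Rightarrow> bool" where
  "pot_inv (Fista_Search y x A \<tau> L) \<longleftrightarrow> norm x \<le> 3 \<and>
     (\<forall>u. u \<in> E \<longrightarrow> norm u \<le> 1 \<longrightarrow> A * (\<psi> y - \<psi> u) + (1 + \<mu> * A) / 2 * (norm (u - x))\<^sup>2 \<le> 1 / 2 * (norm (u - x0))\<^sup>2)"
| "pot_inv (Fista_Success y v L) \<longleftrightarrow> v \<bullet> (x0 - y) \<le> \<psi> x0 - \<psi> y"
| "pot_inv Fista_Failure \<longleftrightarrow> False"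

lemma pot_inv_step:
  assumes inv: "inv s" and pot: "pot_inv s" and st: "step s s'"
  shows "pot_inv s'"
proof (cases s)
  case (Fista_Search y x A \<tau> L)
  note inv' = inv[unfolded Fista_Search] and st' = st[unfolded Fista_Search] and pot' = pot[unfolded Fista_Search]
  have yx: "y \<in> E" "norm y \<le> 1" "x \<in> E" "1 \<le> L" "\<tau> = 1 + \<mu> * A" "0 \<le> A" "norm x \<le> 3" using inv' pot' by auto
  define a where "a = stepsize A L"
  define z where "z = mid y x A L"
  define w where "w = prox L z"
  have a: "0 < a" unfolding a_def by (rule stepsize_pos[OF yx(6,4)])
  have zE: "z \<in> E" unfolding z_def by (rule mid_in) (use yx in auto)
  have w: "w \<in> E" "norm w \<le> 1" using prox_in[OF zE] norm_prox by (auto simp: w_def)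
  note pstep = potential_step[OF yx(1,2,3,7,6,4), folded a_def z_def, folded w_def]
  have pot_next: "(A + a) * (\<psi> w - \<psi> u) + (1 + chi) / 4 * (A + a) * L * (norm (w - z))\<^sup>2
      + (1 + \<mu> * (A + a)) / 2 * (norm (u - x'))\<^sup>2 \<le> 1 / 2 * (norm (u - x0))\<^sup>2"
    if "accepted L z w" "u \<in> E" "norm u \<le> 1"
      "(1 + \<mu> * (A + a)) *\<^sub>R (x' - w) = (1 + \<mu> * A) *\<^sub>R (x - w) - (a * (L - \<mu>)) *\<^sub>R (z - w)" for u x'
  proof -
    have "A * (\<psi> y - \<psi> u) + (1 + \<mu> * A) / 2 * (norm (u - x))\<^sup>2 \<le> 1 / 2 * (norm (u - x0))\<^sup>2"
      using pot' that(2,3) by auto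
    moreover have "A * (\<psi> y - \<psi> u) = A * \<psi> y + a * \<psi> u - (A + a) * \<psi> u"
      "(A + a) * (\<psi> w - \<psi> u) = (A + a) * \<psi> w - (A + a) * \<psi> u"
      by (simp_all add: algebra_simps)
    ultimately show ?thesis using pstep[OF that(2,3,1,4)] by linarith
  qed
  from inv' st' show ?thesis
  proof (cases rule: step_cases)
    case backtrack
    then show ?thesis using pot' by simp
  next
    case failure
    note failure = failure[folded a_def z_def, folded w_def]
    define x' where "x' = w + (1 / (1 + \<mu> * (A + a))) *\<^sub>R ((1 + \<mu> * A) *\<^sub>R (x - w) - (a * (L - \<mu>)) *\<^sub>R (z - w))"
    have p: "0 < 1 + \<mu> * (A + a)" using mu yx a by (simp add: add_pos_nonneg)
    have "(A + a) * (\<psi> w - \<psi> w) + (1 + chi) / 4 * (A + a) * L * (norm (w - z))\<^sup>2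
      + (1 + \<mu> * (A + a)) / 2 * (norm (w - x'))\<^sup>2 \<le> 1 / 2 * (norm (w - x0))\<^sup>2"
      by (rule pot_next) (use failure w p in \<open>auto simp: x'_def\<close>)
    moreover have "0 \<le> (1 + \<mu> * (A + a)) / 2 * (norm (w - x'))\<^sup>2" using p by simp
    moreover have "(1 + chi) / 4 * (A + a) * L * (norm (w - z))\<^sup>2 = (1 + chi) / 4 * ((A + a) * L * (norm (w - z))\<^sup>2)"
      by (simp only: mult.assoc)
    ultimately have "(1 + chi) / 2 * ((A + a) * L * (norm (w - z))\<^sup>2) \<le> (norm (w - x0))\<^sup>2"
      by (simp only: diff_self mult_zero_right add_0_left)
    moreover have "chi * ((A + a) * L * (norm (w - z))\<^sup>2) \<le> (1 + chi) / 2 * ((A + a) * L * (norm (w - z))\<^sup>2)"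
      using chi yx a by (intro mult_right_mono) auto
    ultimately show ?thesis using failure(2) by (simp add: mult_ac)
  next
    case success
    note success = success[folded a_def z_def, folded w_def]
    have "0 \<le> (D z + L *\<^sub>R (w - z)) \<bullet> (x0 - w)"
      unfolding w_def by (rule prox_inner_ge) (use yx x0 in auto)
    moreover have "\<psi> w + D w \<bullet> (x0 - w) + \<mu> / 2 * (norm (x0 - w))\<^sup>2 \<le> \<psi> x0"
      by (rule strongly_convex) (use x0 w in auto)
    moreover have "0 \<le> \<mu> / 2 * (norm (x0 - w))\<^sup>2" using mu by simp
    ultimately show ?thesis
      using success by (simp add: residual_def inner_add_left inner_diff_left algebra_simps)
  next
    case (continue x')
    note continue = continue[folded a_def z_def, folded w_def]
    have pot1: "(A + a) * (\<psi> w - \<psi> u) + (1 + \<mu> * (A + a)) / 2 * (norm (u - x'))\<^sup>2 \<le> 1 / 2 * (norm (u - x0))\<^sup>2"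
      if "u \<in> E" "norm u \<le> 1" for u
    proof -
      have "0 \<le> (1 + chi) / 4 * (A + a) * L * (norm (w - z))\<^sup>2" using chi yx a by simp
      then show ?thesis using pot_next[OF continue(1) that continue(5)] by linarith
    qed
    have "0 \<le> (A + a) * (\<psi> w - \<psi> ystar)" using ystar(3)[OF w] yx a by simp
    then have "(1 + \<mu> * (A + a)) * (norm (ystar - x'))\<^sup>2 \<le> (norm (ystar - x0))\<^sup>2"
      using pot1[OF ystar(1,2)] by simp
    moreover have "1 * (norm (ystar - x'))\<^sup>2 \<le> (1 + \<mu> * (A + a)) * (norm (ystar - x'))\<^sup>2"
      using mu yx a by (intro mult_right_mono) auto
    ultimately have "(norm (ystar - x'))\<^sup>2 \<le> (norm (ystar - x0))\<^sup>2" by linarith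
    then have "norm (ystar - x') \<le> norm (ystar - x0)" by (rule power2_le_imp_le) simp
    also have "\<dots> \<le> 2" using norm_triangle_ineq4[of ystar x0] x0 ystar by simp
    finally have "norm x' \<le> 3"
      using norm_triangle_ineq4[of ystar "ystar - x'"] ystar by simp
    then show ?thesis using continue pot1 by simp
  qed
qed (use st in \<open>auto elim: fista_step.cases\<close>)

lemma pot_inv_reachable:
  assumes "1 \<le> L" "step\<^sup>*\<^sup>* (fista_init x0 L) s"
  shows "pot_inv s"
proof -
  have "inv s \<and> pot_inv s"
    using assms(2)
  proof (induction rule: rtranclp_induct)
    case base
    show ?case using inv_init[OF assms(1)] x0 by (simp add: fista_init_def)
  qed (auto intro: inv_step pot_inv_step)
  then show ?thesis by simp
qed

end

section \<open>Trials of ADAP-FISTA for continuously differentiable functions\<close>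

lemma eventually_decreasing_convergent:
  fixes f :: "nat \<Rightarrow> real"
  assumes "\<forall>\<^sub>F n in sequentially. f (Suc n) \<le> f n" "\<forall>\<^sub>F n in sequentially. b \<le> f n"
  shows "convergent f"
proof -
  obtain N where N: "\<And>n. N \<le> n \<Longrightarrow> f (Suc n) \<le> f n" "\<And>n. N \<le> n \<Longrightarrow> b \<le> f n"
    using eventually_conj[OF assms] unfolding eventually_sequentially by blast
  have "decseq (\<lambda>n. f (n + N))" by (rule decseq_SucI) (use N in simp)
  moreover have "bdd_below (range (\<lambda>n. f (n + N)))" using N(2) by (intro bdd_belowI[of _ b]) auto
  ultimately have "(\<lambda>n. f (n + N)) \<longlonglongrightarrow> (INF n. f (n + N))" by (intro LIMSEQ_decseq_INF)
  then show ?thesis using LIMSEQ_offset convergent_def by blast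
qed

context fista
begin

text \<open>The coefficient of the convex combination \<open>mid y x A L\<close> of \<open>y\<close> and \<open>x\<close>.\<close>

definition weight :: "real \<Rightarrow> real \<Rightarrow> real" where
  "weight A L = stepsize A L / (A + stepsize A L)"

text \<open>With \<open>e = \<mu> + 1 / A\<close> the weight \<open>t\<close> solves \<open>(L - \<mu>) t\<^sup>2 = e (1 - t)\<close>, and \<open>e\<close> becomes \<open>\<mu> t + e (1 - t)\<close>.
  So \<open>t\<close> is of the order of \<open>1 / \<surd>L\<close> while \<open>A\<close> is bounded away from \<open>0\<close>.\<close>

lemma weight:
  assumes A: "0 < A" and L: "1 \<le> L"
  shows weight_pos: "0 < weight A L" and weight_less: "weight A L < 1"
    and weight_eq: "(L - \<mu>) * (weight A L)\<^sup>2 = (\<mu> + 1 / A) * (1 - weight A L)"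
    and inverse_next: "\<mu> + 1 / (A + stepsize A L) = \<mu> * weight A L + (\<mu> + 1 / A) * (1 - weight A L)"
    and extrapolation_eq: "extrapolation A L =
      ((1 - weight A L) / weight A L) * ((1 - weight A L) * (\<mu> + 1 / A) / (\<mu> + 1 / (A + stepsize A L)))"
proof -
  define a where "a = stepsize A L"
  have a: "0 < a" and eq: "(L - \<mu>) * a\<^sup>2 = (1 + \<mu> * A) * (A + a)"
    unfolding a_def using stepsize_pos stepsize_eq A L by auto
  have t: "weight A L = a / (A + a)" by (simp add: weight_def a_def)
  show "0 < weight A L" "weight A L < 1" using A a by (auto simp: t)
  have t1: "1 - weight A L = A / (A + a)" using A a by (simp add: t field_simps)
  have "(L - \<mu>) * (weight A L)\<^sup>2 = (1 + \<mu> * A) * (A + a) / (A + a)\<^sup>2"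
    unfolding t power_divide using eq by simp
  also have "\<dots> = (1 + \<mu> * A) / (A + a)" using A a by (simp add: power2_eq_square)
  also have "\<dots> = (\<mu> + 1 / A) * (1 - weight A L)"
  proof -
    have "(\<mu> + 1 / A) * A = 1 + \<mu> * A" using A by (simp add: distrib_right)
    then show ?thesis unfolding t1 by simp
  qed
  finally show "(L - \<mu>) * (weight A L)\<^sup>2 = (\<mu> + 1 / A) * (1 - weight A L)" .
  have "0 < A + a" using A a by simp
  then show "\<mu> + 1 / (A + stepsize A L) = \<mu> * weight A L + (\<mu> + 1 / A) * (1 - weight A L)"
  proof -
    have p: "(\<mu> + 1 / A) * (A / (A + a)) = (1 + \<mu> * A) / (A + a)" using A by (simp add: distrib_right)
    have "\<mu> + 1 / (A + a) = (\<mu> * a + (1 + \<mu> * A)) / (A + a)" using \<open>0 < A + a\<close> by (simp add: field_simps)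
    then show ?thesis unfolding a_def[symmetric] t1 p unfolding t by (simp only: add_divide_distrib times_divide_eq_right)
  qed
  have tau: "(1 + \<mu> * A) / (1 + \<mu> * (A + a)) = (1 - weight A L) * (\<mu> + 1 / A) / (\<mu> + 1 / (A + a))"
  proof -
    have "(\<mu> + 1 / A) * A = 1 + \<mu> * A" using A by (simp add: distrib_right)
    then have "(1 - weight A L) * (\<mu> + 1 / A) = (1 + \<mu> * A) / (A + a)" unfolding t1 by (simp add: mult.commute)
    moreover have "\<mu> + 1 / (A + a) = (1 + \<mu> * (A + a)) / (A + a)" using A a by (simp add: field_simps)
    ultimately show ?thesis using A a by simp
  qed
  have "extrapolation A L = A / a * ((1 + \<mu> * A) / (1 + \<mu> * (A + a)))"
    unfolding extrapolation_def a_def[symmetric] by simp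
  also have "A / a = (1 - weight A L) / weight A L" unfolding t1 unfolding t using A a by simp
  finally show "extrapolation A L =
      ((1 - weight A L) / weight A L) * ((1 - weight A L) * (\<mu> + 1 / A) / (\<mu> + 1 / (A + stepsize A L)))"
    unfolding tau a_def[symmetric] .
qed

lemma mid_eq:
  assumes "0 \<le> A" "1 \<le> L"
  shows "mid y x A L = y + weight A L *\<^sub>R (x - y)"
proof -
  define a where "a = stepsize A L"
  have s: "0 < A + a" using stepsize_pos[OF assms] assms by (simp add: a_def)
  have "(A + a) *\<^sub>R mid y x A L = A *\<^sub>R y + a *\<^sub>R x" unfolding mid_def a_def[symmetric] using s by simp
  also have "\<dots> = (A + a) *\<^sub>R (y + weight A L *\<^sub>R (x - y))"
  proof -
    have "(A + a) * weight A L = a" using s by (simp add: weight_def a_def)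
    then show ?thesis unfolding scaleR_add_right scaleR_scaleR by (simp add: algebra_simps)
  qed
  finally show ?thesis using s by simp
qed

end

text \<open>The gradient is Lipschitz continuous on the unit ball, but merely continuous on \<open>E\<close>; the negative curvature
  is bounded on bounded sets.\<close>

locale smooth_fista = fista +
  assumes compact_ball: "\<And>r. compact (E \<inter> cball 0 r)"
    and continuous_D: "continuous_on E D"
    and weakly_convex: "\<And>r. \<exists>C. \<forall>u\<in>E \<inter> cball 0 r. \<forall>z\<in>E \<inter> cball 0 r. \<psi> z + D z \<bullet> (u - z) - C * (norm (u - z))\<^sup>2 \<le> \<psi> u"
    and lipschitz: "\<exists>K. \<forall>u\<in>E \<inter> cball 0 1. \<forall>z\<in>E \<inter> cball 0 1. norm (D u - D z) \<le> K * norm (u - z)"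
begin

lemma D_bounded:
  obtains M where "0 \<le> M" "\<And>z. z \<in> E \<Longrightarrow> norm z \<le> r \<Longrightarrow> norm (D z) \<le> M"
proof -
  have "bounded (D ` (E \<inter> cball 0 r))"
    by (intro compact_imp_bounded compact_continuous_image compact_ball
        continuous_on_subset[OF continuous_D]) auto
  then obtain M where "\<forall>z\<in>E \<inter> cball 0 r. norm (D z) \<le> M" by (auto simp: bounded_iff)
  then have "norm (D z) \<le> max M 0" if "z \<in> E" "norm z \<le> r" for z
    using that by (auto intro: order_trans[OF _ max.cobounded1])
  then show ?thesis using that[of "max M 0"] by simp
qed

lemma D_uniformly_continuous:
  assumes "0 < e"
  obtains d where "0 < d" "\<And>u z. u \<in> E \<Longrightarrow> z \<in> E \<Longrightarrow> norm u \<le> r \<Longrightarrow> norm z \<le> r \<Longrightarrow> norm (u - z) < d \<Longrightarrow> norm (D u - D z) < e"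
proof -
  have "uniformly_continuous_on (E \<inter> cball 0 r) D"
    by (intro compact_uniformly_continuous compact_ball continuous_on_subset[OF continuous_D]) auto
  then obtain d where "0 < d"
    "\<And>z u. z \<in> E \<inter> cball 0 r \<Longrightarrow> u \<in> E \<inter> cball 0 r \<Longrightarrow> dist u z < d \<Longrightarrow> dist (D u) (D z) < e"
    using assms unfolding uniformly_continuous_on_def by meson
  then show ?thesis by (intro that[of d]) (auto simp: dist_norm)
qed

lemma weak_convexity_constant:
  obtains C where "0 \<le> C" "\<And>u z. u \<in> E \<Longrightarrow> z \<in> E \<Longrightarrow> norm u \<le> r \<Longrightarrow> norm z \<le> r \<Longrightarrow>
     \<psi> z + D z \<bullet> (u - z) - C * (norm (u - z))\<^sup>2 \<le> \<psi> u"
proof -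
  obtain C where C: "\<forall>u\<in>E \<inter> cball 0 r. \<forall>z\<in>E \<inter> cball 0 r. \<psi> z + D z \<bullet> (u - z) - C * (norm (u - z))\<^sup>2 \<le> \<psi> u"
    using weakly_convex by blast
  show ?thesis
  proof (rule that[of "max C 0"])
    fix u z assume *: "u \<in> E" "z \<in> E" "norm u \<le> r" "norm z \<le> r"
    have "C * (norm (u - z))\<^sup>2 \<le> max C 0 * (norm (u - z))\<^sup>2" by (intro mult_right_mono) auto
    moreover have "\<psi> z + D z \<bullet> (u - z) - C * (norm (u - z))\<^sup>2 \<le> \<psi> u" using C * by simp
    ultimately show "\<psi> z + D z \<bullet> (u - z) - max C 0 * (norm (u - z))\<^sup>2 \<le> \<psi> u" by linarith
  qed simp
qed

lemma psi_bounded_below: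
  obtains m where "\<And>u. u \<in> E \<Longrightarrow> norm u \<le> 1 \<Longrightarrow> m \<le> \<psi> u"
proof -
  obtain C where C: "0 \<le> C" "\<And>u z. u \<in> E \<Longrightarrow> z \<in> E \<Longrightarrow> norm u \<le> 1 \<Longrightarrow> norm z \<le> 1 \<Longrightarrow>
     \<psi> z + D z \<bullet> (u - z) - C * (norm (u - z))\<^sup>2 \<le> \<psi> u"
    using weak_convexity_constant by blast
  show ?thesis
  proof (rule that[of "\<psi> 0 - norm (D 0) - C"])
    fix u assume u: "u \<in> E" "norm u \<le> 1"
    have "\<psi> 0 + D 0 \<bullet> u - C * (norm u)\<^sup>2 \<le> \<psi> u" using C(2)[OF u(1) subspace_0[OF subspace] u(2)] by simp
    moreover have "C * (norm u)\<^sup>2 \<le> C * 1" using C(1) u by (intro mult_left_mono) (auto simp: power_le_one)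
    moreover have "norm (D 0) * norm u \<le> norm (D 0) * 1" using u by (intro mult_left_mono) auto
    moreover have "- (norm (D 0) * norm u) \<le> D 0 \<bullet> u" using Cauchy_Schwarz_ineq2[of "D 0" u] by linarith
    ultimately show "\<psi> 0 - norm (D 0) - C \<le> \<psi> u" by linarith
  qed
qed

text \<open>
  For large \<open>L\<close>, a point of norm at most \<open>2\<close> fails the descent test only if it is outside the unit ball
  and its proximal step is much shorter than \<open>1 / L\<close>.  Such points are almost stationary.
\<close>

lemma rejected:
  assumes e: "0 < e"
  shows "\<forall>\<^sub>F L in at_top. \<forall>z\<in>E. norm z \<le> 2 \<longrightarrow> \<not> accepted L z (prox L z) \<longrightarrow>
    1 < norm z \<and> L * norm (prox L z - z) < e"
proof -
  define k where "k = (1 - chi) / 4"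
  have k: "0 < k" using chi by (simp add: k_def)
  obtain C where C: "0 \<le> C" "\<And>u z. u \<in> E \<Longrightarrow> z \<in> E \<Longrightarrow> norm u \<le> 2 \<Longrightarrow> norm z \<le> 2 \<Longrightarrow>
     \<psi> z + D z \<bullet> (u - z) - C * (norm (u - z))\<^sup>2 \<le> \<psi> u"
    using weak_convexity_constant[of 2] by metis
  obtain K where K: "\<And>u z. u \<in> E \<Longrightarrow> z \<in> E \<Longrightarrow> norm u \<le> 1 \<Longrightarrow> norm z \<le> 1 \<Longrightarrow> norm (D u - D z) \<le> K * norm (u - z)"
  proof -
    obtain K where "\<forall>u\<in>E \<inter> cball 0 1. \<forall>z\<in>E \<inter> cball 0 1. norm (D u - D z) \<le> K * norm (u - z)"
      using lipschitz by blast
    then show ?thesis using that[of K] by auto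
  qed
  obtain M where M: "0 \<le> M" "\<And>z. z \<in> E \<Longrightarrow> norm z \<le> 2 \<Longrightarrow> norm (D z) \<le> M"
    using D_bounded[of 2] by metis
  obtain d where d: "0 < d" "\<And>u z. u \<in> E \<Longrightarrow> z \<in> E \<Longrightarrow> norm u \<le> 2 \<Longrightarrow> norm z \<le> 2 \<Longrightarrow> norm (u - z) < d \<Longrightarrow> norm (D u - D z) < k * e / 2"
    using D_uniformly_continuous[of "k * e / 2" 2] k e by (metis half_gt_zero mult_pos_pos)
  define d' where "d' = min d (k * e / (2 * (C + 1)))"
  have d': "0 < d'" using d k e C by (simp add: d'_def)
  define \<Lambda> where "\<Lambda> = max 1 (max ((K + C) / k) ((2 * M + 3 * C) / (k * d')))"
  show ?thesis
  proof (rule eventually_mono[OF eventually_gt_at_top[of \<Lambda>]], intro ballI impI)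
    fix L z assume L: "\<Lambda> < L" and z: "z \<in> E" "norm z \<le> 2" and rej: "\<not> accepted L z (prox L z)"
    define w where "w = prox L z"
    define h where "h = norm (w - z)"
    have L1: "1 < L" "(K + C) / k < L" "(2 * M + 3 * C) / (k * d') < L" using L by (auto simp: \<Lambda>_def)
    have w: "w \<in> E" "norm w \<le> 1" using prox_in[OF z(1)] norm_prox by (auto simp: w_def)
    have "\<psi> w + D w \<bullet> (z - w) - C * h\<^sup>2 \<le> \<psi> z"
      using C(2)[OF z(1) w(1)] z w by (simp add: h_def norm_minus_commute)
    moreover have "D w \<bullet> (z - w) = - (D w \<bullet> (w - z))" by (simp add: inner_diff_right)
    moreover have "(D w - D z) \<bullet> (w - z) \<le> norm (D w - D z) * h" unfolding h_def by (rule norm_cauchy_schwarz)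
    moreover have "\<psi> z + D z \<bullet> (w - z) + k * L * h\<^sup>2 < \<psi> w"
      using rej by (simp add: accepted_def w_def[symmetric] k_def h_def)
    ultimately have "k * L * h\<^sup>2 < norm (D w - D z) * h + C * h\<^sup>2"
      unfolding inner_diff_left by linarith
    then have lt: "(k * L * h) * h < (norm (D w - D z) + C * h) * h"
      by (simp add: power2_eq_square algebra_simps)
    have "0 < h" using lt by (cases "h = 0") (auto simp: h_def)
    then have lt: "k * L * h < norm (D w - D z) + C * h" using lt by simp
    have z1: "1 < norm z"
    proof (rule ccontr)
      assume "\<not> 1 < norm z"
      then have "norm (D w - D z) \<le> K * h" using K[OF w(1) z(1)] w by (simp add: h_def)
      then have "(k * L) * h < (K + C) * h" using lt by (simp add: algebra_simps)
      then have "k * L < K + C" using \<open>0 < h\<close> by simp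
      then show False using L1(2) k by (simp add: field_simps)
    qed
    have h3: "h \<le> 3" using norm_triangle_ineq4[of w z] w z by (simp add: h_def)
    have "norm (D w - D z) \<le> 2 * M"
      using norm_triangle_ineq4[of "D w" "D z"] M(2)[OF w(1)] M(2)[OF z] w by simp
    then have "k * L * h < 2 * M + 3 * C" using lt mult_left_mono[OF h3 C(1)] by simp
    moreover have "2 * M + 3 * C < (k * d') * L" using L1(3) k d' by (simp add: field_simps)
    ultimately have "(k * L) * h < (k * L) * d'" by (simp add: mult_ac)
    then have hd: "h < d'" using k L1 by simp
    then have "norm (D w - D z) < k * e / 2" using d(2)[OF w(1) z(1)] w z by (simp add: d'_def h_def)
    moreover have "C * h \<le> k * e / 2"
    proof -
      have "C * h \<le> (C + 1) * (k * e / (2 * (C + 1)))"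
        using hd C(1) \<open>0 < h\<close> by (intro mult_mono) (auto simp: d'_def)
      also have "\<dots> = k * e / 2" using C(1) by (simp add: field_simps)
      finally show ?thesis .
    qed
    ultimately have "k * (L * h) < k * e" using lt by (simp add: algebra_simps)
    then show "1 < norm z \<and> L * norm (prox L z - z) < e" using k z1 by (simp add: w_def h_def)
  qed
qed

text \<open>As long as the initial point is not stationary, residuals that do not stop the method are bounded away from \<open>0\<close>.\<close>

lemma residual_gap:
  assumes nonstationary
  obtains \<eta> where "0 < \<eta>" "\<And>L z. 0 < L \<Longrightarrow> z \<in> E \<Longrightarrow>
    \<sigma> * norm (prox L z - x0) < norm (residual L z (prox L z)) \<Longrightarrow> \<eta> \<le> norm (residual L z (prox L z))"
proof -
  obtain u where u: "u \<in> E" "norm u \<le> 1" and neg: "D x0 \<bullet> (u - x0) < 0"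
    using assms by (auto simp: nonstationary_def)
  define g where "g = - (D x0 \<bullet> (u - x0))"
  have g: "0 < g" using neg by (simp add: g_def)
  have cont: "continuous_on E (\<lambda>w. D w \<bullet> (u - w))" by (intro continuous_intros continuous_D)
  obtain d where d: "0 < d" "\<And>w. w \<in> E \<Longrightarrow> norm (w - x0) < d \<Longrightarrow> \<bar>D w \<bullet> (u - w) + g\<bar> < g / 2"
  proof -
    obtain d where "0 < d" "\<forall>w\<in>E. dist w x0 < d \<longrightarrow> dist (D w \<bullet> (u - w)) (D x0 \<bullet> (u - x0)) < g / 2"
      using cont x0(1) half_gt_zero[OF g] unfolding continuous_on_iff by blast
    then show ?thesis using that[of d] by (auto simp: dist_norm g_def)
  qed
  define \<eta> where "\<eta> = min (\<sigma> * d) (g / 4)"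
  show ?thesis
  proof (rule that[of \<eta>])
    show "0 < \<eta>" using sigma d g by (simp add: \<eta>_def)
    fix L :: real and z assume L: "0 < L" and z: "z \<in> E"
    define w where "w = prox L z"
    define v where "v = residual L z w"
    assume "\<sigma> * norm (prox L z - x0) < norm (residual L z (prox L z))"
    then have far: "\<sigma> * norm (w - x0) < norm v" by (simp add: v_def w_def)
    have w: "w \<in> E" "norm w \<le> 1" using prox_in[OF z] norm_prox by (auto simp: w_def)
    have "\<eta> \<le> norm v"
    proof (rule ccontr)
      assume "\<not> \<eta> \<le> norm v"
      then have v: "norm v < \<sigma> * d" "norm v < g / 4" by (auto simp: \<eta>_def)
      then have "\<sigma> * norm (w - x0) < \<sigma> * d" using far by simp
      then have "norm (w - x0) < d" using sigma by simp
      then have "D w \<bullet> (u - w) < - g / 2" using d(2)[OF w(1)] by linarith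
      moreover have "0 \<le> (D z + L *\<^sub>R (w - z)) \<bullet> (u - w)" unfolding w_def by (rule prox_inner_ge[OF L u(2)])
      moreover have "D z + L *\<^sub>R (w - z) = D w - v" by (simp add: v_def residual_def algebra_simps)
      moreover have "- (norm v * 2) \<le> v \<bullet> (u - w)"
      proof -
        have "norm (u - w) \<le> 2" using norm_triangle_ineq4[of u w] u w by simp
        then have "norm v * norm (u - w) \<le> norm v * 2" by (intro mult_left_mono) auto
        then show ?thesis using Cauchy_Schwarz_ineq2[of v "u - w"] by linarith
      qed
      ultimately show False using v g by (simp add: inner_diff_left)
    qed
    then show "\<eta> \<le> norm (residual L z (prox L z))" by (simp add: v_def w_def)
  qed
qed

text \<open>
  If \<open>D z\<close> is almost \<open>- c z / \<bar>z\<bar>\<close>, as near a point \<open>p\<close> of the unit sphere with \<open>D p = - c p\<close>, the length of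
  the proximal step at \<open>z\<close> is controlled by the distance of \<open>z\<close> from the sphere.
\<close>

lemma prox_near_sphere:
  assumes L: "0 < L" and z: "z \<noteq> 0" and c: "0 \<le> c" and D: "norm (D z + (c / norm z) *\<^sub>R z) \<le> e"
  shows prox_near_sphere_dist: "L * norm (prox L z - z) \<le> 2 * L * \<bar>norm z - 1\<bar> + e"
    and prox_near_sphere_norm: "norm z \<ge> 1 + (e - c) / L \<Longrightarrow> norm (prox L z) = 1"
proof -
  define s where "s = (1 / norm z) *\<^sub>R z"
  have s: "norm s = 1" using z by (simp add: s_def)
  have "ball_proj (s + (c / L) *\<^sub>R s) = s"
  proof -
    have "s + (c / L) *\<^sub>R s = (1 + c / L) *\<^sub>R s" by (simp add: scaleR_add_left)
    moreover have "0 \<le> c / L" using c L by simp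
    ultimately show ?thesis using s by (auto simp: ball_proj_def)
  qed
  then have "norm (prox L z - s) \<le> norm (z - (1 / L) *\<^sub>R D z - (s + (c / L) *\<^sub>R s))"
    unfolding prox_def by (metis ball_proj_nonexpansive)
  also have "z - (1 / L) *\<^sub>R D z - (s + (c / L) *\<^sub>R s) = (z - s) - (1 / L) *\<^sub>R (D z + (c / norm z) *\<^sub>R z)"
    by (simp add: s_def algebra_simps)
  also have "norm \<dots> \<le> norm (z - s) + (1 / L) * e"
    using norm_triangle_ineq4[of "z - s" "(1 / L) *\<^sub>R (D z + (c / norm z) *\<^sub>R z)"] D L
    by (smt (verit) divide_pos_pos mult_left_mono norm_scaleR abs_of_pos zero_less_one)
  finally have 1: "norm (prox L z - s) \<le> norm (z - s) + e / L" by simp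
  have zs: "norm (z - s) = \<bar>norm z - 1\<bar>"
  proof -
    have "norm z *\<^sub>R s = z" using z by (simp add: s_def)
    then have "z - s = (norm z - 1) *\<^sub>R s" by (simp add: scaleR_diff_left)
    then show ?thesis using s by simp
  qed
  have "norm (prox L z - z) \<le> norm (prox L z - s) + norm (z - s)"
    using norm_triangle_ineq4[of "prox L z - s" "z - s"] by simp
  then have "norm (prox L z - z) \<le> 2 * \<bar>norm z - 1\<bar> + e / L" using 1 unfolding zs by simp
  from mult_left_mono[OF this, of L]
  show "L * norm (prox L z - z) \<le> 2 * L * \<bar>norm z - 1\<bar> + e" using L by (simp add: distrib_left)
  assume out: "norm z \<ge> 1 + (e - c) / L"
  have "norm ((1 + c / (L * norm z)) *\<^sub>R z) = norm z + c / L"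
  proof -
    have "0 \<le> c / (L * norm z)" using c L by simp
    then show ?thesis using z L by (simp add: distrib_right)
  qed
  moreover have "z - (1 / L) *\<^sub>R D z = (1 + c / (L * norm z)) *\<^sub>R z - (1 / L) *\<^sub>R (D z + (c / norm z) *\<^sub>R z)"
    by (simp add: algebra_simps)
  moreover have "norm ((1 / L) *\<^sub>R (D z + (c / norm z) *\<^sub>R z)) \<le> e / L" using D L by (simp add: divide_right_mono)
  ultimately have "norm z + c / L - e / L \<le> norm (z - (1 / L) *\<^sub>R D z)"
    using norm_triangle_ineq2[of "(1 + c / (L * norm z)) *\<^sub>R z" "(1 / L) *\<^sub>R (D z + (c / norm z) *\<^sub>R z)"] by simp
  then have "1 \<le> norm (z - (1 / L) *\<^sub>R D z)" using out by (simp add: diff_divide_distrib)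
  then show "norm (prox L z) = 1" unfolding prox_def by (rule norm_ball_proj_eq)
qed

end

section \<open>Termination of ADAP-FISTA\<close>

text \<open>
  An infinite run, indexed by the trials of step (2).  The \<open>n\<close>-th trial has the extrapolated point
  \<open>zs n\<close>, the proximal point \<open>ws n\<close> and the weight \<open>ts n\<close>, and it either passes the descent test
  (\<open>acc n\<close>) or doubles \<open>Ls n\<close>.
\<close>

locale fista_run = smooth_fista +
  fixes ys xs zs ws :: "nat \<Rightarrow> 'a" and As Ls ts :: "nat \<Rightarrow> real" and acc :: "nat \<Rightarrow> bool"
  assumes y_in: "ys n \<in> E" and y_ball: "norm (ys n) \<le> 1" and x_in: "xs n \<in> E"
    and A_nonneg: "0 \<le> As n" and L_ge: "1 \<le> Ls n"
    and start: "As n = 0 \<Longrightarrow> ys n = x0 \<and> xs n = x0"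
    and not_start: "As n \<noteq> 0 \<Longrightarrow> nonstationary"
    and zs_def: "zs n = mid (ys n) (xs n) (As n) (Ls n)"
    and ws_def: "ws n = prox (Ls n) (zs n)"
    and ts_def: "ts n = weight (As n) (Ls n)"
    and acc_def: "acc n \<longleftrightarrow> accepted (Ls n) (zs n) (ws n)"
    and rej: "\<not> acc n \<Longrightarrow> ys (Suc n) = ys n \<and> xs (Suc n) = xs n \<and> As (Suc n) = As n \<and> Ls (Suc n) = 2 * Ls n"
    and acc_y: "acc n \<Longrightarrow> ys (Suc n) = ws n"
    and acc_x: "acc n \<Longrightarrow> xs (Suc n) - ws n = extrapolation (As n) (Ls n) *\<^sub>R (ws n - ys n)"
    and acc_A: "acc n \<Longrightarrow> As (Suc n) = As n + stepsize (As n) (Ls n)"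
    and acc_L: "acc n \<Longrightarrow> Ls (Suc n) = Ls n"
    and acc_short: "acc n \<Longrightarrow> chi * As (Suc n) * Ls n * (norm (ws n - zs n))\<^sup>2 \<le> (norm (ws n - x0))\<^sup>2"
    and acc_residual: "acc n \<Longrightarrow> \<sigma> * norm (ws n - x0) < norm (residual (Ls n) (zs n) (ws n))"
begin

lemma z_eq: "zs n = ys n + ts n *\<^sub>R (xs n - ys n)"
  unfolding zs_def ts_def by (rule mid_eq[OF A_nonneg L_ge])

lemma z_in: "zs n \<in> E"
  unfolding zs_def by (rule mid_in[OF y_in x_in])

lemma w_in: "ws n \<in> E" and w_ball: "norm (ws n) \<le> 1"
  unfolding ws_def by (rule prox_in[OF z_in], rule norm_prox)

lemma A_Suc: "As n \<le> As (Suc n)"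
  using rej[of n] acc_A[of n] stepsize_pos[OF A_nonneg L_ge] by (cases "acc n") (auto simp: less_imp_le)

lemma A_mono: "n \<le> m \<Longrightarrow> As n \<le> As m"
  by (rule lift_Suc_mono_le[of As]) (use A_Suc in auto)

lemma L_Suc: "Ls n \<le> Ls (Suc n)"
  using rej[of n] acc_L[of n] L_ge[of n] by (cases "acc n") auto

lemma L_mono: "n \<le> m \<Longrightarrow> Ls n \<le> Ls m"
  by (rule lift_Suc_mono_le[of Ls]) (use L_Suc in auto)

lemma acc_A_pos: "acc n \<Longrightarrow> 0 < As (Suc n)"
  using acc_A[of n] stepsize_pos[OF A_nonneg L_ge] A_nonneg[of n] by (simp add: add_nonneg_pos)

lemma acc_step_length:
  assumes "acc n"
  shows "(norm (ws n - zs n))\<^sup>2 \<le> 4 / (chi * As (Suc n) * Ls n)"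
proof -
  have p: "0 < chi * As (Suc n) * Ls n" using chi acc_A_pos[OF assms] L_ge[of n] by simp
  have "norm (ws n - x0) \<le> 2" using norm_triangle_ineq4[of "ws n" x0] w_ball[of n] x0 by simp
  then have "(norm (ws n - x0))\<^sup>2 \<le> 2\<^sup>2" by (rule power_mono) simp
  then show ?thesis using acc_short[OF assms] p by (simp add: field_simps)
qed

text \<open>Only finitely many doublings: then \<open>A\<close> grows at least linearly, and the residuals tend to \<open>0\<close>.\<close>

lemma infinitely_many_rejected: "\<exists>n\<ge>N. \<not> acc n"
proof (rule ccontr)
  assume "\<not> ?thesis"
  then have acc: "acc n" if "N \<le> n" for n using that by blast
  define L where "L = Ls N"
  have L: "Ls n = L" if "N \<le> n" for n
    using that by (induction rule: dec_induct) (auto simp: L_def acc_L acc)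
  have L1: "1 \<le> L" using L_ge by (simp add: L_def)
  have grow: "As n + 1 / L \<le> As (Suc n)" if "N \<le> n" for n
  proof -
    define a where "a = stepsize (As n) (Ls n)"
    have a: "0 < a" and eq: "(Ls n - \<mu>) * a\<^sup>2 = (1 + \<mu> * As n) * (As n + a)"
      unfolding a_def using stepsize_pos stepsize_eq A_nonneg L_ge by auto
    have "1 * a \<le> (1 + \<mu> * As n) * (As n + a)"
      using a A_nonneg[of n] mu by (intro mult_mono) auto
    also have "\<dots> \<le> L * a\<^sup>2" unfolding eq[symmetric] using L[OF that] mu by (intro mult_right_mono) auto
    finally have "1 * a \<le> (L * a) * a" by (simp add: power2_eq_square)
    then have "1 \<le> L * a" using a by (simp only: mult_le_cancel_right_pos)
    then show ?thesis using acc_A[OF acc[OF that]] L1 by (simp add: a_def field_simps)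
  qed
  have lin: "real k / L \<le> As (N + k)" for k
  proof (induction k)
    case (Suc k)
    then show ?case using grow[of "N + k"] by (simp add: add_divide_distrib)
  qed (simp add: A_nonneg)
  have nonstationary using not_start[of "Suc N"] acc_A_pos[OF acc[of N]] by simp
  then obtain \<eta> where \<eta>: "0 < \<eta>" "\<And>n. acc n \<Longrightarrow> \<eta> \<le> norm (residual (Ls n) (zs n) (ws n))"
  proof (rule residual_gap)
    fix \<eta> assume *: "0 < \<eta>" "\<And>L z. 0 < L \<Longrightarrow> z \<in> E \<Longrightarrow>
      \<sigma> * norm (prox L z - x0) < norm (residual L z (prox L z)) \<Longrightarrow> \<eta> \<le> norm (residual L z (prox L z))"
    show ?thesis
    proof (rule that[OF *(1)])
      fix n assume "acc n"
      from *(2)[OF _ z_in[of n], of "Ls n"] acc_residual[OF this] L_ge[of n]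
      show "\<eta> \<le> norm (residual (Ls n) (zs n) (ws n))" by (simp add: ws_def)
    qed
  qed
  obtain d where d: "0 < d" "\<And>u z. u \<in> E \<Longrightarrow> z \<in> E \<Longrightarrow> norm u \<le> 2 \<Longrightarrow> norm z \<le> 2 \<Longrightarrow> norm (u - z) < d \<Longrightarrow> norm (D u - D z) < \<eta> / 2"
    using D_uniformly_continuous[OF half_gt_zero[OF \<eta>(1)], of 2] by metis
  define e where "e = min (min d 1) (\<eta> / (2 * L))"
  have e: "0 < e" "e \<le> d" "e \<le> 1" and "e \<le> \<eta> / (2 * L)"
    using d(1) \<eta>(1) L1 by (auto simp: e_def)
  then have Le: "L * e \<le> \<eta> / 2" using L1 by (simp add: field_simps)
  obtain k where k: "4 * L / (chi * L * e\<^sup>2) < real k" using reals_Archimedean2 by blast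
  define n where "n = N + k"
  have nN: "N \<le> n" "acc n" using acc by (auto simp: n_def)
  have "(norm (ws n - zs n))\<^sup>2 \<le> 4 / (chi * As (Suc n) * L)" using acc_step_length[OF nN(2)] L[OF nN(1)] by simp
  also have "\<dots> < e\<^sup>2"
  proof -
    have "real k / L \<le> As (Suc n)" using lin[of k] A_Suc[of n] by (simp add: n_def)
    then have "4 < chi * L * e\<^sup>2 * As (Suc n)"
    proof -
      have p: "0 < chi * L * e\<^sup>2" using chi L1 e(1) by simp
      have "4 * L < real k * (chi * L * e\<^sup>2)" using k p by (simp only: pos_divide_less_eq)
      also have "real k \<le> As (Suc n) * L" using \<open>real k / L \<le> As (Suc n)\<close> L1 by (simp add: field_simps)
      then have "real k * (chi * L * e\<^sup>2) \<le> As (Suc n) * L * (chi * L * e\<^sup>2)" using p by (intro mult_right_mono) auto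
      finally have "L * 4 < L * (chi * L * e\<^sup>2 * As (Suc n))" by (simp add: mult_ac)
      then show ?thesis using L1 by (simp only: mult_less_cancel_left_pos)
    qed
    then show ?thesis
      using chi L1 acc_A_pos[OF nN(2)] by (simp add: field_simps)
  qed
  finally have short: "norm (ws n - zs n) < e" by (rule power2_less_imp_less) (use e in simp)
  then have "norm (zs n) \<le> 2" using norm_triangle_ineq4[of "ws n" "ws n - zs n"] w_ball[of n] e by simp
  then have "norm (D (ws n) - D (zs n)) < \<eta> / 2"
    using d(2)[OF w_in[of n] z_in[of n]] short e w_ball[of n] by simp
  moreover have "norm (L *\<^sub>R (zs n - ws n)) \<le> \<eta> / 2"
  proof -
    have "L * norm (ws n - zs n) \<le> L * e" using short L1 by (intro mult_left_mono) auto
    then have "L * norm (ws n - zs n) \<le> \<eta> / 2" using Le by (rule order_trans)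
    then show ?thesis using L1 by (simp add: norm_minus_commute)
  qed
  ultimately have "norm (residual (Ls n) (zs n) (ws n)) < \<eta>"
    unfolding residual_def L[OF nN(1)]
    using norm_triangle_ineq[of "D (ws n) - D (zs n)" "L *\<^sub>R (zs n - ws n)"] by linarith
  then show False using \<eta>(2)[OF nN(2)] by simp
qed

lemma L_tendsto: "filterlim Ls at_top sequentially"
proof -
  have ex: "\<exists>n. 2 ^ k \<le> Ls n" for k :: nat
  proof (induction k)
    case (Suc k)
    then obtain n where "2 ^ k \<le> Ls n" by blast
    moreover obtain m where "n \<le> m" "\<not> acc m" using infinitely_many_rejected by blast
    ultimately have "2 ^ Suc k \<le> Ls (Suc m)" using L_mono[of n m] rej[of m] by simp
    then show ?case by blast
  qed (use L_ge in auto)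
  show ?thesis
    unfolding filterlim_at_top
  proof
    fix Z :: real
    obtain k where "Z < 2 ^ k" using real_arch_pow[of 2 Z] by auto
    moreover obtain N where "2 ^ k \<le> Ls N" using ex by blast
    ultimately have "Z \<le> Ls N" by linarith
    then show "\<forall>\<^sub>F n in sequentially. Z \<le> Ls n"
      unfolding eventually_sequentially using L_mono order_trans by blast
  qed
qed

lemma rejected_eventually:
  assumes "0 < e"
  shows "\<forall>\<^sub>F n in sequentially. norm (zs n) \<le> 2 \<longrightarrow> \<not> acc n \<longrightarrow> 1 < norm (zs n) \<and> Ls n * norm (ws n - zs n) < e"
  using eventually_compose_filterlim[OF rejected[OF assms] L_tendsto]
  by (rule eventually_mono) (use z_in in \<open>auto simp: acc_def ws_def\<close>)

lemma A_pos_eventually: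
  assumes "\<exists>n. acc n \<or> As n \<noteq> 0"
  obtains \<alpha> where "0 < \<alpha>" "\<forall>\<^sub>F n in sequentially. \<alpha> \<le> As n"
proof -
  obtain n where n: "0 < As n" using assms acc_A_pos A_nonneg by (metis order_le_less)
  have "\<forall>\<^sub>F m in sequentially. As n \<le> As m" unfolding eventually_sequentially using A_mono by blast
  then show ?thesis using that n by blast
qed

lemma weight_sqrt_bound:
  assumes "0 < \<alpha>" "\<alpha> \<le> As n"
  shows "(Ls n - \<mu>) * (ts n)\<^sup>2 \<le> \<mu> + 1 / \<alpha>" "0 < ts n" "ts n < 1"
    "3 / 4 * \<mu> \<le> Ls n * (ts n)\<^sup>2" "Ls n * (ts n)\<^sup>2 \<le> \<mu> + 1 / \<alpha>"
proof -
  have A: "0 < As n" using assms by simp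
  show t: "0 < ts n" "ts n < 1" unfolding ts_def using weight_pos weight_less A L_ge by auto
  define e where "e = \<mu> + 1 / As n"
  have e: "\<mu> \<le> e" "e \<le> \<mu> + 1 / \<alpha>" using A assms by (auto simp: e_def frac_le)
  have eq: "(Ls n - \<mu>) * (ts n)\<^sup>2 = e * (1 - ts n)"
    unfolding ts_def e_def by (rule weight_eq[OF A L_ge])
  have "e * (1 - ts n) \<le> e * 1" using e mu t by (intro mult_left_mono) auto
  then show "(Ls n - \<mu>) * (ts n)\<^sup>2 \<le> \<mu> + 1 / \<alpha>" unfolding eq using e by simp
  have eq2: "Ls n * (ts n)\<^sup>2 = e * (1 - ts n) + \<mu> * (ts n)\<^sup>2" using eq by (simp add: algebra_simps)
  have "\<mu> * (1 - ts n) \<le> e * (1 - ts n)" using e t by (intro mult_right_mono) auto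
  moreover have "3 / 4 \<le> (1 - ts n) + (ts n)\<^sup>2"
  proof -
    have "0 \<le> (ts n - 1 / 2)\<^sup>2" by simp
    then show ?thesis by (simp add: power2_eq_square algebra_simps)
  qed
  from mult_left_mono[OF this, of \<mu>] have "3 / 4 * \<mu> \<le> \<mu> * (1 - ts n) + \<mu> * (ts n)\<^sup>2" using mu by (simp add: algebra_simps)
  ultimately show "3 / 4 * \<mu> \<le> Ls n * (ts n)\<^sup>2" unfolding eq2 by linarith
  have "(ts n)\<^sup>2 \<le> ts n" using t power_decreasing[of 1 2 "ts n"] by simp
  then have "\<mu> * (ts n)\<^sup>2 \<le> e * ts n" using e mu by (intro mult_mono) auto
  then show "Ls n * (ts n)\<^sup>2 \<le> \<mu> + 1 / \<alpha>" unfolding eq2 using e by (simp add: algebra_simps)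
qed

lemma weight_tendsto:
  assumes "0 < \<alpha>" "\<forall>\<^sub>F n in sequentially. \<alpha> \<le> As n"
  shows "ts \<longlonglongrightarrow> 0"
proof -
  have "(\<lambda>n. (\<mu> + 1 / \<alpha>) / Ls n) \<longlonglongrightarrow> 0"
    by (rule tendsto_divide_0[OF tendsto_const filterlim_at_top_imp_at_infinity[OF L_tendsto]])
  moreover have "\<forall>\<^sub>F n in sequentially. norm ((ts n)\<^sup>2) \<le> (\<mu> + 1 / \<alpha>) / Ls n"
    using assms(2)
  proof eventually_elim
    case (elim n)
    then show ?case using weight_sqrt_bound(5)[OF assms(1) elim] L_ge[of n] by (simp add: field_simps)
  qed
  ultimately have "(\<lambda>n. (ts n)\<^sup>2) \<longlonglongrightarrow> 0" by (rule Lim_null_comparison[rotated])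
  then have "(\<lambda>n. sqrt ((ts n)\<^sup>2)) \<longlonglongrightarrow> sqrt 0" by (rule tendsto_real_sqrt)
  then show ?thesis by (simp add: tendsto_rabs_zero_iff)
qed

text \<open>A single search ends: if \<open>L\<close> is doubled forever, \<open>zs n\<close> approaches \<open>ys n\<close> along a fixed
  direction from outside of the unit ball.  On such a path the distance from the ball is at least of order
  \<open>1 / L\<close>, whereas rejected trials are within \<open>o(1 / L)\<close>.\<close>

lemma infinitely_many_accepted: "\<exists>n\<ge>N. acc n"
proof (rule ccontr)
  assume "\<not> ?thesis"
  then have nacc: "\<not> acc n" if "N \<le> n" for n using that by blast
  define y where "y = ys N"
  define d where "d = xs N - ys N"
  have const: "ys n = y \<and> xs n - ys n = d \<and> As n = As N" if "N \<le> n" for n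
    using that by (induction rule: dec_induct) (auto simp: y_def d_def rej nacc)
  have z: "zs n = y + ts n *\<^sub>R d" if "N \<le> n" for n using z_eq[of n] const[OF that] by metis
  have y1: "norm y \<le> 1" by (simp add: y_def y_ball)
  have out: "\<forall>\<^sub>F n in sequentially. norm (zs n) \<le> 2 \<longrightarrow> 1 < norm (zs n)"
    using rejected_eventually[OF zero_less_one] eventually_ge_at_top[of N]
    by eventually_elim (use nacc in blast)
  show False
  proof (cases "d = 0")
    case True
    have "\<forall>\<^sub>F n in sequentially. False"
      using out eventually_ge_at_top[of N] by eventually_elim (use z True y1 in simp)
    then show False by simp
  next
    case False
    have "As N \<noteq> 0" using start[of N] False by (auto simp: d_def)
    then obtain \<alpha> where \<alpha>: "0 < \<alpha>" "\<forall>\<^sub>F n in sequentially. \<alpha> \<le> As n" using A_pos_eventually by blast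
    note t0 = weight_tendsto[OF \<alpha>]
    have "(\<lambda>n. norm (y + ts n *\<^sub>R d)) \<longlonglongrightarrow> norm (y + 0 *\<^sub>R d)" by (intro tendsto_intros t0)
    then have "\<forall>\<^sub>F n in sequentially. norm (y + ts n *\<^sub>R d) < 2"
      by (rule order_tendstoD) (use y1 in simp)
    then have z2: "\<forall>\<^sub>F n in sequentially. norm (zs n) < 2"
      using eventually_ge_at_top[of N] by eventually_elim (use z in simp)
    have sq: "(norm (zs n))\<^sup>2 = (norm y)\<^sup>2 + ts n * (2 * (y \<bullet> d) + ts n * (norm d)\<^sup>2)" if "N \<le> n" for n
      unfolding z[OF that] power2_norm_eq_inner
      by (simp add: inner_add_left inner_add_right inner_commute[of d y] algebra_simps)
    have ypos: "\<forall>\<^sub>F n in sequentially. 0 \<le> 2 * (y \<bullet> d) + ts n * (norm d)\<^sup>2"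
      using out z2 eventually_ge_at_top[of N] \<alpha>(2)
    proof eventually_elim
      case (elim n)
      then have "1 < (norm (zs n))\<^sup>2" by simp
      moreover have "(norm y)\<^sup>2 \<le> 1" using y1 by (simp add: power_le_one)
      ultimately have "0 < ts n * (2 * (y \<bullet> d) + ts n * (norm d)\<^sup>2)" using sq[of n] elim by linarith
      then show ?case using weight_sqrt_bound(2)[OF \<alpha>(1) elim(4)] by (simp add: zero_less_mult_iff)
    qed
    have "(\<lambda>n. 2 * (y \<bullet> d) + ts n * (norm d)\<^sup>2) \<longlonglongrightarrow> 2 * (y \<bullet> d) + 0 * (norm d)\<^sup>2" by (intro tendsto_intros t0)
    then have "0 \<le> 2 * (y \<bullet> d) + 0 * (norm d)\<^sup>2" by (rule tendsto_lowerbound) (use ypos in auto)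
    then have yd: "0 \<le> y \<bullet> d" by simp
    \<comment> \<open>the norm of \<open>y\<close> is \<open>1\<close> since \<open>zs n\<close> tends to \<open>y\<close> from outside\<close>
    have "(\<lambda>n. norm (y + ts n *\<^sub>R d)) \<longlonglongrightarrow> norm (y + 0 *\<^sub>R d)" by (intro tendsto_intros t0)
    then have "1 \<le> norm (y + 0 *\<^sub>R d)"
    proof (rule tendsto_lowerbound)
      show "\<forall>\<^sub>F n in sequentially. 1 \<le> norm (y + ts n *\<^sub>R d)"
        using out z2 eventually_ge_at_top[of N] by eventually_elim (use z in fastforce)
    qed simp
    then have ny: "norm y = 1" using y1 by simp
    define e where "e = \<mu> * (norm d)\<^sup>2 / 8"
    have e: "0 < e" using mu False by (simp add: e_def)
    have "\<forall>\<^sub>F n in sequentially. False"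
      using rejected_eventually[OF e] z2 eventually_ge_at_top[of N] \<alpha>(2)
    proof eventually_elim
      case (elim n)
      then have r: "1 < norm (zs n)" "Ls n * norm (ws n - zs n) < e" using nacc by auto
      have "norm (zs n) - 1 \<le> norm (ws n - zs n)"
        using norm_triangle_ineq2[of "zs n" "ws n"] w_ball[of n] by (simp add: norm_minus_commute)
      then have "Ls n * (norm (zs n) - 1) \<le> Ls n * norm (ws n - zs n)" using L_ge[of n] by (intro mult_left_mono) auto
      then have l: "Ls n * (norm (zs n) - 1) < e" using r by linarith
      have "(norm (zs n))\<^sup>2 - 1 = (norm (zs n) - 1) * (norm (zs n) + 1)" by (simp add: power2_eq_square algebra_simps)
      also have "\<dots> \<le> (norm (zs n) - 1) * 3" using r elim by (intro mult_left_mono) auto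
      finally have "Ls n * ((norm (zs n))\<^sup>2 - 1) \<le> Ls n * ((norm (zs n) - 1) * 3)"
        using L_ge[of n] by (intro mult_left_mono) auto
      then have u: "Ls n * ((norm (zs n))\<^sup>2 - 1) < 3 * e" using l by linarith
      have "(ts n)\<^sup>2 * (norm d)\<^sup>2 \<le> (norm (zs n))\<^sup>2 - 1"
        using sq[OF elim(3)] yd ny weight_sqrt_bound(2)[OF \<alpha>(1) elim(4)]
        by (simp add: distrib_left power2_eq_square[of "ts n"])
      then have "Ls n * ((ts n)\<^sup>2 * (norm d)\<^sup>2) \<le> Ls n * ((norm (zs n))\<^sup>2 - 1)"
        using L_ge[of n] by (intro mult_left_mono) auto
      moreover have "3 / 4 * \<mu> * (norm d)\<^sup>2 \<le> Ls n * (ts n)\<^sup>2 * (norm d)\<^sup>2"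
        using weight_sqrt_bound(4)[OF \<alpha>(1) elim(4)] by (intro mult_right_mono) auto
      ultimately have "3 / 4 * \<mu> * (norm d)\<^sup>2 < 3 * e" using u by (simp add: mult.assoc)
      then show False using mu False by (simp add: e_def)
    qed
    then show False by simp
  qed
qed

end

section \<open>Energy and velocity of an infinite run\<close>

context fista
begin

lemma extrapolation_bounds:
  assumes A: "0 < A" and L: "1 \<le> L"
  defines "m \<equiv> extrapolation A L" and "t \<equiv> weight A L"
  shows extrapolation_nonneg: "0 \<le> m" and extrapolation_weight_le: "m * t \<le> 1"
    and extrapolation_square_le: "(\<mu> + 1 / (A + stepsize A L)) * m\<^sup>2 \<le> L"
proof -
  define e where "e = \<mu> + 1 / A"
  define e' where "e' = \<mu> + 1 / (A + stepsize A L)"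
  define r where "r = (1 - t) * e / e'"
  have t: "0 < t" "t < 1" unfolding t_def using weight_pos weight_less A L by auto
  have e: "0 < e" "0 < e'" using mu A stepsize_pos[of A L] L by (auto simp: e_def e'_def add_pos_pos)
  have e': "e' = \<mu> * t + e * (1 - t)" unfolding e'_def e_def t_def by (rule inverse_next[OF A L])
  have eq: "(L - \<mu>) * t\<^sup>2 = e * (1 - t)" unfolding e_def t_def by (rule weight_eq[OF A L])
  have m: "m = (1 - t) / t * r" unfolding m_def r_def e_def e'_def t_def by (rule extrapolation_eq[OF A L])
  have r: "0 \<le> r" "r \<le> 1" using e t mu e' by (auto simp: r_def mult.commute)
  have re: "r * e' = (1 - t) * e" using e by (simp add: r_def)
  show "0 \<le> m" unfolding m using r t by simp
  have mt: "m * t = (1 - t) * r" unfolding m using t by simp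
  also have "\<dots> \<le> 1 * 1" using r t by (intro mult_mono) auto
  finally show "m * t \<le> 1" by simp
  have "e' * m\<^sup>2 * t\<^sup>2 = e' * (m * t)\<^sup>2" by (simp add: power_mult_distrib)
  also have "\<dots> = (1 - t)\<^sup>2 * r * (r * e')" unfolding mt by (simp add: power2_eq_square mult_ac)
  also have "\<dots> = ((1 - t)\<^sup>2 * r) * ((1 - t) * e)" unfolding re by simp
  also have "\<dots> \<le> 1 * ((1 - t) * e)"
  proof (rule mult_right_mono)
    have "(1 - t)\<^sup>2 * r \<le> 1 * 1" using t r by (intro mult_mono power_le_one) auto
    then show "(1 - t)\<^sup>2 * r \<le> 1" by simp
  qed (use t e in auto)
  also have "\<dots> = (L - \<mu>) * t\<^sup>2" unfolding eq by (simp add: mult.commute)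
  also have "\<dots> \<le> L * t\<^sup>2" using mu by (intro mult_right_mono) auto
  finally show "e' * m\<^sup>2 \<le> L" using t by (simp add: mult_le_cancel_right_pos)
qed

end

text \<open>Eventually \<open>A\<close> is bounded below, since it increases with every accepted trial.\<close>

locale fista_run_pos = fista_run +
  fixes \<alpha> :: real
  assumes alpha: "0 < \<alpha>" and alpha_le: "\<forall>\<^sub>F n in sequentially. \<alpha> \<le> As n"
begin

text \<open>The distance of the two iterates, which is proportional to the length of the last move and plays the
  role of a velocity.\<close>

definition q :: "nat \<Rightarrow> real" where "q n = norm (xs n - ys n)"

text \<open>The discrete energy of the run: the potential energy \<open>\<psi>\<close> and a multiple of the squared velocity.\<close>

definition energy :: "nat \<Rightarrow> real" where
  "energy n = \<psi> (ys n) + (\<mu> + 1 / As n) / 2 * (q n)\<^sup>2"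

lemma q_nonneg: "0 \<le> q n" by (simp add: q_def)

lemma t_tendsto: "ts \<longlonglongrightarrow> 0"
  by (rule weight_tendsto[OF alpha alpha_le])

lemma t_small: "0 < e \<Longrightarrow> \<forall>\<^sub>F n in sequentially. ts n < e"
  using order_tendstoD(2)[OF t_tendsto] by blast

lemma L_large: "\<forall>\<^sub>F n in sequentially. Z < Ls n"
  using L_tendsto by (simp add: filterlim_at_top_dense)

lemma nonstationary: nonstationary
  using alpha_le alpha not_start by (metis (no_types, lifting) eventually_sequentially le_refl not_le)

lemma accepted_short:
  assumes e: "0 < e"
  shows "\<forall>\<^sub>F n in sequentially. acc n \<longrightarrow> norm (ws n - zs n) < e"
  using L_large[of "4 / (chi * \<alpha> * e\<^sup>2)"] alpha_le
proof eventually_elim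
  case (elim n)
  show ?case
  proof
    assume "acc n"
    have p: "0 < chi * \<alpha> * e\<^sup>2" using chi alpha e by simp
    have L: "0 < Ls n" using L_ge[of n] by simp
    have "(norm (ws n - zs n))\<^sup>2 \<le> 4 / (chi * As (Suc n) * Ls n)" by (rule acc_step_length[OF \<open>acc n\<close>])
    also have "\<dots> \<le> 4 / (chi * \<alpha> * Ls n)"
      using chi alpha L elim(2) A_Suc[of n] by (intro divide_left_mono mult_right_mono mult_left_mono mult_pos_pos) auto
    also have "\<dots> < e\<^sup>2"
    proof -
      have "4 < Ls n * (chi * \<alpha> * e\<^sup>2)" using elim(1) p by (simp only: pos_divide_less_eq)
      then have "4 < e\<^sup>2 * (chi * \<alpha> * Ls n)" by (simp add: mult_ac)
      then show ?thesis using chi alpha L by (simp only: pos_divide_less_eq mult_pos_pos)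
    qed
    finally show "norm (ws n - zs n) < e" by (rule power2_less_imp_less) (use e in simp)
  qed
qed

lemma accepted_z: "\<forall>\<^sub>F n in sequentially. acc n \<longrightarrow> norm (zs n) \<le> 2"
  using accepted_short[OF zero_less_one]
proof eventually_elim
  case (elim n)
  then show ?case using norm_triangle_ineq4[of "ws n" "ws n - zs n"] w_ball[of n] by auto
qed

text \<open>The steps that pass the descent test without stopping the method are not much shorter than \<open>1 / L\<close>.\<close>

lemma accepted_force:
  obtains \<eta> where "0 < \<eta>" "\<forall>\<^sub>F n in sequentially. acc n \<longrightarrow> \<eta> \<le> Ls n * norm (ws n - zs n)"
proof -
  obtain \<eta> where \<eta>: "0 < \<eta>" "\<And>L z. 0 < L \<Longrightarrow> z \<in> E \<Longrightarrow>
    \<sigma> * norm (prox L z - x0) < norm (residual L z (prox L z)) \<Longrightarrow> \<eta> \<le> norm (residual L z (prox L z))"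
    using residual_gap[OF nonstationary] by metis
  obtain d where d: "0 < d" "\<And>u z. u \<in> E \<Longrightarrow> z \<in> E \<Longrightarrow> norm u \<le> 2 \<Longrightarrow> norm z \<le> 2 \<Longrightarrow> norm (u - z) < d \<Longrightarrow> norm (D u - D z) < \<eta> / 2"
    using D_uniformly_continuous[OF half_gt_zero[OF \<eta>(1)], of 2] by metis
  show ?thesis
  proof (rule that[of "\<eta> / 2"])
    show "\<forall>\<^sub>F n in sequentially. acc n \<longrightarrow> \<eta> / 2 \<le> Ls n * norm (ws n - zs n)"
      using accepted_short[OF d(1)] accepted_z
    proof eventually_elim
      case (elim n)
      show ?case
      proof
        assume a: "acc n"
        have L: "0 < Ls n" using L_ge[of n] by simp
        have "\<eta> \<le> norm (residual (Ls n) (zs n) (ws n))"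
          using \<eta>(2)[OF L z_in[of n]] acc_residual[OF a] by (simp add: ws_def)
        also have "\<dots> \<le> norm (D (ws n) - D (zs n)) + norm (Ls n *\<^sub>R (zs n - ws n))"
          unfolding residual_def by (rule norm_triangle_ineq)
        also have "norm (D (ws n) - D (zs n)) < \<eta> / 2"
          using d(2)[OF w_in[of n] z_in[of n]] elim a w_ball[of n] by simp
        finally show "\<eta> / 2 \<le> Ls n * norm (ws n - zs n)" using L by (simp add: norm_minus_commute)
      qed
    qed
  qed (use \<eta> in simp)
qed

text \<open>The energy gained by the negative curvature \<open>C\<close> is of the order of \<open>t\<^sup>2 q\<^sup>2\<close>, while friction takes away \<open>\<mu> t q\<^sup>2 / 2\<close>;
  the term with \<open>\<eta>\<close> is what the descent test, with \<open>(1 - chi) L / 4\<close> instead of \<open>L / 2\<close>, leaves over.\<close>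

lemma energy_step:
  assumes a: "acc n" and A: "\<alpha> \<le> As n" and z: "norm (zs n) \<le> 2"
    and C: "0 \<le> C" "\<And>u z. u \<in> E \<Longrightarrow> z \<in> E \<Longrightarrow> norm u \<le> 2 \<Longrightarrow> norm z \<le> 2 \<Longrightarrow>
       \<psi> z + D z \<bullet> (u - z) - C * (norm (u - z))\<^sup>2 \<le> \<psi> u"
    and t: "(\<mu> + 2 * C) * ts n \<le> \<mu> / 2"
    and \<eta>: "0 < \<eta>" "\<eta> \<le> Ls n * norm (ws n - zs n)"
  shows "energy (Suc n) \<le> energy n - \<mu> / 4 * (ts n * (q n)\<^sup>2) - \<eta>\<^sup>2 / (4 * (\<mu> + 1 / \<alpha>)) * (ts n)\<^sup>2"
proof -
  define L where "L = Ls n"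
  define T where "T = ts n"
  define h where "h = norm (ws n - zs n)"
  define Q where "Q = q n"
  define r where "r = norm (ws n - ys n)"
  define m where "m = extrapolation (As n) (Ls n)"
  define e' where "e' = \<mu> + 1 / As (Suc n)"
  define e where "e = \<mu> + 1 / As n"
  have A0: "0 < As n" using alpha A by simp
  have L: "1 \<le> L" by (simp add: L_def L_ge)
  have T: "0 < T" "T < 1" "L * T\<^sup>2 \<le> \<mu> + 1 / \<alpha>" using weight_sqrt_bound[OF alpha A] by (auto simp: T_def L_def)
  have "ws n = prox L (zs n)" by (simp add: ws_def L_def)
  then have "D (zs n) \<bullet> (ws n - zs n) + L / 2 * h\<^sup>2 + L / 2 * r\<^sup>2
      \<le> D (zs n) \<bullet> (ys n - zs n) + L / 2 * (norm (ys n - zs n))\<^sup>2"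
    using prox_three_point[of L "ys n" "zs n"] L y_ball[of n] by (simp add: h_def r_def norm_minus_commute)
  moreover have "\<psi> (zs n) + D (zs n) \<bullet> (ys n - zs n) - C * (norm (ys n - zs n))\<^sup>2 \<le> \<psi> (ys n)"
    using C(2)[OF y_in z_in] y_ball[of n] z by simp
  moreover have "\<psi> (ws n) \<le> \<psi> (zs n) + D (zs n) \<bullet> (ws n - zs n) + (1 - chi) * L / 4 * h\<^sup>2"
    using a unfolding acc_def accepted_def by (simp add: L_def h_def)
  moreover have "(1 - chi) * L / 4 * h\<^sup>2 \<le> L / 4 * h\<^sup>2"
    using chi L by (intro mult_right_mono) auto
  moreover have "norm (ys n - zs n) = T * Q"
    using T by (simp add: z_eq T_def Q_def q_def)
  ultimately have 1: "\<psi> (ws n) + L / 4 * h\<^sup>2 + L / 2 * r\<^sup>2 \<le> \<psi> (ys n) + (C + L / 2) * (T * Q)\<^sup>2"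
    by (simp add: distrib_right)
  have mm: "0 \<le> m" "e' * m\<^sup>2 \<le> L"
    using extrapolation_bounds[OF A0 L_ge[of n]] acc_A[OF a] by (auto simp: m_def e'_def L_def)
  have "q (Suc n) = m * r"
    using acc_x[OF a] acc_y[OF a] mm by (simp add: q_def r_def m_def)
  then have "e' * (q (Suc n))\<^sup>2 = e' * m\<^sup>2 * r\<^sup>2" by (simp add: power_mult_distrib)
  also have "\<dots> \<le> L * r\<^sup>2" using mm by (intro mult_right_mono) auto
  finally have 2: "e' * (q (Suc n))\<^sup>2 \<le> L * r\<^sup>2" .
  have ee: "e' \<le> e" using A0 A_Suc[of n] by (simp add: e_def e'_def frac_le)
  have "(L - \<mu>) * T\<^sup>2 = e * (1 - T)" unfolding L_def T_def ts_def e_def by (rule weight_eq[OF A0 L_ge])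
  moreover have "e' = \<mu> * T + e * (1 - T)"
    unfolding e'_def e_def acc_A[OF a] T_def ts_def by (rule inverse_next[OF A0 L_ge])
  ultimately have LT: "L * T\<^sup>2 = e' - \<mu> * T + \<mu> * T\<^sup>2" by (simp add: algebra_simps)
  have "(\<mu> + 2 * C) * T * T \<le> \<mu> / 2 * T" using t T by (intro mult_right_mono) (auto simp: T_def)
  then have "(2 * C + L) * T\<^sup>2 \<le> e' - \<mu> / 2 * T"
    using LT by (simp add: distrib_right power2_eq_square)
  also have "\<dots> \<le> e - \<mu> / 2 * T" using ee by simp
  finally have "(2 * C + L) * T\<^sup>2 * Q\<^sup>2 \<le> (e - \<mu> / 2 * T) * Q\<^sup>2" by (intro mult_right_mono) auto
  then have 3: "(C + L / 2) * (T * Q)\<^sup>2 \<le> e / 2 * Q\<^sup>2 - \<mu> / 4 * (T * Q\<^sup>2)"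
    by (simp add: power_mult_distrib left_diff_distrib distrib_right)
  have "\<eta>\<^sup>2 * T\<^sup>2 \<le> (L * h)\<^sup>2 * T\<^sup>2"
    using \<eta> by (intro mult_right_mono power_mono) (auto simp: L_def h_def)
  also have "\<dots> = (L * T\<^sup>2) * (L * h\<^sup>2)" by (simp add: power2_eq_square mult_ac)
  also have "\<dots> \<le> (\<mu> + 1 / \<alpha>) * (L * h\<^sup>2)" using T L by (intro mult_right_mono) auto
  finally have 4: "\<eta>\<^sup>2 / (4 * (\<mu> + 1 / \<alpha>)) * T\<^sup>2 \<le> L / 4 * h\<^sup>2"
    using alpha mu by (simp add: field_simps add_pos_pos)
  have "energy (Suc n) = \<psi> (ws n) + e' / 2 * (q (Suc n))\<^sup>2"
    unfolding energy_def e'_def acc_y[OF a] ..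
  moreover have "energy n = \<psi> (ys n) + e / 2 * Q\<^sup>2" unfolding energy_def e_def Q_def ..
  ultimately show ?thesis using 1 2 3 4 unfolding T_def[symmetric] Q_def[symmetric] by linarith
qed

lemma energy_decreases:
  obtains c where "0 < c" "\<forall>\<^sub>F n in sequentially. acc n \<longrightarrow> energy (Suc n) \<le> energy n - c * (ts n * (q n)\<^sup>2 + (ts n)\<^sup>2)"
proof -
  obtain C where C: "0 \<le> C" "\<And>u z. u \<in> E \<Longrightarrow> z \<in> E \<Longrightarrow> norm u \<le> 2 \<Longrightarrow> norm z \<le> 2 \<Longrightarrow>
       \<psi> z + D z \<bullet> (u - z) - C * (norm (u - z))\<^sup>2 \<le> \<psi> u"
    using weak_convexity_constant[of 2] by metis
  obtain \<eta> where \<eta>: "0 < \<eta>" "\<forall>\<^sub>F n in sequentially. acc n \<longrightarrow> \<eta> \<le> Ls n * norm (ws n - zs n)"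
    by (rule accepted_force)
  define c where "c = min (\<mu> / 4) (\<eta>\<^sup>2 / (4 * (\<mu> + 1 / \<alpha>)))"
  have c: "0 < c" using mu alpha \<eta>(1) by (simp add: c_def add_pos_pos)
  have cle: "c \<le> \<mu> / 4" "c \<le> \<eta>\<^sup>2 / (4 * (\<mu> + 1 / \<alpha>))"
    unfolding c_def by (rule min.cobounded1, rule min.cobounded2)
  have "0 < \<mu> / (2 * (\<mu> + 2 * C))" using mu C(1) by simp
  from t_small[OF this] \<eta>(2) accepted_z alpha_le
  have "\<forall>\<^sub>F n in sequentially. acc n \<longrightarrow> energy (Suc n) \<le> energy n - c * (ts n * (q n)\<^sup>2 + (ts n)\<^sup>2)"
  proof eventually_elim
    case (elim n)
    show ?case
    proof
      assume a: "acc n"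
      have "(\<mu> + 2 * C) * ts n \<le> \<mu> / 2" using elim(1) mu C(1) by (simp add: field_simps)
      from energy_step[OF a elim(4) _ C this \<eta>(1)] elim a
      have "energy (Suc n) \<le> energy n - \<mu> / 4 * (ts n * (q n)\<^sup>2) - \<eta>\<^sup>2 / (4 * (\<mu> + 1 / \<alpha>)) * (ts n)\<^sup>2"
        by blast
      moreover have "c * (ts n * (q n)\<^sup>2) \<le> \<mu> / 4 * (ts n * (q n)\<^sup>2)"
        using weight_sqrt_bound(2)[OF alpha elim(4)] by (intro mult_right_mono cle) auto
      moreover have "c * (ts n)\<^sup>2 \<le> \<eta>\<^sup>2 / (4 * (\<mu> + 1 / \<alpha>)) * (ts n)\<^sup>2"
        by (intro mult_right_mono cle) auto
      ultimately show "energy (Suc n) \<le> energy n - c * (ts n * (q n)\<^sup>2 + (ts n)\<^sup>2)"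
        by (simp add: distrib_left)
    qed
  qed
  with c show ?thesis using that by blast
qed

lemma rejected_same:
  assumes "\<not> acc n"
  shows "energy (Suc n) = energy n" "q (Suc n) = q n"
  using rej[OF assms] by (auto simp: energy_def q_def)

lemma step_bounds:
  obtains K where "0 \<le> K" "\<forall>\<^sub>F n in sequentially. acc n \<longrightarrow>
     q (Suc n) \<le> q n + K * ts n \<and> norm (ys (Suc n) - ys n) \<le> ts n * q n + K * (ts n)\<^sup>2"
proof -
  obtain M where M: "0 \<le> M" "\<And>z. z \<in> E \<Longrightarrow> norm z \<le> 2 \<Longrightarrow> norm (D z) \<le> M"
    using D_bounded[of 2] by metis
  define K where "K = M * (4 / (3 * \<mu>))"
  have K: "0 \<le> K" using M mu by (simp add: K_def)
  have "\<forall>\<^sub>F n in sequentially. acc n \<longrightarrow>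
     q (Suc n) \<le> q n + K * ts n \<and> norm (ys (Suc n) - ys n) \<le> ts n * q n + K * (ts n)\<^sup>2"
    using accepted_z alpha_le
  proof eventually_elim
    case (elim n)
    show ?case
    proof
      assume a: "acc n"
      have A0: "0 < As n" using elim alpha by simp
      have L: "0 < Ls n" using L_ge[of n] by simp
      have T: "0 < ts n" "3 / 4 * \<mu> \<le> Ls n * (ts n)\<^sup>2" using weight_sqrt_bound[OF alpha elim(2)] by auto
      define m where "m = extrapolation (As n) (Ls n)"
      have m: "0 \<le> m" "m * ts n \<le> 1"
        using extrapolation_bounds[OF A0 L_ge[of n]] by (auto simp: m_def ts_def)
      have "norm (ws n - ys n) = norm (ball_proj (zs n - (1 / Ls n) *\<^sub>R D (zs n)) - ball_proj (ys n))"
        by (simp add: ws_def prox_def ball_proj_id[OF y_ball])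
      also have "\<dots> \<le> norm (zs n - (1 / Ls n) *\<^sub>R D (zs n) - ys n)" by (rule ball_proj_nonexpansive)
      also have "\<dots> = norm ((zs n - ys n) - (1 / Ls n) *\<^sub>R D (zs n))" by (simp add: algebra_simps)
      also have "\<dots> \<le> norm (zs n - ys n) + norm ((1 / Ls n) *\<^sub>R D (zs n))" by (rule norm_triangle_ineq4)
      also have "norm (zs n - ys n) = ts n * q n" using T by (simp add: z_eq q_def)
      also have "norm ((1 / Ls n) *\<^sub>R D (zs n)) \<le> M / Ls n"
        using M(2)[OF z_in] elim a L by (simp add: divide_right_mono)
      also have "M / Ls n \<le> K * (ts n)\<^sup>2"
      proof -
        have "M * (3 / 4 * \<mu>) \<le> M * (Ls n * (ts n)\<^sup>2)" using T M by (intro mult_left_mono) auto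
        then show ?thesis using L mu by (simp add: K_def field_simps)
      qed
      finally have w: "norm (ws n - ys n) \<le> ts n * q n + K * (ts n)\<^sup>2" by simp
      have "q (Suc n) = m * norm (ws n - ys n)"
        using acc_x[OF a] acc_y[OF a] m by (simp add: q_def m_def)
      also have "\<dots> \<le> m * (ts n * q n + K * (ts n)\<^sup>2)" using w m by (intro mult_left_mono) auto
      also have "\<dots> = (m * ts n) * (q n + K * ts n)" by (simp add: power2_eq_square algebra_simps)
      also have "\<dots> \<le> 1 * (q n + K * ts n)" using m K T q_nonneg[of n] by (intro mult_right_mono) auto
      finally show "q (Suc n) \<le> q n + K * ts n \<and> norm (ys (Suc n) - ys n) \<le> ts n * q n + K * (ts n)\<^sup>2"
        using w acc_y[OF a] by simp
    qed
  qed
  with K show ?thesis using that by blast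
qed

lemma energy_bounded_below: "\<exists>m. \<forall>\<^sub>F n in sequentially. m + \<mu> / 2 * (q n)\<^sup>2 \<le> energy n"
proof -
  obtain m where m: "\<And>u. u \<in> E \<Longrightarrow> norm u \<le> 1 \<Longrightarrow> m \<le> \<psi> u" using psi_bounded_below by blast
  have "\<forall>\<^sub>F n in sequentially. m + \<mu> / 2 * (q n)\<^sup>2 \<le> energy n"
    using alpha_le
  proof eventually_elim
    case (elim n)
    have "\<mu> / 2 * (q n)\<^sup>2 \<le> (\<mu> + 1 / As n) / 2 * (q n)\<^sup>2"
      using elim alpha by (intro mult_right_mono) auto
    then show ?case using m[OF y_in y_ball, of n] unfolding energy_def by linarith
  qed
  then show ?thesis by blast
qed

lemma energy_convergent: "convergent energy"
proof -
  obtain c where c: "0 < c" "\<forall>\<^sub>F n in sequentially. acc n \<longrightarrow> energy (Suc n) \<le> energy n - c * (ts n * (q n)\<^sup>2 + (ts n)\<^sup>2)"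
    by (rule energy_decreases)
  obtain m where m: "\<forall>\<^sub>F n in sequentially. m + \<mu> / 2 * (q n)\<^sup>2 \<le> energy n" using energy_bounded_below by blast
  show ?thesis
  proof (rule eventually_decreasing_convergent)
    show "\<forall>\<^sub>F n in sequentially. energy (Suc n) \<le> energy n"
      using c(2) alpha_le
    proof eventually_elim
      case (elim n)
      have "0 \<le> c * (ts n * (q n)\<^sup>2 + (ts n)\<^sup>2)"
        using c(1) weight_sqrt_bound(2)[OF alpha elim(2)] by (intro mult_nonneg_nonneg add_nonneg_nonneg) auto
      then show ?case using elim rejected_same(1)[of n] by (cases "acc n") auto
    qed
    show "\<forall>\<^sub>F n in sequentially. m \<le> energy n"
      using m
    proof eventually_elim
      case (elim n)
      have "0 \<le> \<mu> / 2 * (q n)\<^sup>2" using mu by simp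
      then show ?case using elim by linarith
    qed
  qed
qed

lemma q_bounded: "\<exists>Q. \<forall>\<^sub>F n in sequentially. q n \<le> Q"
proof -
  obtain m where m: "\<forall>\<^sub>F n in sequentially. m + \<mu> / 2 * (q n)\<^sup>2 \<le> energy n" using energy_bounded_below by blast
  obtain K where K: "\<And>n. \<bar>energy n\<bar> \<le> K"
    using convergent_imp_Bseq[OF energy_convergent] by (auto simp: Bseq_def)
  have "\<forall>\<^sub>F n in sequentially. q n \<le> sqrt (2 / \<mu> * (K - m))"
    using m
  proof eventually_elim
    case (elim n)
    have "\<mu> / 2 * (q n)\<^sup>2 \<le> K - m" using elim K[of n] by linarith
    then have "(q n)\<^sup>2 \<le> 2 / \<mu> * (K - m)" using mu by (simp add: field_simps)
    then show ?case by (rule real_le_rsqrt)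
  qed
  then show ?thesis by blast
qed

text \<open>The velocity converges: a suitable combination of its third power and the energy decreases.\<close>

lemma q_convergent: "convergent q"
proof -
  obtain c where c: "0 < c" "\<forall>\<^sub>F n in sequentially. acc n \<longrightarrow> energy (Suc n) \<le> energy n - c * (ts n * (q n)\<^sup>2 + (ts n)\<^sup>2)"
    by (rule energy_decreases)
  obtain K where K: "0 \<le> K" "\<forall>\<^sub>F n in sequentially. acc n \<longrightarrow>
     q (Suc n) \<le> q n + K * ts n \<and> norm (ys (Suc n) - ys n) \<le> ts n * q n + K * (ts n)\<^sup>2"
    by (rule step_bounds)
  obtain m where m: "\<forall>\<^sub>F n in sequentially. m + \<mu> / 2 * (q n)\<^sup>2 \<le> energy n" using energy_bounded_below by blast
  obtain Q where Q: "\<forall>\<^sub>F n in sequentially. q n \<le> Q" using q_bounded by blast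
  define C where "C = 3 * K + 3 * K\<^sup>2 * \<bar>Q\<bar> + K ^ 3"
  have C: "0 \<le> C" using K by (simp add: C_def)
  define G where "G n = (q n) ^ 3 + C / c * energy n" for n
  have "convergent G"
  proof (rule eventually_decreasing_convergent)
    show "\<forall>\<^sub>F n in sequentially. G (Suc n) \<le> G n"
      using c(2) K(2) Q alpha_le
    proof eventually_elim
      case (elim n)
      show ?case
      proof (cases "acc n")
        case False
        then show ?thesis by (simp add: G_def rejected_same)
      next
        case True
        define t where "t = ts n"
        have t: "0 < t" "t < 1" using weight_sqrt_bound[OF alpha elim(4)] by (auto simp: t_def)
        define p where "p = q n"
        have p: "0 \<le> p" "p \<le> \<bar>Q\<bar>" using elim(3) q_nonneg[of n] by (auto simp: p_def)
        have "(q (Suc n)) ^ 3 \<le> (p + K * t) ^ 3"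
          using elim(2) True q_nonneg by (intro power_mono) (auto simp: p_def t_def)
        also have "\<dots> = p ^ 3 + (3 * K) * (t * p\<^sup>2) + (3 * K\<^sup>2 * p) * t\<^sup>2 + K ^ 3 * t ^ 3"
          by (simp add: power3_eq_cube power2_eq_square algebra_simps)
        also have "(3 * K\<^sup>2 * p) * t\<^sup>2 \<le> (3 * K\<^sup>2 * \<bar>Q\<bar>) * t\<^sup>2" using p by (intro mult_right_mono mult_left_mono) auto
        also have "K ^ 3 * t ^ 3 \<le> K ^ 3 * t\<^sup>2" using K t by (intro mult_left_mono power_decreasing) auto
        also have "p ^ 3 + (3 * K) * (t * p\<^sup>2) + (3 * K\<^sup>2 * \<bar>Q\<bar>) * t\<^sup>2 + K ^ 3 * t\<^sup>2 \<le> p ^ 3 + C * (t * p\<^sup>2 + t\<^sup>2)"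
        proof -
          have "(3 * K) * (t * p\<^sup>2) \<le> C * (t * p\<^sup>2)" using K t by (intro mult_right_mono) (auto simp: C_def)
          moreover have "(3 * K\<^sup>2 * \<bar>Q\<bar> + K ^ 3) * t\<^sup>2 \<le> C * t\<^sup>2" using K by (intro mult_right_mono) (auto simp: C_def)
          ultimately show ?thesis by (simp add: distrib_left distrib_right)
        qed
        finally have 1: "(q (Suc n)) ^ 3 \<le> p ^ 3 + C * (t * p\<^sup>2 + t\<^sup>2)" by simp
        have "energy (Suc n) \<le> energy n - c * (t * p\<^sup>2 + t\<^sup>2)" using elim(1) True by (simp add: t_def p_def)
        then have "C / c * energy (Suc n) \<le> C / c * (energy n - c * (t * p\<^sup>2 + t\<^sup>2))"
          using C c by (intro mult_left_mono) auto
        also have "\<dots> = C / c * energy n - C * (t * p\<^sup>2 + t\<^sup>2)" using c by (simp add: right_diff_distrib)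
        finally show ?thesis using 1 by (simp add: G_def p_def)
      qed
    qed
    show "\<forall>\<^sub>F n in sequentially. C / c * m \<le> G n"
      using m
    proof eventually_elim
      case (elim n)
      have "0 \<le> \<mu> / 2 * (q n)\<^sup>2" using mu by simp
      then have "m \<le> energy n" using elim by linarith
      then have "C / c * m \<le> C / c * energy n" using C c by (intro mult_left_mono) auto
      then show ?case using q_nonneg[of n] zero_le_power[OF q_nonneg, of n 3] unfolding G_def by linarith
    qed
  qed
  then obtain l where "G \<longlonglongrightarrow> l" by (auto simp: convergent_def)
  moreover obtain l' where "energy \<longlonglongrightarrow> l'" using energy_convergent by (auto simp: convergent_def)
  ultimately have "(\<lambda>n. G n - C / c * energy n) \<longlonglongrightarrow> l - C / c * l'" by (intro tendsto_intros)
  then have "(\<lambda>n. root 3 ((q n) ^ 3)) \<longlonglongrightarrow> root 3 (l - C / c * l')"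
    by (intro tendsto_real_root) (simp add: G_def)
  then show ?thesis using q_nonneg by (auto simp: convergent_def real_root_power_cancel)
qed

text \<open>If the velocity does not tend to \<open>0\<close>, the energy dissipation bounds the length of the path.\<close>

lemma y_convergent:
  assumes "q \<longlonglongrightarrow> l" "l \<noteq> 0"
  obtains yl where "ys \<longlonglongrightarrow> yl"
proof -
  have "0 \<le> l" by (rule LIMSEQ_le_const[OF assms(1)]) (use q_nonneg in auto)
  with assms(2) have l: "0 < l" by simp
  obtain c where c: "0 < c" "\<forall>\<^sub>F n in sequentially. acc n \<longrightarrow> energy (Suc n) \<le> energy n - c * (ts n * (q n)\<^sup>2 + (ts n)\<^sup>2)"
    by (rule energy_decreases)
  obtain K where K: "0 \<le> K" "\<forall>\<^sub>F n in sequentially. acc n \<longrightarrow>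
     q (Suc n) \<le> q n + K * ts n \<and> norm (ys (Suc n) - ys n) \<le> ts n * q n + K * (ts n)\<^sup>2"
    by (rule step_bounds)
  define H where "H = 2 / l + K"
  have H: "0 < H" using l K by (simp add: H_def add_pos_nonneg)
  have "\<forall>\<^sub>F n in sequentially. l / 2 < q n" using order_tendstoD(1)[OF assms(1), of "l / 2"] l by simp
  then have "\<forall>\<^sub>F n in sequentially. norm (ys (Suc n) - ys n) \<le> H / c * (energy n - energy (Suc n))"
    using c(2) K(2) alpha_le
  proof eventually_elim
    case (elim n)
    show ?case
    proof (cases "acc n")
      case False
      then show ?thesis using rej[OF False] rejected_same[OF False] by simp
    next
      case True
      have t: "0 < ts n" using weight_sqrt_bound[OF alpha elim(4)] by simp
      have "q n \<le> 2 / l * (q n)\<^sup>2" using elim(1) l by (simp add: field_simps power2_eq_square)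
      then have "ts n * q n \<le> ts n * (2 / l * (q n)\<^sup>2)" using t by (intro mult_left_mono) auto
      also have "\<dots> = 2 / l * (ts n * (q n)\<^sup>2)" by simp
      also have "\<dots> \<le> H * (ts n * (q n)\<^sup>2)" using t K by (intro mult_right_mono) (auto simp: H_def)
      finally have "norm (ys (Suc n) - ys n) \<le> H * (ts n * (q n)\<^sup>2) + K * (ts n)\<^sup>2" using elim(3) True by linarith
      also have "K * (ts n)\<^sup>2 \<le> H * (ts n)\<^sup>2" using l by (intro mult_right_mono) (auto simp: H_def)
      finally have "norm (ys (Suc n) - ys n) \<le> H / c * (c * (ts n * (q n)\<^sup>2 + (ts n)\<^sup>2))"
        using c by (simp add: distrib_left)
      also have "\<dots> \<le> H / c * (energy n - energy (Suc n))"
        using elim(2) True H c by (intro mult_left_mono) auto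
      finally show ?thesis .
    qed
  qed
  then obtain N where N: "\<And>n. N \<le> n \<Longrightarrow> norm (ys (Suc n) - ys n) \<le> H / c * (energy n - energy (Suc n))"
    unfolding eventually_sequentially by blast
  have path: "norm (ys m - ys n) \<le> H / c * (energy n - energy m)" if "N \<le> n" "n \<le> m" for m n
    using that(2)
  proof (induction rule: dec_induct)
    case (step k)
    have "norm (ys (Suc k) - ys n) \<le> norm (ys (Suc k) - ys k) + norm (ys k - ys n)"
      using norm_triangle_ineq[of "ys (Suc k) - ys k" "ys k - ys n"] by simp
    also have "\<dots> \<le> H / c * (energy k - energy (Suc k)) + H / c * (energy n - energy k)"
      using N[of k] step that by (intro add_mono) auto
    finally show ?case by (simp add: right_diff_distrib)
  qed simp
  have "Cauchy ys"
    unfolding Cauchy_altdef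
  proof (intro allI impI)
    fix e :: real assume e: "0 < e"
    have "Cauchy energy" using energy_convergent by (rule convergent_Cauchy)
    moreover have "0 < e / (H / c)" using e H c by simp
    ultimately obtain M where M: "\<And>m n. M \<le> m \<Longrightarrow> m < n \<Longrightarrow> dist (energy m) (energy n) < e / (H / c)"
      unfolding Cauchy_altdef by blast
    show "\<exists>M. \<forall>m\<ge>M. \<forall>n>m. dist (ys m) (ys n) < e"
    proof (intro exI[of _ "max M N"] allI impI)
      fix m n assume "max M N \<le> m" "m < n"
      then have "energy m - energy n < e / (H / c)" "norm (ys n - ys m) \<le> H / c * (energy m - energy n)"
        using M[of m n] path[of m n] by (auto simp: dist_real_def)
      moreover have "0 < H / c" using H c by simp
      ultimately have "norm (ys n - ys m) < e"
        unfolding pos_less_divide_eq[OF \<open>0 < H / c\<close>] by (simp only: mult.commute[of "H / c"])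
      then show "dist (ys m) (ys n) < e" by (simp add: dist_norm norm_minus_commute)
    qed
  qed
  have "ys n \<in> E \<inter> cball 0 1" for n using y_in y_ball by simp
  moreover have "complete (E \<inter> cball 0 1)" by (rule compact_imp_complete[OF compact_ball])
  ultimately obtain yl where "ys \<longlonglongrightarrow> yl" using \<open>Cauchy ys\<close> unfolding complete_def by blast
  then show ?thesis by (rule that)
qed

end

section \<open>Infinite runs near a stationary point of the sphere\<close>

context fista
begin

lemma weight_decreasing:
  assumes A: "0 < A" and L: "1 \<le> L" "L < L'"
  shows "weight A L' < weight A L"
proof (rule ccontr)
  define t where "t = weight A L"
  define t' where "t' = weight A L'"
  define e where "e = \<mu> + 1 / A"
  have t: "0 < t" "t < 1" "0 < t'" using weight_pos weight_less A L by (auto simp: t_def t'_def)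
  have e: "0 < e" using A mu by (simp add: e_def add_pos_pos)
  have eq: "(L - \<mu>) * t\<^sup>2 = e * (1 - t)" "(L' - \<mu>) * t'\<^sup>2 = e * (1 - t')"
    unfolding t_def t'_def e_def using weight_eq A L by auto
  assume "\<not> weight A L' < weight A L"
  then have le: "t \<le> t'" by (simp add: t_def t'_def)
  have "(L' - \<mu>) * t\<^sup>2 \<le> (L' - \<mu>) * t'\<^sup>2" using le t L mu by (intro mult_left_mono power_mono) auto
  also have "\<dots> \<le> (L - \<mu>) * t\<^sup>2" unfolding eq using e le by simp
  finally show False using L t by (simp add: mult_le_cancel_right)
qed

lemma weight_double:
  assumes A: "0 < A" and L: "5 \<le> L"
  shows "weight A L \<le> 3 / 2 * weight A (2 * L)"
proof -
  define t where "t = weight A L"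
  define t' where "t' = weight A (2 * L)"
  define e where "e = \<mu> + 1 / A"
  have t: "0 < t" "0 < t'" using weight_pos A L by (auto simp: t_def t'_def)
  have le: "t' < t" unfolding t_def t'_def by (rule weight_decreasing) (use A L in auto)
  have e: "0 < e" using A mu by (simp add: e_def add_pos_pos)
  have eq: "(L - \<mu>) * t\<^sup>2 = e * (1 - t)" "(2 * L - \<mu>) * t'\<^sup>2 = e * (1 - t')"
    unfolding t_def t'_def e_def using weight_eq[of A L] weight_eq[of A "2 * L"] A L by auto
  have "(L - \<mu>) * t\<^sup>2 \<le> (2 * L - \<mu>) * t'\<^sup>2" unfolding eq using e le by simp
  also have "\<dots> \<le> (9 / 4 * (L - \<mu>)) * t'\<^sup>2" using L mu by (intro mult_right_mono) auto
  also have "\<dots> = (L - \<mu>) * (3 / 2 * t')\<^sup>2" by (simp add: power2_eq_square)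
  finally have "t\<^sup>2 \<le> (3 / 2 * t')\<^sup>2" using L mu by simp
  then show ?thesis unfolding t_def[symmetric] t'_def[symmetric] by (rule power2_le_imp_le) (use t in simp)
qed

text \<open>After an accepted step with unchanged \<open>L\<close>, the next extrapolated point continues the move of \<open>y\<close> by the factor \<open>\<beta>\<close>.\<close>

lemma momentum_bounds:
  assumes A: "0 < A" and L: "1 \<le> L"
  defines "\<beta> \<equiv> weight (A + stepsize A L) L * extrapolation A L"
  shows "0 \<le> \<beta>" "\<beta> \<le> 1"
    "weight A L \<le> 1 / 10 \<Longrightarrow> weight (A + stepsize A L) L \<le> 1 / 10 \<Longrightarrow> 3 / 4 \<le> \<beta>"
proof -
  define A' where "A' = A + stepsize A L"
  define t where "t = weight A L"
  define t3 where "t3 = weight A' L"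
  define e where "e = \<mu> + 1 / A"
  define e' where "e' = \<mu> + 1 / A'"
  have A': "0 < A'" using A stepsize_pos[of A L] L by (simp add: A'_def)
  have t: "0 < t" "t < 1" "0 < t3" "t3 < 1" using weight_pos weight_less A A' L by (auto simp: t_def t3_def)
  have e: "0 < e" "0 < e'" "e' \<le> e" "e * (1 - t) \<le> e'"
  proof -
    show "0 < e" "0 < e'" using A A' mu by (auto simp: e_def e'_def add_pos_pos)
    show "e' \<le> e" using A stepsize_pos[of A L] L by (auto simp: e_def e'_def A'_def frac_le)
    show "e * (1 - t) \<le> e'" unfolding e'_def A'_def inverse_next[OF A L] using mu t by (simp add: e_def t_def)
  qed
  have eq: "(L - \<mu>) * t\<^sup>2 = e * (1 - t)" "(L - \<mu>) * t3\<^sup>2 = e' * (1 - t3)"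
    unfolding t_def t3_def e_def e'_def using weight_eq A A' L by auto
  have k: "0 < L - \<mu>" using L mu by simp
  have b: "\<beta> = t3 * ((1 - t) / t * ((1 - t) * e / e'))"
    unfolding \<beta>_def extrapolation_eq[OF A L] t_def e_def e'_def A'_def t3_def ..
  show b0: "0 \<le> \<beta>" unfolding b using t e by simp
  have t32: "t3\<^sup>2 = e' * (1 - t3) / (L - \<mu>)" and t2: "t\<^sup>2 = e * (1 - t) / (L - \<mu>)"
    using eq k by (simp_all add: field_simps)
  have "\<beta>\<^sup>2 = t3\<^sup>2 * (1 - t) ^ 4 * e\<^sup>2 / (t\<^sup>2 * e'\<^sup>2)"
    unfolding b by (simp add: power_mult_distrib power_divide)
  also have "\<dots> = (1 - t3) * (1 - t) ^ 2 * (e * (1 - t) / e')"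
  proof -
    have "t3\<^sup>2 * (1 - t) ^ 4 * e\<^sup>2 * e' = (1 - t3) * (1 - t) ^ 2 * (e * (1 - t)) * (t\<^sup>2 * e'\<^sup>2)"
      unfolding t32 t2 by (simp add: power2_eq_square power4_eq_xxxx)
    then show ?thesis using t e by (simp add: field_simps)
  qed
  finally have sq: "\<beta>\<^sup>2 = (1 - t3) * (1 - t) ^ 2 * (e * (1 - t) / e')" .
  also have "\<dots> \<le> 1 * 1 * 1" using t e by (intro mult_mono power_le_one) auto
  finally have "\<beta>\<^sup>2 \<le> 1\<^sup>2" by simp
  then show "\<beta> \<le> 1" by (rule power2_le_imp_le) simp
  assume small: "weight A L \<le> 1 / 10" "weight (A + stepsize A L) L \<le> 1 / 10"
  have "(3 / 4)\<^sup>2 \<le> (9 / 10) * (9 / 10) ^ 2 * (9 / 10 :: real)" by (simp add: power2_eq_square)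
  also have "\<dots> \<le> (1 - t3) * (1 - t) ^ 2 * (e * (1 - t) / e')"
  proof (intro mult_mono power_mono)
    have "9 / 10 * e' \<le> (1 - t) * e" using small e t by (intro mult_mono) (auto simp: t_def)
    then show "9 / 10 \<le> e * (1 - t) / e'" using e by (simp add: field_simps)
  qed (use small t e in \<open>auto simp: t_def t3_def A'_def\<close>)
  also have "\<dots> = \<beta>\<^sup>2" using sq by simp
  finally show "3 / 4 \<le> \<beta>" by (rule power2_le_imp_le) (rule b0)
qed

end

text \<open>
  From time \<open>N\<close> on, accepted steps have length at least \<open>\<eta> / L\<close> and rejected ones are shorter than \<open>\<epsilon> / L\<close>.  The gradient
  at \<open>z\<close> is almost \<open>- c z / \<bar>z\<bar>\<close> near the point \<open>p\<close> of the sphere, which will be a limit point of rejected trials.  The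
  factor \<open>100\<close> between \<open>\<eta>\<close> and \<open>\<epsilon>\<close> leaves room for the constants below.
\<close>

locale fista_run_near = fista_run_pos +
  fixes p :: 'a and c \<eta> \<epsilon> \<delta> :: real and N :: nat
  assumes c: "0 \<le> c" and eps: "0 < \<epsilon>" "\<eta> = 100 * \<epsilon>" and delta: "\<delta> \<le> 1 / 2" and p: "norm p = 1"
    and near_D: "\<And>z. z \<in> E \<Longrightarrow> norm (z - p) < \<delta> \<Longrightarrow> norm (D z + (c / norm z) *\<^sub>R z) \<le> \<epsilon>"
    and N_force: "\<And>n. N \<le> n \<Longrightarrow> acc n \<Longrightarrow> \<eta> \<le> Ls n * norm (ws n - zs n)"
    and N_rej: "\<And>n. N \<le> n \<Longrightarrow> \<not> acc n \<Longrightarrow> 1 < norm (zs n) \<and> Ls n * norm (ws n - zs n) < \<epsilon>"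
    and N_q: "\<And>n. N \<le> n \<Longrightarrow> ts n * q n < \<delta> / 2"
    and N_A: "\<And>n. N \<le> n \<Longrightarrow> \<alpha> \<le> As n"
    and N_t: "\<And>n. N \<le> n \<Longrightarrow> ts n < 1 / 10"
    and N_L: "\<And>n. N \<le> n \<Longrightarrow> 5 \<le> Ls n"
begin

abbreviation close :: "nat \<Rightarrow> bool" where "close n \<equiv> norm (ys n - p) < \<delta> / 2"

text \<open>The iterate \<open>ys n\<close> is on the sphere and does not move inwards.\<close>

definition on_sphere :: "nat \<Rightarrow> bool" where
  "on_sphere n \<longleftrightarrow> norm (ys n) = 1 \<and> 0 \<le> ys n \<bullet> (xs n - ys n)"

lemma A_pos: "N \<le> n \<Longrightarrow> 0 < As n"
  using N_A[of n] alpha by simp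

lemma t_bounds: "N \<le> n \<Longrightarrow> 0 < ts n \<and> ts n < 1"
  using weight_sqrt_bound[OF alpha N_A] by blast

lemma L_pos: "0 < Ls n"
  using L_ge[of n] by simp

lemma z_near:
  assumes "N \<le> n" "close n"
  shows "norm (zs n - p) < \<delta>" "zs n \<noteq> 0"
proof -
  have "norm (zs n - ys n) = ts n * q n" using t_bounds[OF assms(1)] by (simp add: z_eq q_def)
  then show 1: "norm (zs n - p) < \<delta>"
    using norm_triangle_ineq[of "zs n - ys n" "ys n - p"] N_q[OF assms(1)] assms(2) by simp
  show "zs n \<noteq> 0" using 1 delta p by auto
qed

lemma accepted_off_sphere:
  assumes "N \<le> n" "close n" "acc n"
  shows "\<eta> / (4 * Ls n) \<le> \<bar>norm (zs n) - 1\<bar>"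
proof -
  have "Ls n * norm (ws n - zs n) \<le> 2 * Ls n * \<bar>norm (zs n) - 1\<bar> + \<epsilon>"
    unfolding ws_def
    by (rule prox_near_sphere_dist[OF L_pos z_near(2)[OF assms(1,2)] c near_D[OF z_in z_near(1)[OF assms(1,2)]]])
  then have "\<eta> / 2 \<le> 2 * Ls n * \<bar>norm (zs n) - 1\<bar>" using N_force[OF assms(1,3)] eps by simp
  then show ?thesis using L_pos[of n] by (simp add: field_simps)
qed

lemma rejected_outside:
  assumes "N \<le> n" "\<not> acc n"
  shows "1 < norm (zs n)" "Ls n * (norm (zs n) - 1) < \<epsilon>"
proof -
  show "1 < norm (zs n)" using N_rej[OF assms] by simp
  have "norm (zs n) - 1 \<le> norm (ws n - zs n)"
    using norm_triangle_ineq2[of "zs n" "ws n"] w_ball[of n] by (simp add: norm_minus_commute)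
  then have "Ls n * (norm (zs n) - 1) \<le> Ls n * norm (ws n - zs n)" using L_pos[of n] by simp
  then show "Ls n * (norm (zs n) - 1) < \<epsilon>" using N_rej[OF assms] by linarith
qed

lemma w_on_sphere:
  assumes "N \<le> n" "close n" "1 + \<epsilon> / Ls n \<le> norm (zs n)"
  shows "norm (ws n) = 1"
  unfolding ws_def
proof (rule prox_near_sphere_norm[OF L_pos z_near(2)[OF assms(1,2)] c near_D[OF z_in z_near(1)[OF assms(1,2)]]])
  have "(\<epsilon> - c) / Ls n \<le> \<epsilon> / Ls n" using c L_pos[of n] by (simp add: divide_right_mono)
  then show "1 + (\<epsilon> - c) / Ls n \<le> norm (zs n)" using assms(3) by linarith
qed

lemma norm_z_square:
  "(norm (zs n))\<^sup>2 = (norm (ys n))\<^sup>2 + 2 * ts n * (ys n \<bullet> (xs n - ys n)) + (ts n)\<^sup>2 * (q n)\<^sup>2"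
proof -
  define d where "d = xs n - ys n"
  have "(norm (zs n))\<^sup>2 = (ys n + ts n *\<^sub>R d) \<bullet> (ys n + ts n *\<^sub>R d)"
    unfolding d_def z_eq[symmetric] by (rule power2_norm_eq_inner)
  also have "\<dots> = ys n \<bullet> ys n + 2 * ts n * (ys n \<bullet> d) + (ts n)\<^sup>2 * (d \<bullet> d)"
    by (simp add: inner_add_left inner_add_right inner_commute[of d "ys n"] power2_eq_square algebra_simps)
  finally show ?thesis unfolding q_def d_def power2_norm_eq_inner .
qed

lemma z_outside:
  assumes "N \<le> n" "on_sphere n"
  shows "1 \<le> norm (zs n)"
proof -
  have "1 \<le> (norm (zs n))\<^sup>2"
    unfolding norm_z_square using assms(2) t_bounds[OF assms(1)] by (simp add: on_sphere_def)
  then show ?thesis using power2_le_imp_le[of 1 "norm (zs n)"] by simp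
qed

lemma on_sphere_step:
  assumes n: "N \<le> n" and a: "acc n" and w: "norm (ws n) = 1"
  shows "on_sphere (Suc n)"
proof -
  have "ws n \<bullet> ys n \<le> 1" using norm_cauchy_schwarz[of "ws n" "ys n"] w y_ball[of n] by simp
  then have "0 \<le> ws n \<bullet> (ws n - ys n)" using w by (simp add: inner_diff_right norm_eq_1)
  moreover have "0 \<le> extrapolation (As n) (Ls n)" by (rule extrapolation_nonneg[OF A_pos[OF n] L_ge])
  ultimately show ?thesis
    using acc_x[OF a] acc_y[OF a] w by (simp add: on_sphere_def)
qed

lemma z_segment:
  assumes n: "N \<le> n" and r: "\<not> acc n"
  shows "ts (Suc n) < ts n" "zs (Suc n) = ys n + ts (Suc n) *\<^sub>R (xs n - ys n)"
proof -
  show "ts (Suc n) < ts n"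
    using weight_decreasing[OF A_pos[OF n] L_ge[of n], of "2 * Ls n"] rej[OF r] L_pos[of n] by (simp add: ts_def)
  show "zs (Suc n) = ys n + ts (Suc n) *\<^sub>R (xs n - ys n)" using z_eq[of "Suc n"] rej[OF r] by simp
qed

text \<open>A trial that is rejected at such a point would be followed by trials in the same direction, ever closer to the
  sphere: too close to be accepted, so that the search would not end.\<close>

lemma on_sphere_accepted:
  assumes n: "N \<le> n" and s: "on_sphere n" and cl: "close n"
  shows "acc n"
proof (rule ccontr)
  assume r: "\<not> acc n"
  have all: "\<not> acc (n + j) \<and> ys (n + j) = ys n \<and> xs (n + j) = xs n" for j
  proof (induction j)
    case (Suc j)
    define m where "m = n + j"
    have m: "N \<le> m" "\<not> acc m" "ys m = ys n" "xs m = xs n" using Suc n by (auto simp: m_def)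
    have same: "ys (Suc m) = ys n" "xs (Suc m) = xs n" "Ls (Suc m) = 2 * Ls m" using rej[OF m(2)] m by auto
    have s': "on_sphere m" "on_sphere (Suc m)" using s m same by (auto simp: on_sphere_def)
    have "\<not> acc (Suc m)"
    proof
      assume "acc (Suc m)"
      then have off: "\<eta> / (4 * Ls (Suc m)) \<le> \<bar>norm (zs (Suc m)) - 1\<bar>"
        using accepted_off_sphere[of "Suc m"] m same cl by simp
      have "1 \<le> norm (zs (Suc m))" using z_outside[OF _ s'(2)] m by simp
      moreover have "(norm (zs (Suc m)))\<^sup>2 \<le> (norm (zs m))\<^sup>2"
      proof -
        have t: "0 \<le> ts (Suc m)" "ts (Suc m) \<le> ts m"
          using t_bounds[of "Suc m"] z_segment(1)[OF m(1,2)] m by auto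
        have "2 * ts (Suc m) * (ys n \<bullet> (xs n - ys n)) \<le> 2 * ts m * (ys n \<bullet> (xs n - ys n))"
          using t s by (intro mult_right_mono) (auto simp: on_sphere_def)
        moreover have "(ts (Suc m))\<^sup>2 * (q n)\<^sup>2 \<le> (ts m)\<^sup>2 * (q n)\<^sup>2"
          using t by (intro mult_right_mono power_mono) auto
        ultimately show ?thesis unfolding norm_z_square q_def using same m by (simp add: q_def)
      qed
      then have "norm (zs (Suc m)) \<le> norm (zs m)" by (rule power2_le_imp_le) simp
      then have "Ls m * (norm (zs (Suc m)) - 1) \<le> Ls m * (norm (zs m) - 1)" using L_pos[of m] by simp
      then have "Ls m * (norm (zs (Suc m)) - 1) < \<epsilon>" using rejected_outside(2)[OF m(1,2)] by linarith
      ultimately show False using off eps L_pos[of m] same by (simp add: field_simps)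
    qed
    then show ?case using same by (simp add: m_def)
  qed (use r in simp)
  obtain j where "n \<le> j" "acc j" using infinitely_many_accepted by blast
  then show False using all[of "j - n"] by simp
qed

lemma on_sphere_Suc:
  assumes n: "N \<le> n" and s: "on_sphere n" and cl: "close n"
  shows "on_sphere (Suc n)"
proof -
  have a: "acc n" by (rule on_sphere_accepted[OF n s cl])
  have "\<epsilon> / Ls n \<le> \<eta> / (4 * Ls n)" using eps L_pos[of n] by (simp add: field_simps)
  also have "\<dots> \<le> \<bar>norm (zs n) - 1\<bar>" by (rule accepted_off_sphere[OF n cl a])
  also have "\<dots> = norm (zs n) - 1" using z_outside[OF n s] by simp
  finally have "norm (ws n) = 1" using w_on_sphere[OF n cl] by simp
  then show ?thesis by (rule on_sphere_step[OF n a])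
qed

text \<open>
  After a rejected trial outside of the ball, an accepted trial with half the step size is inside.
  The next extrapolation goes further than the rejected one, hence ends outside the ball.
\<close>

lemma rejected_then_on_sphere:
  assumes n: "N \<le> n" and r: "\<not> acc n" and a: "acc (Suc n)" and cl: "close n" "close (Suc (Suc n))"
  shows "on_sphere (Suc (Suc (Suc n)))"
proof -
  define L where "L = Ls (Suc n)"
  define y where "y = ys n"
  define z where "z = zs n"
  define w where "w = zs (Suc n)"
  define y2 where "y2 = ys (Suc (Suc n))"
  define z3 where "z3 = zs (Suc (Suc n))"
  define t where "t = ts n"
  define t2 where "t2 = ts (Suc n)"
  define \<beta> where "\<beta> = ts (Suc (Suc n)) * extrapolation (As (Suc n)) L"
  have Ns: "N \<le> Suc n" "N \<le> Suc (Suc n)" using n by auto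
  have same: "ys (Suc n) = y" "xs (Suc n) = xs n" "As (Suc n) = As n" "L = 2 * Ls n"
    using rej[OF r] by (auto simp: y_def L_def)
  have L: "0 < L" by (simp add: L_def L_pos)
  have L2: "Ls (Suc (Suc n)) = L" by (simp add: L_def acc_L[OF a])
  have out: "1 < norm z" "L * (norm z - 1) < 2 * \<epsilon>"
    using rejected_outside[OF n r] same(4) by (auto simp: z_def)
  have t: "0 < t2" "t2 < t" "t \<le> 3 / 2 * t2"
  proof -
    show "0 < t2" using t_bounds[OF Ns(1)] by (simp add: t2_def)
    show "t2 < t" unfolding t_def t2_def by (rule z_segment(1)[OF n r])
    show "t \<le> 3 / 2 * t2"
      using weight_double[OF A_pos[OF n] N_L[OF n]] same by (simp add: t_def t2_def ts_def L_def)
  qed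
  have zy: "z - y = t *\<^sub>R (xs n - ys n)" by (simp add: z_def y_def t_def z_eq)
  have wy: "w - y = t2 *\<^sub>R (xs n - ys n)" by (simp add: w_def y_def t2_def z_segment(2)[OF n r])
  define \<rho> where "\<rho> = t / t2 - 1"
  have \<rho>: "0 < \<rho>" "\<rho> \<le> 1 / 2" using t by (auto simp: \<rho>_def field_simps)
  have zw: "z - w = \<rho> *\<^sub>R (w - y)"
  proof -
    have "z - y = (t / t2) *\<^sub>R (w - y)" unfolding zy wy using t by simp
    then show ?thesis by (simp add: \<rho>_def scaleR_diff_left algebra_simps)
  qed
  \<comment> \<open>the accepted trial is inside the ball\<close>
  have inside: "norm w \<le> 1 - \<eta> / (4 * L)"
  proof -
    have "w = (1 - t2 / t) *\<^sub>R y + (t2 / t) *\<^sub>R z"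
    proof -
      have "(t2 / t) *\<^sub>R (z - y) = w - y" unfolding zy wy using t by simp
      then show ?thesis by (simp add: algebra_simps)
    qed
    then have "norm w \<le> (1 - t2 / t) * norm y + (t2 / t) * norm z"
      using norm_triangle_ineq[of "(1 - t2 / t) *\<^sub>R y" "(t2 / t) *\<^sub>R z"] t by simp
    also have "\<dots> \<le> (1 - t2 / t) * norm z + (t2 / t) * norm z"
      using out y_ball[of n] t by (intro add_mono mult_left_mono) (auto simp: y_def)
    finally have "norm w \<le> norm z" by (simp add: algebra_simps)
    then have "L * (norm w - 1) \<le> L * (norm z - 1)" using L by simp
    then have "L * (norm w - 1) < \<eta> / 4" using out eps by linarith
    then have "norm w - 1 < \<eta> / (4 * L)" using L by (simp add: field_simps)
    moreover have "\<eta> / (4 * L) \<le> \<bar>norm w - 1\<bar>"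
      using accepted_off_sphere[OF Ns(1) _ a] cl(1) same by (simp add: w_def L_def y_def)
    ultimately show ?thesis by linarith
  qed
  \<comment> \<open>distances are measured in the direction \<open>\<nu>\<close> of the rejected point\<close>
  define \<nu> where "\<nu> = (1 / norm z) *\<^sub>R z"
  have \<nu>: "norm \<nu> = 1" "\<nu> \<bullet> z = norm z"
    using out by (auto simp: \<nu>_def power2_eq_square simp flip: power2_norm_eq_inner)
  have \<nu>le: "\<nu> \<bullet> u \<le> norm u" for u using norm_cauchy_schwarz[of \<nu> u] \<nu> by simp
  have gap: "\<eta> / (4 * L) \<le> \<rho> * (\<nu> \<bullet> (w - y))"
  proof -
    have "\<rho> * (\<nu> \<bullet> (w - y)) = \<nu> \<bullet> (z - w)" unfolding zw by simp
    also have "\<dots> \<ge> norm z - norm w" using \<nu>le[of w] \<nu> by (simp add: inner_diff_right)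
    finally show ?thesis using out inside by linarith
  qed
  then have gap0: "0 < \<nu> \<bullet> (w - y)"
  proof -
    have "0 < \<eta> / (4 * L)" using eps L by simp
    then have "0 < \<rho> * (\<nu> \<bullet> (w - y))" using gap by linarith
    then show ?thesis using \<rho>(1) by (simp only: zero_less_mult_pos)
  qed
  have w0: "0 \<le> \<nu> \<bullet> w"
  proof -
    have d: "norm (zs n - p) < \<delta>" "norm (zs (Suc n) - p) < \<delta>"
      using z_near(1)[OF n cl(1)] z_near(1)[OF Ns(1)] cl(1) same by (auto simp: y_def)
    have "norm (z - w) \<le> norm (z - p) + norm (w - p)" using norm_triangle_ineq4[of "z - p" "w - p"] by simp
    then have "norm (z - w) < 1" using d delta by (simp add: z_def w_def)
    then have "\<nu> \<bullet> (z - w) < 1" using \<nu>le[of "z - w"] by linarith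
    then show ?thesis using \<nu> out by (simp add: inner_diff_right)
  qed
  have y2: "\<nu> \<bullet> w - \<epsilon> / L \<le> \<nu> \<bullet> y2"
  proof -
    define k where "k = 1 + c / (L * norm w)"
    have nw: "w \<noteq> 0" using z_near(2)[OF Ns(1)] cl(1) same by (simp add: w_def y_def)
    have k: "1 \<le> k" using c L by (simp add: k_def)
    have y2_eq: "y2 = ball_proj (w - (1 / L) *\<^sub>R D w)"
      by (simp add: y2_def acc_y[OF a] ws_def prox_def w_def L_def)
    have Dw: "norm (D w + (c / norm w) *\<^sub>R w) \<le> \<epsilon>"
      using near_D[OF z_in z_near(1)[OF Ns(1)]] cl(1) same by (simp add: w_def y_def)
    obtain s where s: "1 \<le> s" "ball_proj (k *\<^sub>R w) = s *\<^sub>R w"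
    proof (cases "norm (k *\<^sub>R w) \<le> 1")
      case True
      then show ?thesis using that[of k] k by (simp add: ball_proj_def)
    next
      case False
      have "0 < \<eta> / (4 * L)" using eps L by simp
      then have "norm w \<le> 1" using inside by linarith
      then have "1 \<le> 1 / norm w" using nw by (simp add: field_simps)
      moreover have "ball_proj (k *\<^sub>R w) = (1 / norm w) *\<^sub>R w" using False k by (simp add: ball_proj_def)
      ultimately show ?thesis using that by blast
    qed
    have "norm (y2 - s *\<^sub>R w) \<le> norm (w - (1 / L) *\<^sub>R D w - k *\<^sub>R w)"
      unfolding y2_eq s(2)[symmetric] by (rule ball_proj_nonexpansive)
    also have "w - (1 / L) *\<^sub>R D w - k *\<^sub>R w = - ((1 / L) *\<^sub>R (D w + (c / norm w) *\<^sub>R w))"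
      by (simp add: k_def algebra_simps)
    also have "norm \<dots> \<le> \<epsilon> / L" using Dw L by (simp add: divide_right_mono)
    finally have "norm (s *\<^sub>R w - y2) \<le> \<epsilon> / L" by (simp add: norm_minus_commute)
    then have "\<nu> \<bullet> (s *\<^sub>R w - y2) \<le> \<epsilon> / L" using \<nu>le[of "s *\<^sub>R w - y2"] by linarith
    moreover have "\<nu> \<bullet> w \<le> s * (\<nu> \<bullet> w)" using mult_right_mono[OF s(1) w0] by simp
    ultimately show ?thesis by (simp add: inner_diff_right)
  qed
  have z3: "z3 = y2 + \<beta> *\<^sub>R (y2 - y)"
  proof -
    have "xs (Suc (Suc n)) - y2 = extrapolation (As (Suc n)) L *\<^sub>R (y2 - y)"
      using acc_x[OF a] acc_y[OF a] same by (simp add: y2_def L_def)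
    then show ?thesis using z_eq[of "Suc (Suc n)"] by (simp add: z3_def \<beta>_def y2_def)
  qed
  have \<beta>: "\<beta> \<le> 1" "3 / 4 \<le> \<beta>"
    using momentum_bounds[OF A_pos[OF Ns(1)] L_ge[of "Suc n"]] N_t[OF Ns(1)] N_t[OF Ns(2)] L2
    by (auto simp: \<beta>_def L_def ts_def acc_A[OF a])
  have far: "1 + \<eta> / (20 * L) \<le> norm z3"
  proof -
    have "(1 + \<beta>) * (\<nu> \<bullet> w - \<epsilon> / L) \<le> (1 + \<beta>) * (\<nu> \<bullet> y2)" using y2 \<beta> by (intro mult_left_mono) auto
    moreover have "(1 + \<beta>) * (\<epsilon> / L) \<le> 2 * (\<epsilon> / L)" using \<beta> eps L by (intro mult_right_mono) auto
    moreover have "\<nu> \<bullet> z3 = (1 + \<beta>) * (\<nu> \<bullet> y2) - \<beta> * (\<nu> \<bullet> y)"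
      by (simp add: z3 inner_add_right inner_diff_right algebra_simps)
    moreover have "(1 + \<beta>) * (\<nu> \<bullet> w - \<epsilon> / L) - \<beta> * (\<nu> \<bullet> y) = \<nu> \<bullet> w + \<beta> * (\<nu> \<bullet> (w - y)) - (1 + \<beta>) * (\<epsilon> / L)"
      by (simp add: inner_diff_right algebra_simps)
    moreover have "\<nu> \<bullet> w = norm z - \<rho> * (\<nu> \<bullet> (w - y))"
    proof -
      have "\<nu> \<bullet> (z - w) = \<rho> * (\<nu> \<bullet> (w - y))" unfolding zw by simp
      then show ?thesis using \<nu> by (simp add: inner_diff_right)
    qed
    moreover have "(3 / 2 * \<rho>) * (\<nu> \<bullet> (w - y)) \<le> \<beta> * (\<nu> \<bullet> (w - y))"
      using \<beta> \<rho> gap0 by (intro mult_right_mono) auto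
    moreover have "(3 / 2 * \<rho>) * (\<nu> \<bullet> (w - y)) = 3 / 2 * (\<rho> * (\<nu> \<bullet> (w - y)))" by simp
    moreover have "\<eta> / (4 * L) = 25 * (\<epsilon> / L)" "\<eta> / (20 * L) = 5 * (\<epsilon> / L)" "0 < \<epsilon> / L"
      using eps L by auto
    ultimately show ?thesis using gap \<nu>le[of z3] out(1) by linarith
  qed
  have a2: "acc (Suc (Suc n))"
  proof (rule ccontr)
    assume "\<not> ?thesis"
    then have "L * (norm z3 - 1) < \<epsilon>" using rejected_outside(2)[OF Ns(2)] L2 by (simp add: z3_def)
    moreover have "L * (\<eta> / (20 * L)) \<le> L * (norm z3 - 1)" using far L by (intro mult_left_mono) auto
    ultimately show False using eps L by simp
  qed
  have "1 + \<epsilon> / Ls (Suc (Suc n)) \<le> norm (zs (Suc (Suc n)))"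
  proof -
    have "\<epsilon> / L \<le> \<eta> / (20 * L)" using eps L by (simp add: field_simps)
    then show ?thesis using far by (simp add: L2 z3_def)
  qed
  then show ?thesis by (intro on_sphere_step[OF Ns(2) a2] w_on_sphere[OF Ns(2) cl(2)])
qed

end

section \<open>Every ADAP-FISTA call ends\<close>

context fista_run_pos
begin

lemma z_y_tendsto: "(\<lambda>n. zs n - ys n) \<longlonglongrightarrow> 0"
proof -
  obtain l where "q \<longlonglongrightarrow> l" using q_convergent by (auto simp: convergent_def)
  with t_tendsto have "(\<lambda>n. ts n * q n) \<longlonglongrightarrow> 0 * l" by (rule tendsto_mult)
  then have "(\<lambda>n. ts n * q n) \<longlonglongrightarrow> 0" by simp
  moreover have "\<forall>\<^sub>F n in sequentially. norm (zs n - ys n) \<le> ts n * q n"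
    using alpha_le by eventually_elim (use weight_sqrt_bound(2)[OF alpha] in \<open>auto simp: z_eq q_def less_imp_le\<close>)
  ultimately show ?thesis by (rule Lim_null_comparison[rotated])
qed

lemma z_bounded: "\<forall>\<^sub>F n in sequentially. norm (zs n) \<le> 2"
proof -
  have "\<forall>\<^sub>F n in sequentially. norm (zs n - ys n) < 1"
    using order_tendstoD(2)[OF tendsto_norm_zero[OF z_y_tendsto]] by simp
  then show ?thesis
  proof eventually_elim
    case (elim n)
    then show ?case using norm_triangle_ineq[of "zs n - ys n" "ys n"] y_ball[of n] by simp
  qed
qed

lemma y_step_tendsto:
  assumes "q \<longlonglongrightarrow> l"
  shows "(\<lambda>n. ys (Suc n) - ys n) \<longlonglongrightarrow> 0"
proof -
  obtain K where K: "0 \<le> K" "\<forall>\<^sub>F n in sequentially. acc n \<longrightarrow>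
     q (Suc n) \<le> q n + K * ts n \<and> norm (ys (Suc n) - ys n) \<le> ts n * q n + K * (ts n)\<^sup>2"
    by (rule step_bounds)
  have "(\<lambda>n. ts n * q n + K * (ts n)\<^sup>2) \<longlonglongrightarrow> 0 * l + K * 0\<^sup>2" by (intro tendsto_intros t_tendsto assms)
  then have "(\<lambda>n. ts n * q n + K * (ts n)\<^sup>2) \<longlonglongrightarrow> 0" by simp
  moreover have "\<forall>\<^sub>F n in sequentially. norm (ys (Suc n) - ys n) \<le> ts n * q n + K * (ts n)\<^sup>2"
    using K(2) alpha_le
  proof eventually_elim
    case (elim n)
    have "0 \<le> ts n * q n + K * (ts n)\<^sup>2"
      using K(1) weight_sqrt_bound(2)[OF alpha elim(2)] q_nonneg[of n] by simp
    then show ?case using elim rej[of n] by (cases "acc n") auto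
  qed
  ultimately show ?thesis by (rule Lim_null_comparison[rotated])
qed

lemma turning_points: "infinite {n. \<not> acc n \<and> acc (Suc n)}"
  unfolding infinite_nat_iff_unbounded_le
proof
  fix N
  obtain n where n: "N \<le> n" "\<not> acc n" using infinitely_many_rejected by blast
  obtain m where m: "n \<le> m" "acc m" using infinitely_many_accepted by blast
  have "\<exists>k\<ge>n. \<not> acc k \<and> acc (Suc k)"
  proof (rule ccontr)
    assume *: "\<not> ?thesis"
    have "\<not> acc k" if "n \<le> k" for k using that by (induction rule: dec_induct) (use n * in auto)
    then show False using m by blast
  qed
  then show "\<exists>k\<ge>N. k \<in> {n. \<not> acc n \<and> acc (Suc n)}" using n(1) le_trans by blast
qed

text \<open>A limit point of rejected trials is a stationary point on the unit sphere.\<close>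

lemma limit_point:
  obtains r p where "strict_mono r" "\<And>k. \<not> acc (r k) \<and> acc (Suc (r k))" "(\<lambda>k. ys (r k)) \<longlonglongrightarrow> p"
    "p \<in> E" "norm p = 1" "D p = - (norm (D p) *\<^sub>R p)"
proof -
  obtain r0 :: "nat \<Rightarrow> nat" where r0: "strict_mono r0" "\<forall>k. r0 k \<in> {n. \<not> acc n \<and> acc (Suc n)}"
    using infinite_enumerate[OF turning_points] by (elim exE conjE)
  have "seq_compact (E \<inter> cball 0 1)" by (intro compact_imp_seq_compact compact_ball)
  moreover have "\<forall>k. (ys \<circ> r0) k \<in> E \<inter> cball 0 1" using y_in y_ball by simp
  ultimately obtain p r1 where p: "p \<in> E \<inter> cball 0 1" and r1: "strict_mono r1" "((ys \<circ> r0) \<circ> r1) \<longlonglongrightarrow> p"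
    by (rule seq_compactE)
  define r where "r = r0 \<circ> r1"
  have r: "strict_mono r" unfolding r_def by (rule strict_mono_o[OF r0(1) r1(1)])
  have rr: "\<not> acc (r k)" "acc (Suc (r k))" for k using r0(2)[THEN spec, of "r1 k"] by (auto simp: r_def)
  have y: "(\<lambda>k. ys (r k)) \<longlonglongrightarrow> p" using r1(2) by (simp add: r_def o_def)
  have seq: "filterlim r sequentially sequentially" by (rule filterlim_subseq[OF r])
  have "(\<lambda>k. zs (r k) - ys (r k)) \<longlonglongrightarrow> 0" by (rule filterlim_compose[OF z_y_tendsto seq])
  from tendsto_add[OF this y] have z: "(\<lambda>k. zs (r k)) \<longlonglongrightarrow> p" by simp
  have out: "\<forall>\<^sub>F k in sequentially. 1 < norm (zs (r k)) \<and> Ls (r k) * norm (ws (r k) - zs (r k)) < e" if "0 < e" for e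
    using eventually_compose_filterlim[OF rejected_eventually[OF that] seq] eventually_compose_filterlim[OF z_bounded seq]
    by eventually_elim (use rr in auto)
  have "1 \<le> norm p"
    by (rule tendsto_lowerbound[OF tendsto_norm[OF z]]) (use out[OF zero_less_one] in \<open>auto elim: eventually_mono\<close>)
  then have np: "norm p = 1" using p by simp
  have g: "(\<lambda>k. Ls (r k) *\<^sub>R (ws (r k) - zs (r k))) \<longlonglongrightarrow> 0"
  proof (rule tendstoI)
    fix e :: real assume "0 < e"
    from out[OF this] show "\<forall>\<^sub>F k in sequentially. dist (Ls (r k) *\<^sub>R (ws (r k) - zs (r k))) 0 < e"
      by eventually_elim (use L_ge in \<open>auto simp: abs_of_nonneg order_trans[OF zero_le_one]\<close>)
  qed
  have wz: "(\<lambda>k. ws (r k) - zs (r k)) \<longlonglongrightarrow> 0"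
  proof (rule Lim_null_comparison[OF _ tendsto_norm_zero[OF g]])
    have "norm (ws (r k) - zs (r k)) \<le> norm (Ls (r k) *\<^sub>R (ws (r k) - zs (r k)))" for k
      using mult_right_mono[OF L_ge[of "r k"] norm_ge_zero[of "ws (r k) - zs (r k)"]] L_ge[of "r k"] by simp
    then show "\<forall>\<^sub>F k in sequentially. norm (ws (r k) - zs (r k)) \<le> norm (Ls (r k) *\<^sub>R (ws (r k) - zs (r k)))" by simp
  qed
  from tendsto_add[OF wz z] have w: "(\<lambda>k. ws (r k)) \<longlonglongrightarrow> p" by simp
  have Dz: "(\<lambda>k. D (zs (r k))) \<longlonglongrightarrow> D p"
    by (rule continuous_on_tendsto_compose[OF continuous_D z]) (use p z_in in auto)
  have stat: "0 \<le> D p \<bullet> (u - p)" if "norm u \<le> 1" for u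
  proof (rule tendsto_lowerbound)
    show "(\<lambda>k. (D (zs (r k)) + Ls (r k) *\<^sub>R (ws (r k) - zs (r k))) \<bullet> (u - ws (r k))) \<longlonglongrightarrow> D p \<bullet> (u - p)"
      using tendsto_inner[OF tendsto_add[OF Dz g] tendsto_diff[OF tendsto_const w]] by simp
    have "0 \<le> (D (zs n) + Ls n *\<^sub>R (ws n - zs n)) \<bullet> (u - ws n)" for n
      unfolding ws_def by (rule prox_inner_ge) (use L_ge[of n] that in auto)
    then show "\<forall>\<^sub>F k in sequentially. 0 \<le> (D (zs (r k)) + Ls (r k) *\<^sub>R (ws (r k) - zs (r k))) \<bullet> (u - ws (r k))" by simp
  qed simp
  define c where "c = norm (D p)"
  have "D p = - (c *\<^sub>R p)"
  proof (cases "D p = 0")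
    case False
    then have c: "0 < c" by (simp add: c_def)
    have "0 \<le> D p \<bullet> (- (1 / c) *\<^sub>R D p - p)" by (rule stat) (use False in \<open>simp add: c_def\<close>)
    also have "\<dots> = - (1 / c) * (D p \<bullet> D p) - D p \<bullet> p" by (simp add: inner_diff_right)
    also have "D p \<bullet> D p = c * c" by (simp add: c_def power2_eq_square flip: power2_norm_eq_inner)
    finally have "D p \<bullet> p \<le> - c" using c by simp
    then have le: "2 * c * (D p \<bullet> p) \<le> 2 * c * (- c)" using c by (intro mult_left_mono) auto
    have pp: "p \<bullet> p = 1" using np by (simp add: norm_eq_1)
    have "(D p + c *\<^sub>R p) \<bullet> (D p + c *\<^sub>R p) = D p \<bullet> D p + 2 * c * (D p \<bullet> p) + c * c * (p \<bullet> p)"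
      by (simp add: inner_add_left inner_add_right inner_commute[of p "D p"] distrib_left)
    also have "\<dots> \<le> 0" using le pp \<open>D p \<bullet> D p = c * c\<close> by simp
    finally have "D p + c *\<^sub>R p = 0" using inner_ge_zero[of "D p + c *\<^sub>R p"] inner_eq_zero_iff by fastforce
    then show ?thesis by (simp add: eq_neg_iff_add_eq_0)
  qed (simp add: c_def)
  then show ?thesis using that[OF r _ y _ np] rr p by (simp add: c_def)
qed

text \<open>
  Either the iterates converge to \<open>p\<close>; then they stay on the sphere and no further trial is rejected.
  Or the velocity tends to \<open>0\<close>; then consecutive iterates on the sphere are so close that the
  extrapolated point is too close to the sphere for a step that does not stop the method.
\<close>

lemma impossible: False
proof -
  obtain r p where r: "strict_mono r" and rr: "\<And>k. \<not> acc (r k) \<and> acc (Suc (r k))"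
    and y: "(\<lambda>k. ys (r k)) \<longlonglongrightarrow> p" and p: "p \<in> E" "norm p = 1" and Dp: "D p = - (norm (D p) *\<^sub>R p)"
    by (rule limit_point) blast
  define c where "c = norm (D p)"
  obtain \<eta> where \<eta>: "0 < \<eta>" "\<forall>\<^sub>F n in sequentially. acc n \<longrightarrow> \<eta> \<le> Ls n * norm (ws n - zs n)"
    by (rule accepted_force)
  define \<epsilon> where "\<epsilon> = \<eta> / 100"
  have eps: "0 < \<epsilon>" "\<eta> = 100 * \<epsilon>" using \<eta>(1) by (auto simp: \<epsilon>_def)
  have seq: "filterlim r sequentially sequentially" by (rule filterlim_subseq[OF r])
  obtain \<delta> where \<delta>: "0 < \<delta>" "\<delta> \<le> 1 / 2" "\<And>z. z \<in> E \<Longrightarrow> norm (z - p) < \<delta> \<Longrightarrow> norm (D z + (c / norm z) *\<^sub>R z) \<le> \<epsilon>"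
  proof -
    have "((\<lambda>z. D z + (c / norm z) *\<^sub>R z) \<longlongrightarrow> D p + (c / norm p) *\<^sub>R p) (at p within E)"
      using continuous_D p by (intro tendsto_intros) (auto simp: continuous_on_def)
    moreover have Dp0: "D p + (c / norm p) *\<^sub>R p = 0"
    proof -
      have "D p + c *\<^sub>R p = 0" by (simp only: Dp[folded c_def] left_minus)
      then show ?thesis using p(2) by simp
    qed
    ultimately have "((\<lambda>z. D z + (c / norm z) *\<^sub>R z) \<longlongrightarrow> 0) (at p within E)" by simp
    then have "\<forall>\<^sub>F z in at p within E. norm (D z + (c / norm z) *\<^sub>R z) < \<epsilon>"
      by (rule order_tendstoD(2)[OF tendsto_norm_zero eps(1)])
    then obtain d where d: "0 < d" "\<And>z. z \<in> E \<Longrightarrow> z \<noteq> p \<Longrightarrow> dist z p < d \<Longrightarrow> norm (D z + (c / norm z) *\<^sub>R z) < \<epsilon>"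
      unfolding eventually_at by blast
    show ?thesis
    proof (rule that[of "min d (1 / 2)"])
      fix z assume "z \<in> E" "norm (z - p) < min d (1 / 2)"
      then show "norm (D z + (c / norm z) *\<^sub>R z) \<le> \<epsilon>"
        using d(2)[of z] Dp0 eps by (cases "z = p") (auto simp: dist_norm)
    qed (use d in auto)
  qed
  obtain l where l: "q \<longlonglongrightarrow> l" using q_convergent by (auto simp: convergent_def)
  have "(\<lambda>n. ts n * q n) \<longlonglongrightarrow> 0 * l" by (intro tendsto_intros t_tendsto l)
  then have tq: "\<forall>\<^sub>F n in sequentially. ts n * q n < \<delta> / 2"
    using order_tendstoD(2)[of "\<lambda>n. ts n * q n" 0 sequentially "\<delta> / 2"] \<delta>(1) by simp
  have rej': "\<forall>\<^sub>F n in sequentially. \<not> acc n \<longrightarrow> 1 < norm (zs n) \<and> Ls n * norm (ws n - zs n) < \<epsilon>"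
    using rejected_eventually[OF eps(1)] z_bounded by eventually_elim blast
  have t10: "\<forall>\<^sub>F n in sequentially. ts n < 1 / 10" by (rule t_small) simp
  have "\<forall>\<^sub>F n in sequentially. (acc n \<longrightarrow> \<eta> \<le> Ls n * norm (ws n - zs n)) \<and>
     (\<not> acc n \<longrightarrow> 1 < norm (zs n) \<and> Ls n * norm (ws n - zs n) < \<epsilon>) \<and>
     ts n * q n < \<delta> / 2 \<and> \<alpha> \<le> As n \<and> ts n < 1 / 10 \<and> 5 < Ls n"
    using \<eta>(2) rej' tq alpha_le t10 L_large[of 5] by eventually_elim auto
  then obtain N where N: "\<And>n. N \<le> n \<Longrightarrow> (acc n \<longrightarrow> \<eta> \<le> Ls n * norm (ws n - zs n)) \<and>
     (\<not> acc n \<longrightarrow> 1 < norm (zs n) \<and> Ls n * norm (ws n - zs n) < \<epsilon>) \<and>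
     ts n * q n < \<delta> / 2 \<and> \<alpha> \<le> As n \<and> ts n < 1 / 10 \<and> 5 < Ls n"
    unfolding eventually_sequentially by blast
  interpret near: fista_run_near E \<psi> D \<mu> \<sigma> chi x0 ys xs zs ws As Ls ts acc \<alpha> p c \<eta> \<epsilon> \<delta> N
    by unfold_locales (use N \<delta> eps p in \<open>auto simp: c_def less_imp_le\<close>)
  have y_close: "\<forall>\<^sub>F k in sequentially. norm (ys (r k) - p) < \<delta> / 4"
    using tendstoD[OF y, of "\<delta> / 4"] \<delta>(1) by (simp add: dist_norm)
  show False
  proof (cases "l = 0")
    case False
    obtain yl where yl: "ys \<longlonglongrightarrow> yl" by (rule y_convergent[OF l False])
    have "(\<lambda>k. ys (r k)) \<longlonglongrightarrow> yl" by (rule filterlim_compose[OF yl seq])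
    then have "yl = p" using y by (rule LIMSEQ_unique)
    then have "\<forall>\<^sub>F n in sequentially. near.close n"
      using tendstoD[OF yl, of "\<delta> / 2"] \<delta>(1) by (simp add: dist_norm)
    then obtain M where M: "\<And>n. M \<le> n \<Longrightarrow> near.close n" unfolding eventually_sequentially by blast
    define n where "n = r (max M N)"
    have n: "M \<le> n" "N \<le> n" using seq_suble[OF r, of "max M N"] by (auto simp: n_def)
    have s: "near.on_sphere (Suc (Suc (Suc n)))"
      by (rule near.rejected_then_on_sphere) (use n rr M in \<open>auto simp: n_def\<close>)
    have "near.on_sphere k" if "Suc (Suc (Suc n)) \<le> k" for k
      using that by (induction rule: dec_induct) (use s near.on_sphere_Suc M n in auto)
    then have "acc k" if "Suc (Suc (Suc n)) \<le> k" for k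
      using that near.on_sphere_accepted[of k] M n by simp
    then show False using infinitely_many_rejected by blast
  next
    case True
    define B where "B = \<mu> + 1 / \<alpha>"
    have B: "0 < B" using mu alpha by (simp add: B_def add_pos_pos)
    obtain K where K: "0 \<le> K" "\<forall>\<^sub>F n in sequentially. acc n \<longrightarrow>
       q (Suc n) \<le> q n + K * ts n \<and> norm (ys (Suc n) - ys n) \<le> ts n * q n + K * (ts n)\<^sup>2"
      by (rule step_bounds)
    define \<kappa> where "\<kappa> = min 1 (\<eta> / (4 * (B * (2 + K))))"
    have \<kappa>: "0 < \<kappa>" "\<kappa> \<le> 1" "B * (2 + K) * \<kappa> \<le> \<eta> / 4"
    proof -
      have BK: "0 < B * (2 + K)" using B K by simp
      show "0 < \<kappa>" "\<kappa> \<le> 1" using BK \<eta>(1) by (auto simp: \<kappa>_def)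
      have "\<kappa> \<le> \<eta> / (4 * (B * (2 + K)))" by (simp add: \<kappa>_def)
      then show "B * (2 + K) * \<kappa> \<le> \<eta> / 4" using BK by (simp add: field_simps)
    qed
    have "\<forall>\<^sub>F n in sequentially. q n < \<kappa>" using order_tendstoD(2)[OF l] \<kappa>(1) True by simp
    moreover have "\<forall>\<^sub>F n in sequentially. norm (ys (Suc n) - ys n) < \<delta> / 40"
      using tendstoD[OF y_step_tendsto[OF l], of "\<delta> / 40"] \<delta>(1) by simp
    ultimately have "\<forall>\<^sub>F n in sequentially. q n < \<kappa> \<and> norm (ys (Suc n) - ys n) < \<delta> / 40 \<and>
       (acc n \<longrightarrow> norm (ys (Suc n) - ys n) \<le> ts n * q n + K * (ts n)\<^sup>2)"
      using K(2) by eventually_elim auto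
    then obtain M where M: "\<And>n. M \<le> n \<Longrightarrow> q n < \<kappa> \<and> norm (ys (Suc n) - ys n) < \<delta> / 40 \<and>
       (acc n \<longrightarrow> norm (ys (Suc n) - ys n) \<le> ts n * q n + K * (ts n)\<^sup>2)"
      unfolding eventually_sequentially by blast
    obtain k where k: "max M N \<le> k" "norm (ys (r k) - p) < \<delta> / 4"
    proof -
      obtain k0 where "\<And>k. k0 \<le> k \<Longrightarrow> norm (ys (r k) - p) < \<delta> / 4"
        using y_close unfolding eventually_sequentially by blast
      then show ?thesis using that[of "max k0 (max M N)"] by simp
    qed
    define n where "n = r k"
    have n: "M \<le> n" "N \<le> n" using seq_suble[OF r, of k] k by (auto simp: n_def)
    have cl: "near.close (n + j)" if "j \<le> 5" for j
    proof -
      have "norm (ys (n + j) - ys n) \<le> real j * (\<delta> / 40)"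
      proof (induction j)
        case (Suc j)
        have "norm (ys (n + Suc j) - ys n) \<le> norm (ys (Suc (n + j)) - ys (n + j)) + norm (ys (n + j) - ys n)"
          using norm_triangle_ineq[of "ys (Suc (n + j)) - ys (n + j)" "ys (n + j) - ys n"] by simp
        also have "\<dots> \<le> \<delta> / 40 + real j * (\<delta> / 40)"
          using M[of "n + j"] n Suc by (intro add_mono) auto
        finally show ?case by (simp add: distrib_right)
      qed simp
      also have "\<dots> \<le> 5 * (\<delta> / 40)" using that \<delta>(1) by (intro mult_right_mono) auto
      finally show ?thesis
        using norm_triangle_ineq[of "ys (n + j) - ys n" "ys n - p"] k(2) \<delta>(1) by (simp add: n_def)
    qed
    define m where "m = Suc (Suc (Suc n))"
    have mN: "N \<le> m" "M \<le> m" "N \<le> Suc m" using n by (auto simp: m_def)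
    have cm: "near.close m" "near.close (Suc m)" using cl[of 3] cl[of 4] by (auto simp: m_def numeral_eq_Suc)
    have s: "near.on_sphere m"
      unfolding m_def
      by (rule near.rejected_then_on_sphere) (use n rr cl[of 0] cl[of 2] in \<open>auto simp: n_def numeral_eq_Suc\<close>)
    have am: "acc m" by (rule near.on_sphere_accepted[OF mN(1) s cm(1)])
    have s': "near.on_sphere (Suc m)" by (rule near.on_sphere_Suc[OF mN(1) s cm(1)])
    have am': "acc (Suc m)" by (rule near.on_sphere_accepted[OF mN(3) s' cm(2)])
    define L where "L = Ls m"
    have L: "0 < L" "Ls (Suc m) = L" using near.L_pos acc_L[OF am] by (auto simp: L_def)
    define t where "t = ts m"
    define t' where "t' = ts (Suc m)"
    define Q where "Q = q (Suc m)"
    define h where "h = norm (ys (Suc m) - ys m)"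
    have t: "0 < t" "t < 1" "L * t\<^sup>2 \<le> B" "0 < t'" "L * t'\<^sup>2 \<le> B"
      using weight_sqrt_bound[OF alpha near.N_A[OF mN(1)]] weight_sqrt_bound[OF alpha near.N_A[OF mN(3)]] L
      by (auto simp: t_def t'_def B_def L_def)
    have Q: "0 \<le> Q" "Q \<le> \<kappa>" "q m \<le> \<kappa>" using M[of m] M[of "Suc m"] mN q_nonneg by (auto simp: Q_def less_imp_le)
    have h: "0 \<le> h" "h \<le> t * \<kappa> + K * t\<^sup>2"
    proof -
      have "h \<le> t * q m + K * t\<^sup>2" using M[OF mN(2)] am by (simp add: h_def t_def)
      also have "t * q m \<le> t * \<kappa>" using t Q by (intro mult_left_mono) auto
      finally show "h \<le> t * \<kappa> + K * t\<^sup>2" by simp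
    qed (simp add: h_def)
    \<comment> \<open>on the sphere, the radial part of the velocity is half the length of the last move\<close>
    have inner: "ys (Suc m) \<bullet> (xs (Suc m) - ys (Suc m)) = Q * h / 2"
    proof -
      define e where "e = extrapolation (As m) (Ls m)"
      have e: "0 \<le> e" unfolding e_def by (rule extrapolation_nonneg[OF near.A_pos[OF mN(1)] L_ge])
      have x: "xs (Suc m) - ys (Suc m) = e *\<^sub>R (ys (Suc m) - ys m)"
        using acc_x[OF am] acc_y[OF am] by (simp add: e_def)
      have "ys (Suc m) \<bullet> ys (Suc m) = 1" "ys m \<bullet> ys m = 1"
        using s s' by (auto simp: near.on_sphere_def norm_eq_1)
      then have "h\<^sup>2 = 2 * (ys (Suc m) \<bullet> (ys (Suc m) - ys m))"
        unfolding h_def power2_norm_eq_inner by (simp add: inner_diff_left inner_diff_right inner_commute)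
      moreover have "Q = e * h" unfolding Q_def q_def x h_def using e by simp
      ultimately show ?thesis unfolding x by (simp add: power2_eq_square)
    qed
    have "\<eta> / (4 * L) \<le> norm (zs (Suc m)) - 1"
      using near.accepted_off_sphere[OF mN(3) cm(2) am'] near.z_outside[OF mN(3) s'] L by simp
    then have "\<eta> / 4 \<le> L * (norm (zs (Suc m)) - 1)" using L by (simp add: field_simps)
    moreover have "L * (2 * (norm (zs (Suc m)) - 1)) \<le> L * (t' * (Q * h) + t'\<^sup>2 * Q\<^sup>2)"
    proof (rule mult_left_mono)
      have "2 * (norm (zs (Suc m)) - 1) \<le> (norm (zs (Suc m)))\<^sup>2 - 1"
        using zero_le_power2[of "norm (zs (Suc m)) - 1"] by (simp add: power2_eq_square algebra_simps)
      also have "\<dots> = t' * (Q * h) + t'\<^sup>2 * Q\<^sup>2"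
        unfolding near.norm_z_square inner using s' by (simp add: near.on_sphere_def t'_def Q_def)
      finally show "2 * (norm (zs (Suc m)) - 1) \<le> t' * (Q * h) + t'\<^sup>2 * Q\<^sup>2" .
    qed (use L in simp)
    moreover have "L * (2 * (norm (zs (Suc m)) - 1)) = 2 * (L * (norm (zs (Suc m)) - 1))" by simp
    ultimately have "\<eta> / 2 \<le> L * (t' * (Q * h) + t'\<^sup>2 * Q\<^sup>2)" by linarith
    also have "\<dots> \<le> L * (t' * (\<kappa> * (t * (1 + K))) + t'\<^sup>2 * \<kappa>\<^sup>2)"
    proof (intro mult_left_mono add_mono mult_mono power_mono)
      have "K * t\<^sup>2 \<le> K * t" using t K(1) power_decreasing[of 1 2 t] by (intro mult_left_mono) auto
      moreover have "t * \<kappa> \<le> t * 1" using t \<kappa> by (intro mult_left_mono) auto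
      ultimately show "h \<le> t * (1 + K)" using h by (simp add: distrib_left mult.commute)
    qed (use Q \<kappa> t L h K in auto)
    also have "\<dots> = (L * (t' * t)) * (\<kappa> * (1 + K)) + (L * t'\<^sup>2) * \<kappa>\<^sup>2" by (simp add: algebra_simps)
    also have "\<dots> \<le> B * (\<kappa> * (1 + K)) + B * (\<kappa> * 1)"
    proof (intro add_mono mult_mono)
      have "0 \<le> (t - t')\<^sup>2" by simp
      then have "2 * (t' * t) \<le> t\<^sup>2 + t'\<^sup>2" by (simp add: power2_eq_square algebra_simps)
      then have "L * (2 * (t' * t)) \<le> L * (t\<^sup>2 + t'\<^sup>2)" using L by (intro mult_left_mono) auto
      then show "L * (t' * t) \<le> B" using t by (simp add: distrib_left)
      show "\<kappa>\<^sup>2 \<le> \<kappa> * 1" using \<kappa> power_decreasing[of 1 2 \<kappa>] by simp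
    qed (use \<kappa> t B K L in auto)
    also have "\<dots> = B * (2 + K) * \<kappa>" by (simp add: algebra_simps)
    also have "\<dots> \<le> \<eta> / 4" by (rule \<kappa>(3))
    finally show False using \<eta>(1) by simp
  qed
qed

end

lemma (in fista_run) run_impossible: False
proof -
  obtain n where "acc n" using infinitely_many_accepted by blast
  then obtain \<alpha> where "0 < \<alpha>" "\<forall>\<^sub>F n in sequentially. \<alpha> \<le> As n" using A_pos_eventually by blast
  then interpret fista_run_pos E \<psi> D \<mu> \<sigma> chi x0 ys xs zs ws As Ls ts acc \<alpha> by unfold_locales
  show False by (rule impossible)
qed

theorem (in smooth_fista) fista_terminates:
  assumes inv: "inv (run 0)" and step: "\<And>n. step (run n) (run (Suc n))"
  shows False
proof -
  have inv: "inv (run n)" for n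
    by (induction n) (use inv inv_step step in auto)
  have "\<exists>y x A \<tau> L. run n = Fista_Search y x A \<tau> L" for n
    using step[of n] by (auto elim: fista_step.cases)
  then obtain ys xs As \<tau>s Ls where run: "\<And>n. run n = Fista_Search (ys n) (xs n) (As n) (\<tau>s n) (Ls n)" by metis
  note invs = inv[unfolded run]
  note steps = step[unfolded run]
  define zs where "zs n = mid (ys n) (xs n) (As n) (Ls n)" for n
  define ws where "ws n = prox (Ls n) (zs n)" for n
  define ts where "ts n = weight (As n) (Ls n)" for n
  define acc where "acc n \<longleftrightarrow> accepted (Ls n) (zs n) (ws n)" for n
  have cases: "(\<not> acc n \<and> ys (Suc n) = ys n \<and> xs (Suc n) = xs n \<and> As (Suc n) = As n \<and> Ls (Suc n) = 2 * Ls n) \<or>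
     (acc n \<and> chi * As (Suc n) * Ls n * (norm (ws n - zs n))\<^sup>2 \<le> (norm (ws n - x0))\<^sup>2 \<and>
      \<sigma> * norm (ws n - x0) < norm (residual (Ls n) (zs n) (ws n)) \<and>
      xs (Suc n) - ws n = extrapolation (As n) (Ls n) *\<^sub>R (ws n - ys n) \<and>
      ys (Suc n) = ws n \<and> As (Suc n) = As n + stepsize (As n) (Ls n) \<and> Ls (Suc n) = Ls n)" for n
    using invs[of n] steps[of n]
    by (cases rule: step_cases) (simp_all add: acc_def ws_def zs_def)
  interpret fista_run E \<psi> D \<mu> \<sigma> chi x0 ys xs zs ws As Ls ts acc
  proof unfold_locales
    fix n
    show "ys n \<in> E" "norm (ys n) \<le> 1" "xs n \<in> E" "0 \<le> As n" "1 \<le> Ls n"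
      "As n = 0 \<Longrightarrow> ys n = x0 \<and> xs n = x0" "As n \<noteq> 0 \<Longrightarrow> nonstationary"
      using invs[of n] by auto
    show "zs n = mid (ys n) (xs n) (As n) (Ls n)" "ws n = prox (Ls n) (zs n)"
      "ts n = weight (As n) (Ls n)" "acc n \<longleftrightarrow> accepted (Ls n) (zs n) (ws n)"
      by (simp_all only: zs_def ws_def ts_def acc_def)
    show "\<not> acc n \<Longrightarrow> ys (Suc n) = ys n \<and> xs (Suc n) = xs n \<and> As (Suc n) = As n \<and> Ls (Suc n) = 2 * Ls n"
      "acc n \<Longrightarrow> ys (Suc n) = ws n"
      "acc n \<Longrightarrow> xs (Suc n) - ws n = extrapolation (As n) (Ls n) *\<^sub>R (ws n - ys n)"
      "acc n \<Longrightarrow> As (Suc n) = As n + stepsize (As n) (Ls n)" "acc n \<Longrightarrow> Ls (Suc n) = Ls n"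
      "acc n \<Longrightarrow> chi * As (Suc n) * Ls n * (norm (ws n - zs n))\<^sup>2 \<le> (norm (ws n - x0))\<^sup>2"
      "acc n \<Longrightarrow> \<sigma> * norm (ws n - x0) < norm (residual (Ls n) (zs n) (ws n))"
      using cases[of n] by blast+
  qed
  show False by (rule run_impossible)
qed

section \<open>ADAP-AIPP\<close>

text \<open>The input of HLR: the gradient of the convex function \<open>g\<close> is Lipschitz continuous on the spectraplex with
  constant \<open>Lg\<close>.\<close>

locale hlr = convex_differentiable g for g :: "real^'n^'n \<Rightarrow> real" +
  fixes Lg \<epsilon> \<rho> lam0 \<sigma> chi :: real and s0 :: nat and Y0 :: "'n cmat"
  assumes sigma: "0 < \<sigma>" "\<sigma> < 1 / 2" and chi: "0 < chi" "chi < 1"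
    and Lg: "0 \<le> Lg" "\<forall>Z\<in>spectraplex. \<forall>Z'\<in>spectraplex. norm (grad g Z' - grad g Z) \<le> Lg * norm (Z' - Z)"
    and Y0: "Y0 \<in> mat_ball s0 1"
    and pos: "0 < \<epsilon>" "0 < \<rho>" "0 < lam0"
begin

text \<open>A step of the ADAP-FISTA call that ADAP-AIPP makes at the prox center \<open>W\<close>.\<close>

abbreviation fstep :: "nat \<Rightarrow> real \<Rightarrow> 'n cmat \<Rightarrow> 'n cmat fista_state \<Rightarrow> 'n cmat fista_state \<Rightarrow> bool" where
  "fstep s lam W \<equiv> fista_step \<sigma> chi (mats s) (1 / 2) W (aipp_smooth g lam W)
     (\<lambda>U. ereal lam * indicator_fn (mat_ball s 1) U)"

lemma scaled_indicator:
  "0 < lam \<Longrightarrow> (\<lambda>U. ereal lam * indicator_fn (mat_ball s 1) U) = indicator_fn (mats s \<inter> cball 0 1)"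
  by (auto simp: indicator_fn_def mat_ball_eq fun_eq_iff)

lemma smooth_fista_aipp:
  assumes lam: "0 < lam" and W: "W \<in> mat_ball s 1"
  shows "smooth_fista (mats s) (aipp_smooth g lam W) (prox_gradient g lam W) (1 / 2) \<sigma> chi W"
proof unfold_locales
  have Ws: "W \<in> mats s" "norm W \<le> 1" using W by (auto simp: mat_ball_def)
  show "subspace (mats s :: 'n cmat set)" by (rule subspace_mats)
  show "prox_gradient g lam W z \<in> mats s" if "z \<in> mats s" for z
    using that Ws by (auto simp: prox_gradient_def mats_def)
  show "gradient_on (mats s) (aipp_smooth g lam W) z = prox_gradient g lam W z" if "z \<in> mats s" for z
    by (rule gradient_aipp_smooth[OF Ws(1) that])
  show "W \<in> mats s" "norm W \<le> 1" by fact+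
  show "compact (mats s \<inter> cball 0 r :: 'n cmat set)" for r
    using compact_mat_ball[of s r] by (simp add: mat_ball_eq)
  show "continuous_on (mats s) (prox_gradient g lam W)" by (rule continuous_on_prox_gradient)
  show "\<exists>C. \<forall>u\<in>mats s \<inter> cball 0 r. \<forall>z\<in>mats s \<inter> cball 0 r.
      aipp_smooth g lam W z + prox_gradient g lam W z \<bullet> (u - z) - C * (norm (u - z))\<^sup>2 \<le> aipp_smooth g lam W u" for r
  proof -
    obtain M where M: "\<And>z. z \<in> mat_ball s r \<Longrightarrow> norm (grad g (gram z)) \<le> M"
      using grad_gram_bounded[of s r] by (auto simp: bdd_above_def)
    show ?thesis
    proof (intro exI[of _ "lam * M"] ballI)
      fix u z :: "'n cmat" assume u: "u \<in> mats s \<inter> cball 0 r" and z: "z \<in> mats s \<inter> cball 0 r"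
      have "lam * norm (grad g (gram z)) \<le> lam * M"
        using M[of z] z lam by (intro mult_left_mono) (auto simp: mat_ball_eq)
      then have "(- (lam * M)) * (norm (u - z))\<^sup>2 \<le> (1 / 2 - lam * norm (grad g (gram z))) * (norm (u - z))\<^sup>2"
        by (intro mult_right_mono) auto
      then show "aipp_smooth g lam W z + prox_gradient g lam W z \<bullet> (u - z) - lam * M * (norm (u - z))\<^sup>2 \<le> aipp_smooth g lam W u"
        using aipp_smooth_lower[of lam W z u] lam by simp
    qed
  qed
  obtain K where "\<And>U V. U \<in> mats s \<Longrightarrow> norm U \<le> 1 \<Longrightarrow> V \<in> mats s \<Longrightarrow> norm V \<le> 1 \<Longrightarrow>
    norm (prox_gradient g lam W U - prox_gradient g lam W V) \<le> K * norm (U - V)"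
    using prox_gradient_lipschitz[OF Lg less_imp_le[OF lam], of s W] by blast
  then show "\<exists>K. \<forall>u\<in>mats s \<inter> cball 0 1. \<forall>z\<in>mats s \<inter> cball 0 1.
      norm (prox_gradient g lam W u - prox_gradient g lam W z) \<le> K * norm (u - z)" by (intro exI[of _ K]) auto
qed (use chi sigma in auto)

lemma strongly_convex_fista_aipp:
  assumes lam: "0 < lam" "4 * lam * grad_bound g s \<le> 1" and W: "W \<in> mat_ball s 1"
  obtains ystar where
    "strongly_convex_fista (mats s) (aipp_smooth g lam W) (prox_gradient g lam W) (1 / 2) \<sigma> chi W ystar"
proof -
  interpret smooth_fista "mats s" "aipp_smooth g lam W" "prox_gradient g lam W" "1 / 2" \<sigma> chi W
    by (rule smooth_fista_aipp[OF lam(1) W])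
  have "continuous_on sym_mats g" by (rule differentiable_imp_continuous_on[OF differentiable])
  then have "continuous_on (mat_ball s 1) (\<lambda>U. g (gram U))"
    by (rule continuous_on_compose2[OF _ continuous_on_gram]) (auto intro: gram_in_sym)
  then have "continuous_on (mat_ball s 1) (aipp_smooth g lam W)"
    unfolding aipp_smooth_def[abs_def] by (intro continuous_intros)
  then obtain ystar where y: "ystar \<in> mat_ball s 1" "\<And>u. u \<in> mat_ball s 1 \<Longrightarrow> aipp_smooth g lam W ystar \<le> aipp_smooth g lam W u"
    using continuous_attains_inf[OF compact_mat_ball, of s 1 "aipp_smooth g lam W"] W by blast
  have "strongly_convex_fista (mats s) (aipp_smooth g lam W) (prox_gradient g lam W) (1 / 2) \<sigma> chi W ystar"
  proof unfold_locales
    show "ystar \<in> mats s" "norm ystar \<le> 1"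
      "\<And>u. u \<in> mats s \<Longrightarrow> norm u \<le> 1 \<Longrightarrow> aipp_smooth g lam W ystar \<le> aipp_smooth g lam W u"
      using y by (auto simp: mat_ball_def)
    fix u z :: "'n cmat" assume uz: "u \<in> mats s" "norm u \<le> 1" "z \<in> mats s" "norm z \<le> 3"
    have "norm (grad g (gram z)) \<le> grad_bound g s"
      by (rule norm_grad_le_grad_bound) (use uz in \<open>simp add: mat_ball_def\<close>)
    then have "lam * norm (grad g (gram z)) \<le> lam * grad_bound g s" using lam(1) by (intro mult_left_mono) auto
    then have "1 / 2 / 2 \<le> 1 / 2 - lam * norm (grad g (gram z))" using lam(2) by linarith
    then have "1 / 2 / 2 * (norm (u - z))\<^sup>2 \<le> (1 / 2 - lam * norm (grad g (gram z))) * (norm (u - z))\<^sup>2"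
      by (intro mult_right_mono) auto
    then show "aipp_smooth g lam W z + prox_gradient g lam W z \<bullet> (u - z) + 1 / 2 / 2 * (norm (u - z))\<^sup>2 \<le> aipp_smooth g lam W u"
      using aipp_smooth_lower[of lam W z u] lam by simp
  qed
  then show ?thesis by (rule that)
qed

lemma fista_no_infinite_run:
  assumes lam: "0 < lam" and W: "W \<in> mat_ball s 1" and M: "1 \<le> M"
    and start: "(fstep s lam W)\<^sup>*\<^sup>* (fista_init W M) (run 0)" and run: "\<And>n. fstep s lam W (run n) (run (Suc n))"
  shows False
proof -
  interpret smooth_fista "mats s" "aipp_smooth g lam W" "prox_gradient g lam W" "1 / 2" \<sigma> chi W
    by (rule smooth_fista_aipp[OF lam W])
  note start = start[unfolded scaled_indicator[OF lam]] and run = run[unfolded scaled_indicator[OF lam]]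
  show False by (rule fista_terminates[of run]) (use inv_reachable[OF start] inv_init[OF M] run in auto)
qed

lemma fista_progress:
  assumes lam: "0 < lam" and W: "W \<in> mat_ball s 1" and M: "1 \<le> M"
    and start: "(fstep s lam W)\<^sup>*\<^sup>* (fista_init W M) (Fista_Search y x A \<tau> L)"
  shows "\<exists>f'. fstep s lam W (Fista_Search y x A \<tau> L) f'"
proof -
  interpret smooth_fista "mats s" "aipp_smooth g lam W" "prox_gradient g lam W" "1 / 2" \<sigma> chi W
    by (rule smooth_fista_aipp[OF lam W])
  show ?thesis
    using step_exists inv_reachable[OF start[unfolded scaled_indicator[OF lam]]] inv_init[OF M]
    unfolding scaled_indicator[OF lam] by blast
qed

lemma fista_success:
  assumes lam: "0 < lam" and W: "W \<in> mat_ball s 1" and M: "1 \<le> M"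
    and start: "(fstep s lam W)\<^sup>*\<^sup>* (fista_init W M) (Fista_Success W' V L)"
  shows "W' \<in> mat_ball s 1" "norm V \<le> \<sigma> * norm (W' - W)" "1 \<le> L"
proof -
  interpret smooth_fista "mats s" "aipp_smooth g lam W" "prox_gradient g lam W" "1 / 2" \<sigma> chi W
    by (rule smooth_fista_aipp[OF lam W])
  have "inv (Fista_Success W' V L)"
    using inv_reachable[OF start[unfolded scaled_indicator[OF lam]]] inv_init[OF M] by blast
  then show "W' \<in> mat_ball s 1" "norm V \<le> \<sigma> * norm (W' - W)" "1 \<le> L" by (auto simp: mat_ball_def)
qed

text \<open>A call can only fail, or have its output rejected, if the prox parameter is too large.\<close>

lemma fista_small_lam:
  assumes lam: "0 < lam" "4 * lam * grad_bound g s \<le> 1" and W: "W \<in> mat_ball s 1" and M: "1 \<le> M"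
    and start: "(fstep s lam W)\<^sup>*\<^sup>* (fista_init W M) f"
  shows "f \<noteq> Fista_Failure" "f = Fista_Success W' V L \<Longrightarrow> aipp_accepts g lam W W' V"
proof -
  obtain ystar where "strongly_convex_fista (mats s) (aipp_smooth g lam W) (prox_gradient g lam W) (1 / 2) \<sigma> chi W ystar"
    using strongly_convex_fista_aipp[OF lam W] by blast
  then interpret strongly_convex_fista "mats s" "aipp_smooth g lam W" "prox_gradient g lam W" "1 / 2" \<sigma> chi W ystar .
  have p: "pot_inv f" by (rule pot_inv_reachable[OF M start[unfolded scaled_indicator[OF lam(1)]]])
  then show "f \<noteq> Fista_Failure" by auto
  assume "f = Fista_Success W' V L"
  then show "aipp_accepts g lam W W' V" using p by (simp add: aipp_accepts_def aipp_smooth_def)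
qed

lemma C_sigma_pos: "0 < C_sigma \<sigma>"
  using sigma by (simp add: C_sigma_def)

text \<open>With \<open>e = W - W'\<close> and \<open>V + e = lam R\<close>, the acceptance test says that \<open>(norm (V + e))\<^sup>2 - (norm V)\<^sup>2\<close> is at most
  \<open>2 lam\<close> times the decrease of the objective, and \<open>norm V\<close> is at most \<open>\<sigma> / (1 - \<sigma>) * norm (V + e)\<close>.\<close>

lemma residual_descent:
  assumes lam: "0 < lam" and acc: "aipp_accepts g lam W W' V" and V: "norm V \<le> \<sigma> * norm (W' - W)"
  shows "lam * (norm (aipp_residual lam W W' V))\<^sup>2 \<le> C_sigma \<sigma> * (g (gram W) - g (gram W'))"
proof -
  define e where "e = W - W'"
  define \<Delta> where "\<Delta> = g (gram W) - g (gram W')"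
  have Ve: "norm V \<le> \<sigma> * norm e" using V by (simp add: e_def norm_minus_commute)
  have sq: "(norm (V + e))\<^sup>2 = (norm V)\<^sup>2 + 2 * (V \<bullet> e) + (norm e)\<^sup>2"
    by (simp add: power2_norm_eq_inner inner_add_left inner_add_right inner_commute)
  have "1 / 2 * (norm e)\<^sup>2 + V \<bullet> e \<le> lam * \<Delta>"
    using acc by (simp add: aipp_accepts_def \<Delta>_def e_def norm_minus_commute right_diff_distrib)
  then have 1: "(norm (V + e))\<^sup>2 - (norm V)\<^sup>2 \<le> 2 * (lam * \<Delta>)" using sq by simp
  have "norm e \<le> norm (V + e) + norm V" using norm_triangle_ineq4[of "V + e" V] by simp
  then have "(1 - \<sigma>) * norm e \<le> norm (V + e)" using Ve by (simp add: left_diff_distrib)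
  then have "\<sigma> * ((1 - \<sigma>) * norm e) \<le> \<sigma> * norm (V + e)" using sigma by (intro mult_left_mono) auto
  moreover have "(1 - \<sigma>) * norm V \<le> (1 - \<sigma>) * (\<sigma> * norm e)" using Ve sigma by (intro mult_left_mono) auto
  ultimately have "(1 - \<sigma>) * norm V \<le> \<sigma> * norm (V + e)" by (simp add: mult.left_commute)
  then have "((1 - \<sigma>) * norm V)\<^sup>2 \<le> (\<sigma> * norm (V + e))\<^sup>2" using sigma by (intro power_mono) auto
  then have 2: "(1 - \<sigma>)\<^sup>2 * (norm V)\<^sup>2 \<le> \<sigma>\<^sup>2 * (norm (V + e))\<^sup>2" by (simp add: power_mult_distrib)
  have "(1 - \<sigma>)\<^sup>2 * ((norm (V + e))\<^sup>2 - (norm V)\<^sup>2) \<le> (1 - \<sigma>)\<^sup>2 * (2 * (lam * \<Delta>))"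
    using 1 by (intro mult_left_mono) auto
  moreover have "(1 - 2 * \<sigma>) * (norm (V + e))\<^sup>2 = (1 - \<sigma>)\<^sup>2 * (norm (V + e))\<^sup>2 - \<sigma>\<^sup>2 * (norm (V + e))\<^sup>2"
    by (simp add: power2_eq_square algebra_simps)
  ultimately have "(1 - 2 * \<sigma>) * (norm (V + e))\<^sup>2 \<le> 2 * (1 - \<sigma>)\<^sup>2 * (lam * \<Delta>)"
    using 2 by (simp add: right_diff_distrib)
  then have 3: "(norm (V + e))\<^sup>2 \<le> C_sigma \<sigma> * (lam * \<Delta>)"
    using sigma by (simp add: C_sigma_def field_simps)
  have "aipp_residual lam W W' V = (1 / lam) *\<^sub>R (V + e)"
    by (simp add: aipp_residual_def e_def)
  then have "lam * (norm (aipp_residual lam W W' V))\<^sup>2 = (norm (V + e))\<^sup>2 / lam"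
    using lam by (simp add: power2_eq_square)
  also have "\<dots> \<le> C_sigma \<sigma> * (lam * \<Delta>) / lam" using 3 lam by (intro divide_right_mono) auto
  finally show ?thesis using lam by (simp add: \<Delta>_def)
qed

lemma accept_descends:
  assumes "0 < lam" "aipp_accepts g lam W W' V" "norm V \<le> \<sigma> * norm (W' - W)"
  shows "g (gram W') \<le> g (gram W)"
proof -
  have "0 \<le> C_sigma \<sigma> * (g (gram W) - g (gram W'))"
    using residual_descent[OF assms] assms(1) by (meson order_trans mult_nonneg_nonneg less_imp_le zero_le_power2)
  then show ?thesis using C_sigma_pos by (simp add: zero_le_mult_iff)
qed

section \<open>The Frank-Wolfe steps\<close>

text \<open>Every step of HLR decreases the optimality gap from \<open>e\<close> to some \<open>e'\<close> like this.\<close>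

definition fw_decrease :: "real \<Rightarrow> real \<Rightarrow> bool" where
  "fw_decrease e e' \<longleftrightarrow> (\<forall>\<alpha>. 0 \<le> \<alpha> \<longrightarrow> \<alpha> \<le> 1 \<longrightarrow> e' \<le> e - \<alpha> * max \<epsilon> e + 2 * Lg * \<alpha>\<^sup>2)"

lemma fw_decrease_mono:
  assumes "fw_decrease e e'" "e \<le> f"
  shows "fw_decrease f e'"
  unfolding fw_decrease_def
proof (intro allI impI)
  fix \<alpha> :: real assume a: "0 \<le> \<alpha>" "\<alpha> \<le> 1"
  have "max \<epsilon> f - max \<epsilon> e \<le> f - e" using assms(2) by (auto simp: max_def)
  then have "\<alpha> * (max \<epsilon> f - max \<epsilon> e) \<le> 1 * (f - e)"
    using a assms(2) by (intro mult_mono) (auto simp: max_def)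
  then show "e' \<le> f - \<alpha> * max \<epsilon> f + 2 * Lg * \<alpha>\<^sup>2"
    using assms(1) a unfolding fw_decrease_def right_diff_distrib by fastforce
qed

text \<open>
  If \<open>\<epsilon> \<le> M\<close>, the gap decreases like \<open>2 M / k\<close> in the first half of the steps, and every step of the second half
  decreases it at least by \<open>\<epsilon>\<^sup>2 / (2 M)\<close>.  If \<open>\<epsilon> > M\<close>, every step decreases it at least by \<open>\<epsilon> / 2\<close>.
\<close>

lemma fw_count:
  assumes dec: "\<And>j. j < N \<Longrightarrow> fw_decrease (h j) (h (Suc j))" and nonneg: "\<And>j. 0 \<le> h j"
    and h0: "h 0 \<le> M" and M: "4 * Lg \<le> M"
  shows "real N \<le> 4 * M / \<epsilon>"
proof (cases "M < \<epsilon>")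
  case True
  have "h k \<le> M - real k * (\<epsilon> / 2)" if "k \<le> N" for k
    using that
  proof (induction k)
    case (Suc k)
    have "h (Suc k) \<le> h k - 1 * max \<epsilon> (h k) + 2 * Lg * 1\<^sup>2"
      using dec[of k] Suc.prems unfolding fw_decrease_def by (metis Suc_le_eq le_numeral_extra(4) zero_le_one)
    also have "\<dots> \<le> h k - \<epsilon> / 2" using M True by simp
    finally show ?case using Suc by (simp add: distrib_right add_divide_distrib)
  qed (use h0 in simp)
  from this[of N] have "real N * (\<epsilon> / 2) \<le> M" using nonneg[of N] by simp
  moreover have "0 \<le> M" using M Lg by simp
  ultimately show ?thesis using pos by (simp add: field_simps)
next
  case False
  then have M0: "0 < M" "\<epsilon> \<le> M" using pos by auto
  have le: "h (Suc j) \<le> h j" if "j < N" for j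
  proof -
    have "h (Suc j) \<le> h j - 0 * max \<epsilon> (h j) + 2 * Lg * 0\<^sup>2"
      using dec[OF that] unfolding fw_decrease_def by (metis le_numeral_extra(3) zero_le_one)
    then show ?thesis by simp
  qed
  have hM: "h k \<le> M" if "k \<le> N" for k
    using that
  proof (induction k)
    case (Suc k)
    then show ?case using le[of k] by simp
  qed (use h0 in simp)
  have step: "h (Suc j) \<le> h j - e\<^sup>2 / (2 * M)" if j: "j < N" and e: "0 \<le> e" "e \<le> max \<epsilon> (h j)" for j e
  proof -
    \<comment> \<open>the step size \<open>e / M\<close> is admissible and almost optimal\<close>
    have eM: "e \<le> M" using e(2) hM[of j] j M0 by auto
    have "0 \<le> e / M" "e / M \<le> 1" using e(1) eM M0 by auto
    then have "h (Suc j) \<le> h j - e / M * max \<epsilon> (h j) + 2 * Lg * (e / M)\<^sup>2"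
      using dec[OF j] unfolding fw_decrease_def by blast
    moreover have "e / M * e \<le> e / M * max \<epsilon> (h j)" using e M0 by (intro mult_left_mono) auto
    moreover have "2 * Lg * (e / M)\<^sup>2 \<le> M / 2 * (e / M)\<^sup>2" using M by (intro mult_right_mono) auto
    moreover have "h j - e / M * e + M / 2 * (e / M)\<^sup>2 = h j - e\<^sup>2 / (2 * M)"
      using M0 by (simp add: power2_eq_square field_simps)
    ultimately show ?thesis by linarith
  qed
  have half1: "h k \<le> 2 * M / (real k + 2)" if "k \<le> N" for k
    using that
  proof (induction k)
    case (Suc k)
    define b where "b = 2 * M / (real k + 2)"
    have k: "k < N" and hb: "h k \<le> b" using Suc by (auto simp: b_def)
    have b: "0 < b" "b \<le> M" using M0 by (auto simp: b_def field_simps)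
    have "h (Suc k) \<le> h k - (h k)\<^sup>2 / (2 * M)" by (rule step[OF k]) (use nonneg in auto)
    also have "\<dots> \<le> b - b\<^sup>2 / (2 * M)"
    proof -
      have "0 \<le> (b - h k) * (2 * M - (b + h k))" using hb b hM[of k] k by (intro mult_nonneg_nonneg) auto
      then have "b\<^sup>2 - (h k)\<^sup>2 \<le> 2 * M * (b - h k)" by (simp add: power2_eq_square algebra_simps)
      then have "(b\<^sup>2 - (h k)\<^sup>2) / (2 * M) \<le> b - h k" using M0 by (simp add: field_simps)
      then show ?thesis by (simp add: diff_divide_distrib)
    qed
    also have "b - b\<^sup>2 / (2 * M) = 2 * M * ((real k + 1) / (real k + 2)\<^sup>2)"
    proof -
      define u where "u = real k + 2"
      have u: "0 < u" "real k + 1 = u - 1" by (auto simp: u_def)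
      show ?thesis unfolding b_def u(2) u_def[symmetric] using u(1) M0 by (simp add: power2_eq_square field_simps)
    qed
    also have "\<dots> \<le> 2 * M * (1 / (real k + 3))"
    proof (intro mult_left_mono)
      have "(real k + 1) * (real k + 3) \<le> (real k + 2)\<^sup>2" by (simp add: power2_eq_square algebra_simps)
      then show "(real k + 1) / (real k + 2)\<^sup>2 \<le> 1 / (real k + 3)" by (simp add: divide_simps)
    qed (use M0 in simp)
    finally show ?case by (simp add: add.commute)
  qed (use h0 in simp)
  define m where "m = N div 2"
  have half2: "h (m + i) \<le> h m - real i * (\<epsilon>\<^sup>2 / (2 * M))" if "m + i \<le> N" for i
    using that
  proof (induction i)
    case (Suc i)
    have "h (Suc (m + i)) \<le> h (m + i) - \<epsilon>\<^sup>2 / (2 * M)" by (rule step) (use Suc pos in auto)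
    then show ?case using Suc by (simp add: distrib_right add_divide_distrib)
  qed simp
  have mN: "m \<le> N" by (simp add: m_def)
  have "real (N - m) * (\<epsilon>\<^sup>2 / (2 * M)) \<le> 2 * M / (real m + 2)"
    using half2[of "N - m"] half1[OF mN] nonneg[of N] mN by simp
  then have "real (N - m) * (real m + 2) * \<epsilon>\<^sup>2 \<le> 4 * M\<^sup>2"
    using M0 by (simp add: field_simps power2_eq_square)
  moreover have "(real N)\<^sup>2 \<le> 4 * (real (N - m) * (real m + 2))"
  proof -
    have "N\<^sup>2 \<le> 4 * ((N - m) * (m + 2))"
    proof (cases "even N")
      case True
      then have "N = 2 * m" by (simp add: m_def)
      then show ?thesis by (simp add: power2_eq_square algebra_simps)
    next
      case False
      then have "N = 2 * m + 1" by (simp add: m_def)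
      then show ?thesis by (simp add: power2_eq_square algebra_simps)
    qed
    then have "real (N\<^sup>2) \<le> real (4 * ((N - m) * (m + 2)))" by (simp only: of_nat_le_iff)
    then show ?thesis by (simp add: distrib_left)
  qed
  then have "(real N)\<^sup>2 * \<epsilon>\<^sup>2 \<le> 4 * (real (N - m) * (real m + 2)) * \<epsilon>\<^sup>2" by (intro mult_right_mono) auto
  ultimately have "(real N * \<epsilon>)\<^sup>2 \<le> (4 * M)\<^sup>2" by (simp add: power_mult_distrib)
  then have "real N * \<epsilon> \<le> 4 * M" by (rule power2_le_imp_le) (use M0 in simp)
  then show ?thesis using pos by (simp add: field_simps)
qed

lemma g_min_le: "Z \<in> spectraplex \<Longrightarrow> g_min g \<le> g Z"
  unfolding g_min_def
proof (rule cINF_lower)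
  have z: "(0::real^'n^'n) \<in> sym_mats" by (rule subspace_0[OF subspace_sym_mats])
  have "g 0 - max (- lambda_min (grad g 0)) 0 \<le> g Z" if "Z \<in> spectraplex" for Z
    using grad_inequality[OF z, of Z] inner_spectraplex_ge[OF grad_in_sym[OF z] that] that
    by (simp add: spectraplex_def)
  then show "bdd_below (g ` spectraplex)" by (auto simp: bdd_below_def)
qed

text \<open>The quantity \<open>\<epsilon>\<^sub>k\<close> of the method is the Frank-Wolfe gap.\<close>

lemma eig_gap:
  assumes Y: "norm Y \<le> 1" and eig: "hlr_eig g Y \<theta> y \<epsilon>k"
  shows eig_gap_ge: "Z \<in> spectraplex \<Longrightarrow> grad g (gram Y) \<bullet> (gram Y - Z) \<le> \<epsilon>k"
    and eig_gap_eq: "grad g (gram Y) \<bullet> (outer y - gram Y) = - \<epsilon>k"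
    and eig_norm: "norm y \<le> 1"
    and eig_gap_min: "g (gram Y) - g_min g \<le> \<epsilon>k"
proof -
  define G where "G = grad g (gram Y)"
  have G: "G \<in> sym_mats" by (simp add: G_def grad_in_sym gram_in_sym)
  have e: "\<theta> = max (- lambda_min G) 0" "\<epsilon>k = G \<bullet> gram Y + \<theta>"
    and y: "if \<theta> > 0 then is_eigenpair G (lambda_min G) y \<and> norm y = 1 else y = 0"
    using eig by (auto simp: hlr_eig_def Let_def G_def inner_gram)
  show ge: "grad g (gram Y) \<bullet> (gram Y - Z) \<le> \<epsilon>k" if "Z \<in> spectraplex" for Z
    using inner_spectraplex_ge[OF G that] e unfolding G_def[symmetric] by (simp add: inner_diff_right)
  show "norm y \<le> 1" using y by (auto split: if_splits)
  have "G \<bullet> outer y = - \<theta>"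
  proof (cases "0 < \<theta>")
    case True
    then have "G *v y = lambda_min G *\<^sub>R y" "norm y = 1" using y by (auto simp: is_eigenpair_def)
    moreover have "\<theta> = - lambda_min G" using e True by simp
    ultimately show ?thesis by (simp add: inner_outer norm_eq_1)
  next
    case False
    then show ?thesis using y e by (auto simp: inner_outer max_def split: if_splits)
  qed
  then show "grad g (gram Y) \<bullet> (outer y - gram Y) = - \<epsilon>k"
    using e unfolding G_def[symmetric] by (simp add: inner_diff_right)
  have "g (gram Y) - \<epsilon>k \<le> g_min g"
    unfolding g_min_def
  proof (rule cINF_greatest)
    show "spectraplex \<noteq> ({} :: (real^'n^'n) set)" using gram_in_spectraplex[OF Y] by blast
    fix Z :: "real^'n^'n" assume Z: "Z \<in> spectraplex"
    have "g (gram Y) + G \<bullet> (Z - gram Y) \<le> g Z"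
      unfolding G_def by (rule grad_inequality[OF gram_in_sym]) (use Z in \<open>simp add: spectraplex_def\<close>)
    then show "g (gram Y) - \<epsilon>k \<le> g Z" using ge[OF Z] unfolding G_def[symmetric] by (simp add: inner_diff_right)
  qed
  then show "g (gram Y) - g_min g \<le> \<epsilon>k" by simp
qed

lemma eig_stop_optimal:
  assumes Y: "norm Y \<le> 1" and eig: "hlr_eig g Y \<theta> y \<epsilon>k" and le: "\<epsilon>k \<le> \<epsilon>"
  shows "eps_optimal g \<epsilon> (gram Y)"
proof -
  let ?G = "grad g (gram Y)"
  have Z: "gram Y \<in> spectraplex" by (rule gram_in_spectraplex[OF Y])
  have "- ?G \<in> eps_subdifferential sym_mats \<epsilon> (indicator_fn spectraplex) (gram Y)"
    unfolding eps_subdifferential_def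
  proof (intro CollectI conjI ballI)
    show "- ?G \<in> sym_mats" by (intro subspace_neg subspace_sym_mats grad_in_sym gram_in_sym)
    fix Z' :: "real^'n^'n"
    show "indicator_fn spectraplex (gram Y) + ereal (- ?G \<bullet> (Z' - gram Y)) - ereal \<epsilon> \<le> indicator_fn spectraplex Z'"
    proof (cases "Z' \<in> spectraplex")
      case True
      then have "- ?G \<bullet> (Z' - gram Y) \<le> \<epsilon>"
        using eig_gap_ge[OF Y eig True] le by (simp add: inner_diff_right)
      then show ?thesis using Z True by (simp add: indicator_fn_def)
    qed (simp add: indicator_fn_def)
  qed
  then show ?thesis using Z unfolding eps_optimal_def by force
qed

text \<open>The matrix \<open>[\<surd>(1-\<alpha>) Y, \<surd>\<alpha> y]\<close>.\<close>

lemma append_convex: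
  assumes Y: "Y \<in> mat_ball s 1" and y: "norm y \<le> 1" and a: "0 \<le> \<alpha>" "\<alpha> \<le> 1"
  shows "append_col s (sqrt (1 - \<alpha>) *\<^sub>R Y) (sqrt \<alpha> *\<^sub>R y) \<in> mat_ball (s + 1) 1"
    and "gram (append_col s (sqrt (1 - \<alpha>) *\<^sub>R Y) (sqrt \<alpha> *\<^sub>R y)) = \<alpha> *\<^sub>R outer y + (1 - \<alpha>) *\<^sub>R gram Y"
proof -
  have Ys: "Y \<in> mats s" "norm Y \<le> 1" using Y by (auto simp: mat_ball_def)
  then have sY: "sqrt (1 - \<alpha>) *\<^sub>R Y \<in> mats s" by (simp add: subspace_scale subspace_mats)
  show "gram (append_col s (sqrt (1 - \<alpha>) *\<^sub>R Y) (sqrt \<alpha> *\<^sub>R y)) = \<alpha> *\<^sub>R outer y + (1 - \<alpha>) *\<^sub>R gram Y"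
    unfolding gram_append_col[OF sY] using a by (simp add: gram_scaleR outer_scaleR)
  have "(norm (append_col s (sqrt (1 - \<alpha>) *\<^sub>R Y) (sqrt \<alpha> *\<^sub>R y)))\<^sup>2 = (1 - \<alpha>) * (norm Y)\<^sup>2 + \<alpha> * (norm y)\<^sup>2"
    unfolding norm_append_col[OF sY] using a by (simp add: power_mult_distrib)
  also have "\<dots> \<le> (1 - \<alpha>) * 1 + \<alpha> * 1"
    using a Ys y by (intro add_mono mult_left_mono power_le_one) auto
  finally have "(norm (append_col s (sqrt (1 - \<alpha>) *\<^sub>R Y) (sqrt \<alpha> *\<^sub>R y)))\<^sup>2 \<le> 1\<^sup>2" by simp
  then have "norm (append_col s (sqrt (1 - \<alpha>) *\<^sub>R Y) (sqrt \<alpha> *\<^sub>R y)) \<le> 1" by (rule power2_le_imp_le) simp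
  then show "append_col s (sqrt (1 - \<alpha>) *\<^sub>R Y) (sqrt \<alpha> *\<^sub>R y) \<in> mat_ball (s + 1) 1"
    using append_col_in_mats[OF sY] by (simp add: mat_ball_def)
qed

lemma single_column:
  assumes y: "norm y \<le> 1"
  shows "append_col 0 0 y \<in> mat_ball 1 1" "gram (append_col 0 0 y) = outer y"
proof -
  have "(norm (append_col 0 0 y))\<^sup>2 = (norm y)\<^sup>2" using norm_append_col[OF zero_in_mats, of 0 y] by simp
  then have "norm (append_col 0 0 y) = norm y" by (rule power2_eq_imp_eq) auto
  then show "append_col 0 0 y \<in> mat_ball 1 1"
    using append_col_in_mats[OF zero_in_mats, of 0 y] y by (simp add: mat_ball_def)
  show "gram (append_col 0 0 y) = outer y" using gram_append_col[OF zero_in_mats, of 0 y] by simp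
qed

text \<open>Convexity replaces the descent lemma, at the cost of a factor \<open>2\<close>; the squared distance of \<open>y y\<^sup>T\<close> and \<open>Y Y\<^sup>T\<close> is at
  most \<open>2\<close>.\<close>

lemma line_descent:
  assumes Y: "Y \<in> mat_ball s 1" and eig: "hlr_eig g Y \<theta> y \<epsilon>k" and a: "0 \<le> \<alpha>" "\<alpha> \<le> 1"
  shows "g (\<alpha> *\<^sub>R outer y + (1 - \<alpha>) *\<^sub>R gram Y) \<le> g (gram Y) - \<alpha> * \<epsilon>k + 2 * Lg * \<alpha>\<^sup>2"
proof -
  have Y1: "norm Y \<le> 1" using Y by (simp add: mat_ball_def)
  note y = eig_norm[OF Y1 eig]
  define Z where "Z = gram Y"
  define Z' where "Z' = \<alpha> *\<^sub>R outer y + (1 - \<alpha>) *\<^sub>R gram Y"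
  have Z': "Z' \<in> spectraplex" "Z' \<in> sym_mats"
  proof -
    have "Z' = gram (append_col s (sqrt (1 - \<alpha>) *\<^sub>R Y) (sqrt \<alpha> *\<^sub>R y))"
      using append_convex(2)[OF Y y a] by (simp add: Z'_def)
    then show "Z' \<in> spectraplex" "Z' \<in> sym_mats"
      using append_convex(1)[OF Y y a] gram_in_spectraplex gram_in_sym by (auto simp: mat_ball_def)
  qed
  have Z: "Z \<in> spectraplex" "Z \<in> sym_mats" using gram_in_spectraplex[OF Y1] gram_in_sym by (auto simp: Z_def)
  have diff: "Z' - Z = \<alpha> *\<^sub>R (outer y - Z)" by (simp add: Z'_def Z_def algebra_simps)
  have "(norm (outer y - Z))\<^sup>2 \<le> 2"
  proof -
    have "norm (outer y) \<le> 1"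
      using norm_gram_le[of "append_col 0 0 y"] single_column[OF y]
      by (simp add: mat_ball_def) (meson norm_ge_zero order_trans power_le_one)
    then have "(norm (outer y))\<^sup>2 \<le> 1" by (simp add: power_le_one)
    moreover have "norm Z \<le> 1" using norm_gram_le[of Y] Y1 power_le_one[of "norm Y" 2] by (simp add: Z_def)
    then have "(norm Z)\<^sup>2 \<le> 1" by (simp add: power_le_one)
    moreover have "0 \<le> Z \<bullet> outer y" using psd_gram[of Y] by (simp add: inner_outer Z_def psd_def)
    moreover have "(norm (outer y - Z))\<^sup>2 = (norm (outer y))\<^sup>2 - 2 * (Z \<bullet> outer y) + (norm Z)\<^sup>2"
      by (simp add: power2_norm_eq_inner inner_diff_left inner_diff_right inner_commute)
    ultimately show ?thesis by linarith
  qed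
  then have sq: "(norm (Z' - Z))\<^sup>2 \<le> 2 * \<alpha>\<^sup>2"
    unfolding diff using mult_left_mono[of "(norm (outer y - Z))\<^sup>2" 2 "\<alpha>\<^sup>2"] by (simp add: power_mult_distrib mult.commute)
  have "g Z' + grad g Z' \<bullet> (Z - Z') \<le> g Z" by (rule grad_inequality[OF Z'(2) Z(2)])
  then have 1: "g Z' \<le> g Z + grad g Z \<bullet> (Z' - Z) + (grad g Z' - grad g Z) \<bullet> (Z' - Z)"
    by (simp add: inner_diff_left inner_diff_right)
  have 2: "grad g Z \<bullet> (Z' - Z) = - (\<alpha> * \<epsilon>k)"
    unfolding diff using eig_gap_eq[OF Y1 eig] by (simp add: Z_def)
  have "(grad g Z' - grad g Z) \<bullet> (Z' - Z) \<le> norm (grad g Z' - grad g Z) * norm (Z' - Z)"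
    by (rule norm_cauchy_schwarz)
  also have "\<dots> \<le> (Lg * norm (Z' - Z)) * norm (Z' - Z)"
    using Lg(2) Z(1) Z'(1) by (intro mult_right_mono) auto
  also have "\<dots> = Lg * (norm (Z' - Z))\<^sup>2" by (simp add: power2_eq_square)
  also have "\<dots> \<le> Lg * (2 * \<alpha>\<^sup>2)" by (rule mult_left_mono[OF sq Lg(1)])
  finally have "g Z' \<le> g Z - \<alpha> * \<epsilon>k + 2 * Lg * \<alpha>\<^sup>2" using 1 2 by simp
  then show ?thesis by (simp only: Z'_def Z_def)
qed

lemma line_search:
  assumes Y: "Y \<in> mat_ball s 1" and eig: "hlr_eig g Y \<theta> y \<epsilon>k" and gt: "\<not> \<epsilon>k \<le> \<epsilon>"
    and min: "is_arg_min (\<lambda>\<alpha>. g (\<alpha> *\<^sub>R outer y + (1 - \<alpha>) *\<^sub>R gram Y)) (\<lambda>\<alpha>. \<alpha> \<in> {0..1}) \<alpha>"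
    and Y': "(Y', s') = (if \<alpha> = 1 then (append_col 0 0 y, 1)
                   else (append_col s (sqrt (1 - \<alpha>) *\<^sub>R Y) (sqrt \<alpha> *\<^sub>R y), s + 1))"
  shows "Y' \<in> mat_ball s' 1" "s' \<le> s + 1" "g (gram Y') \<le> g (gram Y)"
    "fw_decrease (g (gram Y) - g_min g) (g (gram Y') - g_min g)"
proof -
  have Y1: "norm Y \<le> 1" using Y by (simp add: mat_ball_def)
  note y = eig_norm[OF Y1 eig]
  have a: "0 \<le> \<alpha>" "\<alpha> \<le> 1" using min by (auto simp: is_arg_min_def)
  show s': "s' \<le> s + 1" using Y' by (auto split: if_splits)
  show "Y' \<in> mat_ball s' 1"
    using Y' single_column[OF y] append_convex[OF Y y a] by (auto split: if_splits)
  have gr: "gram Y' = \<alpha> *\<^sub>R outer y + (1 - \<alpha>) *\<^sub>R gram Y"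
    using Y' single_column[OF y] append_convex[OF Y y a] by (auto split: if_splits)
  have le: "g (gram Y') \<le> g (\<beta> *\<^sub>R outer y + (1 - \<beta>) *\<^sub>R gram Y)" if "0 \<le> \<beta>" "\<beta> \<le> 1" for \<beta>
    using min that unfolding gr is_arg_min_def by (auto simp: not_less)
  show "g (gram Y') \<le> g (gram Y)" using le[of 0] by simp
  show "fw_decrease (g (gram Y) - g_min g) (g (gram Y') - g_min g)"
    unfolding fw_decrease_def
  proof (intro allI impI)
    fix \<beta> :: real assume b: "0 \<le> \<beta>" "\<beta> \<le> 1"
    have "\<beta> * max \<epsilon> (g (gram Y) - g_min g) \<le> \<beta> * \<epsilon>k"
      using eig_gap_min[OF Y1 eig] gt b by (intro mult_left_mono) auto
    then show "g (gram Y') - g_min g \<le> g (gram Y) - g_min g - \<beta> * max \<epsilon> (g (gram Y) - g_min g) + 2 * Lg * \<beta>\<^sup>2"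
      using le[OF b] line_descent[OF Y eig b] by linarith
  qed
qed

end

section \<open>Runs of HLR\<close>

context hlr
begin

abbreviation hstep :: "'n hlr_state \<Rightarrow> 'n hlr_state \<Rightarrow> bool" where
  "hstep \<equiv> hlr_step \<sigma> chi g \<epsilon> \<rho> lam0"

abbreviation curv :: "nat \<Rightarrow> real" where "curv s \<equiv> curv_bound g Lg s lam0"

abbreviation Q :: "nat \<Rightarrow> real" where "Q s \<equiv> real_of_int (Q_bound g Lg s lam0)"

text \<open>An iteration of ADAP-AIPP that does not stop decreases the objective by at least \<open>1 / K s\<close>.\<close>

definition K :: "nat \<Rightarrow> real" where "K s = C_sigma \<sigma> * curv s / \<rho>\<^sup>2"

lemma curv_bounds: "1 / lam0 \<le> curv s" "8 * grad_bound g s \<le> curv s" "0 < curv s"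
proof -
  show "1 / lam0 \<le> curv s" by (simp add: curv_bound_def)
  then show "0 < curv s" using pos(3) by (meson divide_pos_pos order_less_le_trans zero_less_one)
  show "8 * grad_bound g s \<le> curv s" using Lg(1) by (simp add: curv_bound_def le_max_iff_disj)
qed

lemma K_pos: "0 < K s"
  using C_sigma_pos curv_bounds(3) pos by (simp add: K_def)

lemma Q_nonneg: "0 \<le> Q s"
proof -
  have "0 \<le> log0p (lam0 * curv s) / ln 2" by (simp add: log0p_def)
  then have "0 \<le> Q_bound g Lg s lam0" unfolding Q_bound_def by (simp add: order_less_le_trans[of "-1"])
  then show ?thesis by simp
qed

lemma halvings_le:
  assumes "1 / curv s \<le> lam0 / 2 ^ r"
  shows "real r \<le> Q s"
proof -
  have "2 ^ r \<le> lam0 * curv s"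
    using assms curv_bounds(3)[of s] by (simp add: field_simps)
  then have "ln (2 ^ r) \<le> ln (lam0 * curv s)" by (intro ln_mono) auto
  then have "real r * ln 2 \<le> log0p (lam0 * curv s)" by (simp add: ln_realpow log0p_def)
  then have "real r \<le> log0p (lam0 * curv s) / ln 2" by (simp add: field_simps)
  then show ?thesis unfolding Q_bound_def by linarith
qed

text \<open>The prox parameter is only halved while it is large.\<close>

lemma halving_ok:
  assumes "0 < lam" "\<not> 4 * lam * grad_bound g s \<le> 1" "s \<le> s'"
  shows "1 / curv s' \<le> lam / 2"
proof -
  have "4 * lam * grad_bound g s \<le> 4 * lam * grad_bound g s'"
    using grad_bound_mono[OF assms(3)] assms(1) by (intro mult_left_mono) auto
  also have "\<dots> \<le> lam / 2 * curv s'" using mult_left_mono[OF curv_bounds(2)[of s'], of "lam / 2"] assms(1) by simp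
  finally have "1 \<le> lam / 2 * curv s'" using assms(2) by simp
  then show ?thesis using curv_bounds(3)[of s'] by (simp add: field_simps)
qed

text \<open>The iterate at which a state of ADAP-AIPP has arrived.\<close>

primrec current :: "'n aipp_state \<Rightarrow> 'n cmat" where
  "current (Aipp_Call W lam Mb) = W"
| "current (Aipp_Fista W lam Mb f) = W"
| "current (Aipp_Output Y R) = Y"

text \<open>The optimality gaps after the first \<open>n\<close> Frank-Wolfe steps; \<open>e\<close> bounds the last one.\<close>

definition gap_history :: "nat \<Rightarrow> real \<Rightarrow> bool" where
  "gap_history n e \<longleftrightarrow> (\<exists>h. h 0 \<le> g (gram Y0) - g_min g \<and> (\<forall>j. 0 \<le> h j) \<and>
     (\<forall>j<n. fw_decrease (h j) (h (Suc j))) \<and> e \<le> h n)"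

lemma gap_history_mono: "gap_history n e \<Longrightarrow> e' \<le> e \<Longrightarrow> gap_history n e'"
  unfolding gap_history_def using order_trans by blast

lemma gap_history_Suc:
  assumes "gap_history n e" "fw_decrease e e'" "0 \<le> e'"
  shows "gap_history (Suc n) e'"
proof -
  obtain h where h: "h 0 \<le> g (gram Y0) - g_min g" "\<forall>j. 0 \<le> h j" "\<forall>j<n. fw_decrease (h j) (h (Suc j))" "e \<le> h n"
    using assms(1) unfolding gap_history_def by blast
  show ?thesis
    unfolding gap_history_def
  proof (intro exI[of _ "h(Suc n := e')"] conjI allI impI)
    fix j assume "j < Suc n"
    then show "fw_decrease ((h(Suc n := e')) j) ((h(Suc n := e')) (Suc j))"
      using h(3) fw_decrease_mono[OF assms(2) h(4)] by (auto simp: less_Suc_eq)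
  qed (use h assms(3) in auto)
qed

lemma gap_history_bound:
  assumes "gap_history n e"
  shows "int (Suc n) \<le> iter_bound g Lg Y0 \<epsilon>"
proof -
  define m where "m = Max {g (gram Y0) - g_min g, sqrt (4 * Lg * (g (gram Y0) - g_min g)), 4 * Lg}"
  obtain h where h: "h 0 \<le> g (gram Y0) - g_min g" "\<forall>j. 0 \<le> h j" "\<forall>j<n. fw_decrease (h j) (h (Suc j))"
    using assms unfolding gap_history_def by blast
  have "real n \<le> 4 * m / \<epsilon>"
    by (rule fw_count[of n h]) (use h in \<open>auto simp: m_def\<close>)
  then have "of_int (int (Suc n)) \<le> 1 + 4 * m / \<epsilon>" by simp
  also have "\<dots> \<le> of_int (iter_bound g Lg Y0 \<epsilon>)" unfolding iter_bound_def m_def by (rule le_of_int_ceiling)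
  finally show ?thesis by (simp only: of_int_le_iff)
qed

text \<open>
  The number \<open>calls\<close> of ADAP-FISTA calls since the beginning of HLR, at an iterate \<open>W\<close> of the ADAP-AIPP call
  that follows \<open>n\<close> completed ones; \<open>r\<close> counts the calls that this ADAP-AIPP call has rejected and, while a call
  is running, this call.  Accepted calls are charged to the decrease of the objective, except for the last one of
  every ADAP-AIPP call.  The bound is stated for all column dimensions not smaller than the largest one so far, \<open>mc\<close>, so that
  it survives an increase of \<open>mc\<close>.
\<close>

definition calls_ok :: "nat \<Rightarrow> nat \<Rightarrow> nat \<Rightarrow> real \<Rightarrow> 'n cmat \<Rightarrow> bool" where
  "calls_ok calls mc n r W \<longleftrightarrow>
     (\<forall>s\<ge>mc. real calls \<le> real n * (1 + Q s) + r + K s * (g (gram Y0) - g (gram W)))"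

text \<open>The prox parameter after \<open>r\<close> halvings, and its lower bound.\<close>

definition lam_ok :: "nat \<Rightarrow> real \<Rightarrow> nat \<Rightarrow> bool" where
  "lam_ok mc lam r \<longleftrightarrow> lam = lam0 / 2 ^ r \<and> (\<forall>s\<ge>mc. 1 / curv s \<le> lam)"

text \<open>Invariant of an ADAP-AIPP call, with \<open>n\<close> the number of completed iterations of HLR.\<close>

primrec aipp_inv :: "nat \<Rightarrow> nat \<Rightarrow> nat \<Rightarrow> nat \<Rightarrow> 'n aipp_state \<Rightarrow> bool" where
  "aipp_inv s mc n calls (Aipp_Call W lam Mb) \<longleftrightarrow> W \<in> mat_ball s 1 \<and> 1 \<le> Mb \<and>
     (\<exists>r. lam_ok mc lam r \<and> calls_ok calls mc n (real r) W)"
| "aipp_inv s mc n calls (Aipp_Fista W lam Mb f) \<longleftrightarrow> W \<in> mat_ball s 1 \<and> 1 \<le> Mb \<and>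
     (\<exists>r. lam_ok mc lam r \<and> calls_ok calls mc n (real r + 1) W) \<and>
     (\<exists>M\<ge>1. (fstep s lam W)\<^sup>*\<^sup>* (fista_init W M) f)"
| "aipp_inv s mc n calls (Aipp_Output Y R) \<longleftrightarrow> Y \<in> mat_ball s 1 \<and> calls_ok calls mc (Suc n) 0 Y"

lemma lam_pos: "lam_ok mc lam r \<Longrightarrow> 0 < lam"
  using pos by (simp add: lam_ok_def)

lemma lam_ok_halve:
  assumes "lam_ok mc lam r" "\<not> 4 * lam * grad_bound g s \<le> 1" "s \<le> mc"
  shows "lam_ok mc (lam / 2) (Suc r)"
  unfolding lam_ok_def
proof (intro conjI allI impI)
  show "lam / 2 = lam0 / 2 ^ Suc r" using assms(1) by (simp add: lam_ok_def)
  fix s' assume "mc \<le> s'"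
  then show "1 / curv s' \<le> lam / 2"
    using assms(3) by (intro halving_ok[OF lam_pos[OF assms(1)] assms(2)]) simp
qed

lemma aipp_inv_step:
  assumes inv: "aipp_inv s mc n calls p" and s: "s \<le> mc" and st: "aipp_step \<sigma> chi g s \<rho> p p'"
  shows "aipp_inv s mc n (calls + (case p of Aipp_Call W lam Mb \<Rightarrow> 1 | _ \<Rightarrow> 0)) p'
    \<and> g (gram (current p')) \<le> g (gram (current p))"
  using st
proof (cases rule: aipp_step.cases)
  case (call_fista M Mb W lam)
  have "calls_ok (calls + 1) mc n (real r + 1) W" if "calls_ok calls mc n (real r) W" for r
    using that by (auto simp: calls_ok_def)
  then show ?thesis using inv call_fista by (auto intro!: exI[of _ M])
next
  case (run_fista W lam f f' Mb)
  then show ?thesis using inv by (auto intro: rtranclp.rtrancl_into_rtrancl)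
next
  case (fista_failed W lam Mb)
  obtain r M where r: "W \<in> mat_ball s 1" "1 \<le> Mb" "lam_ok mc lam r" "calls_ok calls mc n (real r + 1) W"
    "1 \<le> M" "(fstep s lam W)\<^sup>*\<^sup>* (fista_init W M) Fista_Failure"
    using inv fista_failed by auto
  have "\<not> 4 * lam * grad_bound g s \<le> 1"
    using fista_small_lam(1)[OF lam_pos[OF r(3)] _ r(1,5,6)] by blast
  then have "lam_ok mc (lam / 2) (Suc r)" using lam_ok_halve r(3) s by blast
  moreover have "calls_ok calls mc n (real (Suc r)) W" using r(4) by (simp add: add.commute)
  ultimately show ?thesis using fista_failed r by auto
next
  case (reject lam W W' V Mb L)
  obtain r M where r: "W \<in> mat_ball s 1" "1 \<le> Mb" "lam_ok mc lam r" "calls_ok calls mc n (real r + 1) W"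
    "1 \<le> M" "(fstep s lam W)\<^sup>*\<^sup>* (fista_init W M) (Fista_Success W' V L)"
    using inv reject by auto
  have "\<not> 4 * lam * grad_bound g s \<le> 1"
    using fista_small_lam(2)[OF lam_pos[OF r(3)] _ r(1,5,6) refl] reject by blast
  then have "lam_ok mc (lam / 2) (Suc r)" using lam_ok_halve r(3) s by blast
  moreover have "calls_ok calls mc n (real (Suc r)) W" using r(4) by (simp add: add.commute)
  ultimately show ?thesis using reject r by auto
next
  case (stop lam W W' V R Mb L)
  obtain r M where r: "W \<in> mat_ball s 1" "1 \<le> Mb" "lam_ok mc lam r" "calls_ok calls mc n (real r + 1) W"
    "1 \<le> M" "(fstep s lam W)\<^sup>*\<^sup>* (fista_init W M) (Fista_Success W' V L)"
    using inv stop by auto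
  note succ = fista_success[OF lam_pos[OF r(3)] r(1,5,6)]
  have le: "g (gram W') \<le> g (gram W)" by (rule accept_descends[OF lam_pos[OF r(3)] stop(3) succ(2)])
  have "calls_ok calls mc (Suc n) 0 W'"
    unfolding calls_ok_def
  proof (intro allI impI)
    fix s' assume s': "mc \<le> s'"
    have "real r \<le> Q s'" by (rule halvings_le) (use r(3) s' in \<open>auto simp: lam_ok_def\<close>)
    moreover have "K s' * (g (gram Y0) - g (gram W)) \<le> K s' * (g (gram Y0) - g (gram W'))"
      using K_pos[of s'] le by (intro mult_left_mono) auto
    moreover have "real calls \<le> real n * (1 + Q s') + (real r + 1) + K s' * (g (gram Y0) - g (gram W))"
      using r(4) s' by (auto simp: calls_ok_def)
    ultimately show "real calls \<le> real (Suc n) * (1 + Q s') + 0 + K s' * (g (gram Y0) - g (gram W'))"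
      by (simp add: distrib_right)
  qed
  then show ?thesis using stop succ le by auto
next
  case (accept lam W W' V Mb L)
  obtain r M where r: "W \<in> mat_ball s 1" "1 \<le> Mb" "lam_ok mc lam r" "calls_ok calls mc n (real r + 1) W"
    "1 \<le> M" "(fstep s lam W)\<^sup>*\<^sup>* (fista_init W M) (Fista_Success W' V L)"
    using inv accept by auto
  note lam = lam_pos[OF r(3)]
  note succ = fista_success[OF lam r(1,5,6)]
  have le: "g (gram W') \<le> g (gram W)" by (rule accept_descends[OF lam accept(3) succ(2)])
  have "calls_ok calls mc n (real r) W'"
    unfolding calls_ok_def
  proof (intro allI impI)
    fix s' assume s': "mc \<le> s'"
    \<comment> \<open>an iteration that does not stop decreases the objective by at least \<open>1 / K s'\<close>\<close>
    have "1 \<le> K s' * (g (gram W) - g (gram W'))"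
    proof -
      have "\<rho>\<^sup>2 \<le> (norm (aipp_residual lam W W' V))\<^sup>2" using accept(4) pos(2) by (intro power_mono) auto
      then have "1 / curv s' * \<rho>\<^sup>2 \<le> lam * (norm (aipp_residual lam W W' V))\<^sup>2"
        using r(3) s' lam by (intro mult_mono) (auto simp: lam_ok_def)
      also have "\<dots> \<le> C_sigma \<sigma> * (g (gram W) - g (gram W'))"
        by (rule residual_descent[OF lam accept(3) succ(2)])
      finally show ?thesis using curv_bounds(3)[of s'] pos(2) by (simp add: K_def field_simps)
    qed
    moreover have "real calls \<le> real n * (1 + Q s') + (real r + 1) + K s' * (g (gram Y0) - g (gram W))"
      using r(4) s' by (auto simp: calls_ok_def)
    ultimately show "real calls \<le> real n * (1 + Q s') + real r + K s' * (g (gram Y0) - g (gram W'))"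
      by (simp add: right_diff_distrib)
  qed
  then show ?thesis using accept r succ le by auto
qed

text \<open>Invariant of HLR.  One minimum eigenvector computation ends every iteration.\<close>

definition hinv :: "'n hlr_state \<Rightarrow> bool" where
  "hinv st \<longleftrightarrow> cols st \<le> max_cols st \<and> max_cols st \<le> s0 + iter st \<and>
     (case phase st of
        Hlr_Aipp p \<Rightarrow> iter st = Suc (eig_comps st) \<and>
          aipp_inv (cols st) (max_cols st) (eig_comps st) (fista_calls st) p \<and>
          gap_history (eig_comps st) (g (gram (current p)) - g_min g)
      | Hlr_Output Y \<theta> \<Rightarrow> iter st = eig_comps st \<and> int (iter st) \<le> iter_bound g Lg Y0 \<epsilon> \<and>
          eps_optimal g \<epsilon> (gram Y) \<and> calls_ok (fista_calls st) (max_cols st) (iter st) 0 Y)"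

lemma gap_nonneg: "W \<in> mat_ball s 1 \<Longrightarrow> 0 \<le> g (gram W) - g_min g"
  using g_min_le[OF gram_in_spectraplex] by (simp add: mat_ball_def)

lemma lam_ok_init: "lam_ok mc lam0 0"
  using curv_bounds(1) pos(3) curv_bounds(3) by (simp add: lam_ok_def field_simps)

lemma hinv_init: "hinv (hlr_init s0 Y0 lam0)"
proof -
  have "gap_history 0 (g (gram Y0) - g_min g)"
    unfolding gap_history_def using gap_nonneg[OF Y0] by (intro exI[of _ "\<lambda>_. g (gram Y0) - g_min g"]) auto
  moreover have "calls_ok 0 s0 0 0 Y0" by (simp add: calls_ok_def)
  ultimately show ?thesis
    using Y0 lam_ok_init[of s0] by (auto simp: hinv_def hlr_init_def aipp_init_def intro!: exI[of _ 0])
qed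

lemma hinv_step:
  assumes inv: "hinv st" and st: "hstep st st'"
  shows "hinv st'"
  using st
proof (cases rule: hlr_step.cases)
  case (run_aipp p p' calls)
  have i: "cols st \<le> max_cols st" "max_cols st \<le> s0 + iter st" "iter st = Suc (eig_comps st)"
    "aipp_inv (cols st) (max_cols st) (eig_comps st) (fista_calls st) p"
    "gap_history (eig_comps st) (g (gram (current p)) - g_min g)"
    using inv run_aipp by (auto simp: hinv_def)
  have "aipp_inv (cols st) (max_cols st) (eig_comps st) (fista_calls st + calls) p'"
    "g (gram (current p')) \<le> g (gram (current p))"
    using aipp_inv_step[OF i(4,1) run_aipp(3)] run_aipp(4) by auto
  then show ?thesis
    using i gap_history_mono[OF i(5), of "g (gram (current p')) - g_min g"] run_aipp by (simp add: hinv_def)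
next
  case (hlr_stop Y R \<theta> y \<epsilon>k)
  have i: "cols st \<le> max_cols st" "max_cols st \<le> s0 + iter st" "iter st = Suc (eig_comps st)"
    "Y \<in> mat_ball (cols st) 1" "calls_ok (fista_calls st) (max_cols st) (Suc (eig_comps st)) 0 Y"
    "gap_history (eig_comps st) (g (gram Y) - g_min g)"
    using inv hlr_stop by (auto simp: hinv_def)
  have "eps_optimal g \<epsilon> (gram Y)"
    by (rule eig_stop_optimal[OF _ hlr_stop(3,4)]) (use i in \<open>simp add: mat_ball_def\<close>)
  then show ?thesis using i gap_history_bound[OF i(6)] hlr_stop by (simp add: hinv_def)
next
  case (hlr_next Y R \<theta> y \<epsilon>k \<alpha> Y' s')
  have i: "cols st \<le> max_cols st" "max_cols st \<le> s0 + iter st" "iter st = Suc (eig_comps st)"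
    "Y \<in> mat_ball (cols st) 1" "calls_ok (fista_calls st) (max_cols st) (Suc (eig_comps st)) 0 Y"
    "gap_history (eig_comps st) (g (gram Y) - g_min g)"
    using inv hlr_next by (auto simp: hinv_def)
  note ls = line_search[OF i(4) hlr_next(3,4,5,6)]
  have "gap_history (Suc (eig_comps st)) (g (gram Y') - g_min g)"
    by (rule gap_history_Suc[OF i(6) ls(4) gap_nonneg[OF ls(1)]])
  moreover have "calls_ok (fista_calls st) (max (max_cols st) s') (Suc (eig_comps st)) 0 Y'"
    unfolding calls_ok_def
  proof (intro allI impI)
    fix s assume s: "max (max_cols st) s' \<le> s"
    then have "real (fista_calls st) \<le> real (Suc (eig_comps st)) * (1 + Q s) + 0 + K s * (g (gram Y0) - g (gram Y))"
      using i(5) by (auto simp: calls_ok_def)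
    moreover have "K s * (g (gram Y0) - g (gram Y)) \<le> K s * (g (gram Y0) - g (gram Y'))"
      using K_pos[of s] ls(3) by (intro mult_left_mono) auto
    ultimately show "real (fista_calls st) \<le> real (Suc (eig_comps st)) * (1 + Q s) + 0 + K s * (g (gram Y0) - g (gram Y'))"
      by linarith
  qed
  ultimately show ?thesis
    using i ls lam_ok_init hlr_next by (auto simp: hinv_def aipp_init_def intro!: exI[of _ 0])
qed

lemma hinv_reachable: "hstep\<^sup>*\<^sup>* (hlr_init s0 Y0 lam0) st \<Longrightarrow> hinv st"
  by (induction rule: rtranclp_induct) (auto intro: hinv_init hinv_step)

lemma aipp_progress:
  assumes "aipp_inv s mc n calls p" "\<nexists>Y R. p = Aipp_Output Y R"
  shows "\<exists>p'. aipp_step \<sigma> chi g s \<rho> p p'"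
proof (cases p)
  case (Aipp_Call W lam Mb)
  then have "1 \<le> Mb" using assms by simp
  then show ?thesis using aipp_step.call_fista[of 1 Mb] Aipp_Call by blast
next
  case (Aipp_Fista W lam Mb f)
  obtain r M where r: "W \<in> mat_ball s 1" "lam_ok mc lam r" "1 \<le> M" "(fstep s lam W)\<^sup>*\<^sup>* (fista_init W M) f"
    using assms Aipp_Fista by auto
  show ?thesis
  proof (cases f)
    case (Fista_Search y x A \<tau> L)
    then obtain f' where "fstep s lam W f f'" using fista_progress[OF lam_pos[OF r(2)] r(1,3)] r(4) by blast
    then show ?thesis using aipp_step.run_fista Aipp_Fista by blast
  next
    case (Fista_Success W' V L)
    show ?thesis
    proof (cases "aipp_accepts g lam W W' V")
      case True
      show ?thesis
      proof (cases "norm (aipp_residual lam W W' V) \<le> \<rho>")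
        case True
        from aipp_step.stop[OF \<open>aipp_accepts g lam W W' V\<close> refl this] show ?thesis
          unfolding Aipp_Fista Fista_Success by blast
      next
        case False
        from aipp_step.accept[OF \<open>aipp_accepts g lam W W' V\<close> this] show ?thesis
          unfolding Aipp_Fista Fista_Success by blast
      qed
    next
      case False
      from aipp_step.reject[OF this] show ?thesis unfolding Aipp_Fista Fista_Success by blast
    qed
  next
    case Fista_Failure
    then show ?thesis unfolding Aipp_Fista using aipp_step.fista_failed by blast
  qed
next
  case (Aipp_Output Y R)
  then show ?thesis using assms by blast
qed

lemma eig_exists: "\<exists>\<theta> y \<epsilon>k. hlr_eig g Y \<theta> y \<epsilon>k"
proof -
  define G where "G = grad g (gram Y)"
  obtain v where v: "is_eigenpair G (lambda_min G) v" "norm v = 1"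
    using lambda_min_eigenpair[of G] grad_in_sym[OF gram_in_sym] by (auto simp: G_def)
  define \<theta> where "\<theta> = max (- lambda_min G) 0"
  have "hlr_eig g Y \<theta> (if 0 < \<theta> then v else 0) (left_mult G Y \<bullet> Y + \<theta>)"
    using v by (simp add: hlr_eig_def Let_def G_def[symmetric] \<theta>_def)
  then show ?thesis by blast
qed

lemma line_search_exists:
  "\<exists>\<alpha>. is_arg_min (\<lambda>\<alpha>. g (\<alpha> *\<^sub>R outer y + (1 - \<alpha>) *\<^sub>R gram Y)) (\<lambda>\<alpha>. \<alpha> \<in> {0..1}) \<alpha>"
proof -
  have "outer y \<in> sym_mats" by (simp add: outer_def sym_mats_def transpose_def vec_eq_iff mult.commute)
  then have "\<alpha> *\<^sub>R outer y + (1 - \<alpha>) *\<^sub>R gram Y \<in> sym_mats" for \<alpha>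
    by (simp add: subspace_add subspace_scale subspace_sym_mats gram_in_sym)
  then have "continuous_on {0..1} (\<lambda>\<alpha>. g (\<alpha> *\<^sub>R outer y + (1 - \<alpha>) *\<^sub>R gram Y))"
    by (intro continuous_on_compose2[OF differentiable_imp_continuous_on[OF differentiable]] continuous_intros) auto
  then have "\<exists>\<alpha>\<in>{0..1}. \<forall>\<beta>\<in>{0..1}.
     g (\<alpha> *\<^sub>R outer y + (1 - \<alpha>) *\<^sub>R gram Y) \<le> g (\<beta> *\<^sub>R outer y + (1 - \<beta>) *\<^sub>R gram Y)"
    by (intro continuous_attains_inf) auto
  then obtain \<alpha> where "\<alpha> \<in> {0..1}" and "\<forall>\<beta>\<in>{0..1}.
     g (\<alpha> *\<^sub>R outer y + (1 - \<alpha>) *\<^sub>R gram Y) \<le> g (\<beta> *\<^sub>R outer y + (1 - \<beta>) *\<^sub>R gram Y)" ..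
  then show ?thesis unfolding is_arg_min_def by (intro exI[of _ \<alpha>] conjI notI) (auto dest: bspec simp: not_less[symmetric])
qed

lemma hlr_progress:
  assumes inv: "hinv st" and run: "phase st = Hlr_Aipp p"
  shows "\<exists>st'. hstep st st'"
proof (cases "\<exists>Y R. p = Aipp_Output Y R")
  case False
  then obtain p' where "aipp_step \<sigma> chi g (cols st) \<rho> p p'"
    using aipp_progress inv run by (fastforce simp: hinv_def)
  from hlr_step.run_aipp[OF run this refl] show ?thesis by blast
next
  case True
  then obtain Y R where p: "phase st = Hlr_Aipp (Aipp_Output Y R)" using run by blast
  obtain \<theta> y \<epsilon>k where eig: "hlr_eig g Y \<theta> y \<epsilon>k" using eig_exists by blast
  show ?thesis
  proof (cases "\<epsilon>k \<le> \<epsilon>")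
    case True
    from hlr_step.hlr_stop[OF p eig this] show ?thesis by blast
  next
    case False
    obtain \<alpha> where \<alpha>: "is_arg_min (\<lambda>\<alpha>. g (\<alpha> *\<^sub>R outer y + (1 - \<alpha>) *\<^sub>R gram Y)) (\<lambda>\<alpha>. \<alpha> \<in> {0..1}) \<alpha>"
      using line_search_exists by blast
    obtain Y' s' where "(Y', s') = (if \<alpha> = 1 then (append_col 0 0 y, 1)
        else (append_col (cols st) (sqrt (1 - \<alpha>) *\<^sub>R Y) (sqrt \<alpha> *\<^sub>R y), cols st + 1))"
      by (metis surj_pair)
    from hlr_step.hlr_next[OF p eig False \<alpha> this] show ?thesis by blast
  qed
qed

text \<open>The numbers of iterations and of ADAP-FISTA calls are bounded along all runs.\<close>

lemma work_bounded: "\<exists>B. \<forall>st. hinv st \<longrightarrow> iter st + fista_calls st \<le> B"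
proof -
  define I where "I = nat (iter_bound g Lg Y0 \<epsilon>)"
  define s where "s = s0 + I"
  define R where "R = real I * (1 + Q s) + (Q s + 1) + K s * (g (gram Y0) - g_min g)"
  have calls: "real calls \<le> R"
    if "calls_ok calls mc n r W" "mc \<le> s" "n \<le> I" "r \<le> Q s + 1" "W \<in> mat_ball c 1" for calls mc n r W c
  proof -
    have "real calls \<le> real n * (1 + Q s) + r + K s * (g (gram Y0) - g (gram W))"
      using that by (auto simp: calls_ok_def)
    moreover have "real n * (1 + Q s) \<le> real I * (1 + Q s)" using that Q_nonneg[of s] by (intro mult_right_mono) auto
    moreover have "K s * (g (gram Y0) - g (gram W)) \<le> K s * (g (gram Y0) - g_min g)"
      using K_pos[of s] gap_nonneg[OF that(5)] by (intro mult_left_mono) auto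
    ultimately show ?thesis using that unfolding R_def by linarith
  qed
  have "iter st + fista_calls st \<le> I + nat \<lceil>R\<rceil>" if inv: "hinv st" for st
  proof -
    have "iter st \<le> I \<and> real (fista_calls st) \<le> R"
    proof (cases "phase st")
      case (Hlr_Aipp p)
      have i: "max_cols st \<le> s0 + iter st" "iter st = Suc (eig_comps st)"
        "aipp_inv (cols st) (max_cols st) (eig_comps st) (fista_calls st) p"
        "gap_history (eig_comps st) (g (gram (current p)) - g_min g)"
        using inv Hlr_Aipp by (auto simp: hinv_def)
      have "int (iter st) \<le> iter_bound g Lg Y0 \<epsilon>" using gap_history_bound[OF i(4)] i(2) by simp
      then have I: "iter st \<le> I" by (simp add: I_def)
      then have mc: "max_cols st \<le> s" using i(1) by (simp add: s_def)
      have r: "real r \<le> Q s" if "lam_ok (max_cols st) lam r" for lam r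
        by (rule halvings_le) (use that mc in \<open>auto simp: lam_ok_def\<close>)
      have "real (fista_calls st) \<le> R"
      proof (cases p)
        case (Aipp_Call W lam Mb)
        then obtain r' where "W \<in> mat_ball (cols st) 1" "lam_ok (max_cols st) lam r'"
          "calls_ok (fista_calls st) (max_cols st) (eig_comps st) (real r') W" using i(3) by auto
        then show ?thesis using calls[OF _ mc] I i(2) r[of lam r'] by fastforce
      next
        case (Aipp_Fista W lam Mb f)
        then obtain r' where "W \<in> mat_ball (cols st) 1" "lam_ok (max_cols st) lam r'"
          "calls_ok (fista_calls st) (max_cols st) (eig_comps st) (real r' + 1) W" using i(3) by auto
        then show ?thesis using calls[OF _ mc] I i(2) r[of lam r'] by fastforce
      next
        case (Aipp_Output Y R)
        then have "Y \<in> mat_ball (cols st) 1" "calls_ok (fista_calls st) (max_cols st) (Suc (eig_comps st)) 0 Y"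
          using i(3) by auto
        then show ?thesis using calls[OF _ mc] I i(2) Q_nonneg[of s] by fastforce
      qed
      with I show ?thesis by simp
    next
      case (Hlr_Output Y \<theta>)
      have i: "max_cols st \<le> s0 + iter st" "int (iter st) \<le> iter_bound g Lg Y0 \<epsilon>"
        "calls_ok (fista_calls st) (max_cols st) (iter st) 0 Y" "gram Y \<in> spectraplex"
        using inv Hlr_Output by (auto simp: hinv_def eps_optimal_def)
      have I: "iter st \<le> I" using i(2) by (simp add: I_def)
      then have mc: "max_cols st \<le> s" using i(1) by (simp add: s_def)
      have "real (fista_calls st) \<le> real (iter st) * (1 + Q s) + 0 + K s * (g (gram Y0) - g (gram Y))"
        using i(3) mc by (auto simp: calls_ok_def)
      moreover have "real (iter st) * (1 + Q s) \<le> real I * (1 + Q s)" using I Q_nonneg[of s] by (intro mult_right_mono) auto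
      moreover have "K s * (g (gram Y0) - g (gram Y)) \<le> K s * (g (gram Y0) - g_min g)"
        using K_pos[of s] g_min_le[OF i(4)] by (intro mult_left_mono) auto
      ultimately show ?thesis using I Q_nonneg[of s] unfolding R_def by linarith
    qed
    then have "real (fista_calls st) \<le> real_of_int \<lceil>R\<rceil>" "iter st \<le> I" using le_of_int_ceiling[of R] by linarith+
    then show ?thesis by linarith
  qed
  then show ?thesis by blast
qed

text \<open>
  So an infinite run would end in an infinite run of a single ADAP-FISTA call.
\<close>

lemma hlr_terminates:
  assumes start: "run 0 = hlr_init s0 Y0 lam0" and step: "\<And>i. hstep (run i) (run (Suc i))"
  shows False
proof -
  have inv: "hinv (run i)" for i
    by (induction i) (use start hinv_init hinv_step step in auto)
  define N where "N i = iter (run i) + fista_calls (run i)" for i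
  have mono: "N i \<le> N (Suc i)" for i
    using step[of i] by (cases rule: hlr_step.cases) (auto simp: N_def)
  obtain B where B: "\<And>i. N i \<le> B" using work_bounded inv unfolding N_def by blast
  obtain n0 where n0: "\<And>i. n0 \<le> i \<Longrightarrow> N (Suc i) = N i"
  proof -
    define m where "m = Max (range N)"
    have fin: "finite (range N)" using B by (auto intro: finite_subset[of _ "{..B}"])
    then have "m \<in> range N" unfolding m_def by (rule Max_in) simp
    then obtain n0 where n0: "N n0 = m" by auto
    have "N i = m" if "n0 \<le> i" for i
    proof (rule antisym)
      show "N i \<le> m" unfolding m_def using fin by simp
      show "m \<le> N i" unfolding n0[symmetric] by (rule lift_Suc_mono_le[of N]) (use mono that in auto)
    qed
    then show ?thesis using that[of n0] by simp
  qed
  have fista: "\<exists>W lam Mb f. phase (run i) = Hlr_Aipp (Aipp_Fista W lam Mb f)" if i: "n0 \<le> i" for i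
    using step[of i]
  proof (cases rule: hlr_step.cases)
    case (run_aipp p p' calls)
    show ?thesis
    proof (cases p)
      case (Aipp_Call W lam Mb)
      then have "N (Suc i) = N i + 1" using run_aipp by (simp add: N_def)
      then show ?thesis using n0[OF i] by simp
    next
      case (Aipp_Output Y R)
      then show ?thesis using run_aipp by (auto elim: aipp_step.cases)
    qed (use run_aipp in auto)
  next
    case (hlr_stop Y R \<theta> y \<epsilon>k)
    then have "phase (run (Suc i)) = Hlr_Output Y \<theta>" by simp
    then show ?thesis using step[of "Suc i"] by (auto elim: hlr_step.cases)
  next
    case (hlr_next Y R \<theta> y \<epsilon>k \<alpha> Y' s')
    then have "N (Suc i) = N i + 1" by (simp add: N_def)
    then show ?thesis using n0[OF i] by simp
  qed
  have next_fista: "\<exists>f'. phase (run (Suc i)) = Hlr_Aipp (Aipp_Fista W lam Mb f') \<and> fstep (cols (run i)) lam W f f' \<and>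
     cols (run (Suc i)) = cols (run i)"
    if i: "n0 \<le> i" and p: "phase (run i) = Hlr_Aipp (Aipp_Fista W lam Mb f)" for i W lam Mb f
    using step[of i]
  proof (cases rule: hlr_step.cases)
    case (run_aipp q q' calls)
    obtain W' lam' Mb' f' where q': "q' = Aipp_Fista W' lam' Mb' f'"
      using fista[of "Suc i"] i run_aipp by auto
    have "q = Aipp_Fista W lam Mb f" using p run_aipp by simp
    with run_aipp(3) q' show ?thesis using run_aipp by (auto elim: aipp_step.cases)
  qed (use p in auto)
  obtain W lam Mb f0 where p0: "phase (run n0) = Hlr_Aipp (Aipp_Fista W lam Mb f0)" using fista by blast
  define s where "s = cols (run n0)"
  have all: "\<exists>f. phase (run (n0 + k)) = Hlr_Aipp (Aipp_Fista W lam Mb f) \<and> cols (run (n0 + k)) = s" for k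
  proof (induction k)
    case (Suc k)
    then show ?case using next_fista[of "n0 + k"] by fastforce
  qed (use p0 s_def in simp)
  then obtain F where F: "\<And>k. phase (run (n0 + k)) = Hlr_Aipp (Aipp_Fista W lam Mb (F k)) \<and> cols (run (n0 + k)) = s"
    by metis
  have "fstep s lam W (F k) (F (Suc k))" for k
    using next_fista[of "n0 + k" W lam Mb "F k"] F[of k] F[of "Suc k"] by auto
  moreover obtain r M where "W \<in> mat_ball s 1" "lam_ok (max_cols (run n0)) lam r" "1 \<le> M"
    "(fstep s lam W)\<^sup>*\<^sup>* (fista_init W M) (F 0)"
    using inv[of n0] F[of 0] by (auto simp: hinv_def)
  ultimately show False using fista_no_infinite_run[of lam W s M F] lam_pos by blast
qed

lemma hlr_output:
  assumes reach: "hstep\<^sup>*\<^sup>* (hlr_init s0 Y0 lam0) st" and out: "phase st = Hlr_Output Y \<theta>"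
  shows "eps_optimal g \<epsilon> (gram Y)" "int (iter st) \<le> iter_bound g Lg Y0 \<epsilon>"
    "int (eig_comps st) \<le> iter_bound g Lg Y0 \<epsilon>"
    "real (fista_calls st) \<le> real_of_int ((1 + Q_bound g Lg (max_cols st) lam0) * iter_bound g Lg Y0 \<epsilon>)
       + C_sigma \<sigma> * curv_bound g Lg (max_cols st) lam0 / \<rho>\<^sup>2 * (g (gram Y0) - g (gram Y))"
proof -
  have i: "iter st = eig_comps st" "int (iter st) \<le> iter_bound g Lg Y0 \<epsilon>" "eps_optimal g \<epsilon> (gram Y)"
    "calls_ok (fista_calls st) (max_cols st) (iter st) 0 Y"
    using hinv_reachable[OF reach] out by (auto simp: hinv_def)
  then show "eps_optimal g \<epsilon> (gram Y)" "int (iter st) \<le> iter_bound g Lg Y0 \<epsilon>"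
    "int (eig_comps st) \<le> iter_bound g Lg Y0 \<epsilon>" by auto
  have "real (iter st) \<le> real_of_int (iter_bound g Lg Y0 \<epsilon>)" using i(2) by linarith
  then have "real (iter st) * (1 + Q (max_cols st)) \<le> real_of_int (iter_bound g Lg Y0 \<epsilon>) * (1 + Q (max_cols st))"
    using Q_nonneg[of "max_cols st"] by (intro mult_right_mono) auto
  then show "real (fista_calls st) \<le> real_of_int ((1 + Q_bound g Lg (max_cols st) lam0) * iter_bound g Lg Y0 \<epsilon>)
       + C_sigma \<sigma> * curv_bound g Lg (max_cols st) lam0 / \<rho>\<^sup>2 * (g (gram Y0) - g (gram Y))"
    using i(4) by (auto simp: calls_ok_def K_def mult.commute)
qed

end

theorem theorem2p5:
  fixes g :: "real^'n^'n \<Rightarrow> real"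
    and Lg \<epsilon> \<rho> lam0 \<sigma> chi :: real
    and s0 :: nat
    and Y0 :: "'n cmat"
  assumes "0 < \<sigma>" "\<sigma> < 1 / 2" and "0 < chi" "chi < 1"
    and "convex_on sym_mats g"
    and "g differentiable_on sym_mats"
    and "0 \<le> Lg"
    and "\<forall>Z\<in>spectraplex. \<forall>Z'\<in>spectraplex. norm (grad g Z' - grad g Z) \<le> Lg * norm (Z' - Z)"
    and "1 \<le> s0" and "Y0 \<in> mat_ball s0 1"
    and "0 < \<epsilon>" "0 < \<rho>" "0 < lam0"
  shows
    "(\<nexists>run. run 0 = hlr_init s0 Y0 lam0 \<and>
        (\<forall>i::nat. hlr_step \<sigma> chi g \<epsilon> \<rho> lam0 (run i) (run (Suc i)))) \<and>
     (\<forall>st. (hlr_step \<sigma> chi g \<epsilon> \<rho> lam0)\<^sup>*\<^sup>* (hlr_init s0 Y0 lam0) st \<longrightarrow>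
        (\<exists>Y \<theta>. phase st = Hlr_Output Y \<theta>) \<or> (\<exists>st'. hlr_step \<sigma> chi g \<epsilon> \<rho> lam0 st st')) \<and>
     (\<forall>st Y \<theta>. (hlr_step \<sigma> chi g \<epsilon> \<rho> lam0)\<^sup>*\<^sup>* (hlr_init s0 Y0 lam0) st \<longrightarrow>
        phase st = Hlr_Output Y \<theta> \<longrightarrow>
        eps_optimal g \<epsilon> (gram Y) \<and>
        int (iter st) \<le> iter_bound g Lg Y0 \<epsilon> \<and>
        int (eig_comps st) \<le> iter_bound g Lg Y0 \<epsilon> \<and>
        real (fista_calls st) \<le>
          real_of_int ((1 + Q_bound g Lg (max_cols st) lam0) * iter_bound g Lg Y0 \<epsilon>)
          + C_sigma \<sigma> * curv_bound g Lg (max_cols st) lam0 / \<rho>\<^sup>2 * (g (gram Y0) - g (gram Y)))"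
proof -
  interpret hlr g Lg \<epsilon> \<rho> lam0 \<sigma> chi s0 Y0
    by unfold_locales (use assms in auto)
  show ?thesis
  proof (intro conjI allI impI)
    show "\<nexists>run. run 0 = hlr_init s0 Y0 lam0 \<and> (\<forall>i::nat. hstep (run i) (run (Suc i)))"
      using hlr_terminates by blast
    fix st assume reach: "hstep\<^sup>*\<^sup>* (hlr_init s0 Y0 lam0) st"
    show "(\<exists>Y \<theta>. phase st = Hlr_Output Y \<theta>) \<or> (\<exists>st'. hstep st st')"
      using hlr_progress[OF hinv_reachable[OF reach]] by (cases "phase st") auto
  qed (use hlr_output in auto)
qed

end
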